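(* Let $(R,\mathfrak m,k)$ be a commutative noetherian local ring that is not Gorenstein and satisfies $\mathfrak m^3=0\neq\mathfrak m^2$. Set $e=\operatorname{rank}_k\mathfrak m/\mathfrak m^2$. If $A$ is a non-zero minimal acyclic complex of finitely generated free $R$-modules, with differentials $\partial_i\colon A_i\to A_{i-1}$, then one of the following holds: (I) The residue field $k$ is not a direct summand of $\operatorname{Coker}\partial_i$ for any $i\in\mathbb Z$, and there is a positive integer $a$ such that $$a=\operatorname{rank}_R A_i\quad\text{for all } i\in\mathbb Z.$$ Moreover, $\operatorname{length}_R\operatorname{Coker}\partial_i=ae$ for all $i\in\mathbb Z$. (II) There is an integer $\varkappa$ such that $k$ is a direct summand of $\operatorname{Coker}\partial_{\varkappa+2}$ and not of $\operatorname{Coker}\partial_{i+2}$ for any $i<\varkappa$, and a positive integer $a$ such that $$a=\operatorname{rank}_R A_i\quad\text{for all integers } i\le\varkappa,\qquad\text{and}$$ $$\operatorname{rank}_R A_{i+1}>\operatorname{rank}_R A_i\quad\text{for all integers } i\ge\varkappa.$$ Moreover, $\operatorname{length}_R\operatorname{Coker}\partial_{i+2}=ae$ for all integers $i\le\varkappa$.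
   Context: A complex $A=\cdots\to A_{i+1}\xrightarrow{\partial_{i+1}}A_i\xrightarrow{\partial_i}A_{i-1}\to\cdots$ (indexed by all $i\in\mathbb Z$) of finitely generated free $R$-modules is acyclic if all its homology modules vanish, and minimal if $\partial_i(A_i)\subseteq\mathfrak m A_{i-1}$ for all $i$. Here $\operatorname{Coker}\partial_i=A_{i-1}/\partial_i(A_i)$. *)

theory Defs
  imports
    "Jordan_Normal_Form.Missing_VectorSpace"
    "HOL-Algebra.Ring_Divisibility"
    "HOL-Algebra.Ideal_Product"
    "HOL-Library.Extended_Nat"
begin

definition ring_as_module :: "('a, 'r) ring_scheme \<Rightarrow> ('a, 'a) module" where
  "ring_as_module R =
    \<lparr>carrier = carrier R, monoid.mult = monoid.mult R, one = one R, zero = zero R, add = add R, smult = monoid.mult R\<rparr>"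

text \<open>The fields \<open>mult\<close> and \<open>one\<close> of a module record carry no information and are filled arbitrarily.\<close>

definition quotient_module :: "('a, 'b, 'c) module_scheme \<Rightarrow> 'b set \<Rightarrow> ('a, 'b set) module" where
  "quotient_module M N =
    \<lparr>carrier = a_rcosets\<^bsub>M\<^esub> N, monoid.mult = (\<lambda>X Y. N), one = N, zero = N, add = set_add M,
     smult = (\<lambda>r X. \<Union>x\<in>X. N +>\<^bsub>M\<^esub> (r \<odot>\<^bsub>M\<^esub> x))\<rparr>"

definition ideal_smult ::
  "('a, 'r) ring_scheme \<Rightarrow> 'a set \<Rightarrow> ('a, 'b, 'c) module_scheme \<Rightarrow> 'b set" where
  "ideal_smult R I M =
    LinearCombinations.module.span R M {r \<odot>\<^bsub>M\<^esub> x | r x. r \<in> I \<and> x \<in> carrier M}"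

definition finite_basis ::
  "('a, 'r) ring_scheme \<Rightarrow> ('a, 'b, 'c) module_scheme \<Rightarrow> 'b set \<Rightarrow> bool" where
  "finite_basis R M B \<longleftrightarrow>
    finite B \<and> B \<subseteq> carrier M \<and> \<not> LinearCombinations.module.lin_dep R M B \<and>
    LinearCombinations.module.span R M B = carrier M"

definition fg_free_module :: "('a, 'r) ring_scheme \<Rightarrow> ('a, 'b, 'c) module_scheme \<Rightarrow> bool" where
  "fg_free_module R M \<longleftrightarrow> Module.module R M \<and> (\<exists>B. finite_basis R M B)"

text \<open>Over a nonzero commutative ring all finite bases of a module have the same cardinality.\<close>

definition free_rank :: "('a, 'r) ring_scheme \<Rightarrow> ('a, 'b, 'c) module_scheme \<Rightarrow> nat" where
  "free_rank R M = (THE n. \<exists>B. finite_basis R M B \<and> card B = n)"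

definition module_length :: "('a, 'r) ring_scheme \<Rightarrow> ('a, 'b, 'c) module_scheme \<Rightarrow> enat" where
  "module_length R M =
    (SUP n \<in> {n. \<exists>N. (\<forall>i\<le>n. LinearCombinations.submodule R (N i) M) \<and> (\<forall>i<n. N i \<subset> N (Suc i))}.
      enat n)"

definition is_direct_summand ::
  "('a, 'r) ring_scheme \<Rightarrow> ('a, 'k, 'l) module_scheme \<Rightarrow> ('a, 'b, 'c) module_scheme \<Rightarrow> bool" where
  "is_direct_summand R K M \<longleftrightarrow>
    (\<exists>N L. LinearCombinations.submodule R N M \<and> LinearCombinations.submodule R L M \<and>
       N \<inter> L = {\<zero>\<^bsub>M\<^esub>} \<and> LinearCombinations.module.submodule_sum M N L = carrier M \<and>
       (\<exists>f \<in> LinearCombinations.module_hom R K (M\<lparr>carrier := N\<rparr>). bij_betw f (carrier K) N))"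

definition noetherian_local_ring :: "('a, 'r) ring_scheme \<Rightarrow> 'a set \<Rightarrow> bool" where
  "noetherian_local_ring R \<mm> \<longleftrightarrow>
    cring R \<and> noetherian_ring R \<and> maximalideal \<mm> R \<and> (\<forall>J. maximalideal J R \<longrightarrow> J = \<mm>)"

text \<open>The residue field as an \<open>R\<close>-module; as a ring it is \<open>R Quot \<mm>\<close>.\<close>

definition residue_module :: "('a, 'r) ring_scheme \<Rightarrow> 'a set \<Rightarrow> ('a, 'a set) module" where
  "residue_module R \<mm> = quotient_module (ring_as_module R) \<mm>"

text \<open>
  \<open>\<mm>/\<mm>\<^sup>2\<close> as a module over \<open>R Quot \<mm>\<close>. The coset product modulo \<open>\<mm>\<^sup>2\<close> of a coset of \<open>\<mm>\<close> in \<open>R\<close>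
  and a coset of \<open>\<mm>\<^sup>2\<close> in \<open>\<mm>\<close> is the single coset of \<open>\<mm>\<^sup>2\<close> containing any product of representatives.
\<close>

definition cotangent_space :: "('a, 'r) ring_scheme \<Rightarrow> 'a set \<Rightarrow> ('a set, 'a set) module" where
  "cotangent_space R \<mm> = (let \<mm>2 = ideal_prod R \<mm> \<mm> in
    \<lparr>carrier = (\<lambda>x. \<mm>2 +>\<^bsub>R\<^esub> x) ` \<mm>, monoid.mult = (\<lambda>X Y. \<mm>2), one = \<mm>2, zero = \<mm>2, add = set_add R,
     smult = rcoset_mult R \<mm>2\<rparr>)"

text \<open>
  The test modules range over the type \<^typ>\<open>nat \<Rightarrow> 'a\<close>, which contains a copy of \<open>R\<close> and of every
  finitely generated \<open>R\<close>-module. By Baer's criterion (test modules \<open>R\<close>, submodules its ideals) the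
  extension property then holds for test modules over arbitrary types.
\<close>

definition injective_module :: "('a, 'r) ring_scheme \<Rightarrow> ('a, 'b, 'c) module_scheme \<Rightarrow> bool" where
  "injective_module R E \<longleftrightarrow> Module.module R E \<and>
    (\<forall>(M :: ('a, nat \<Rightarrow> 'a) module) N f.
       Module.module R M \<and> LinearCombinations.submodule R N M \<and>
       f \<in> LinearCombinations.module_hom R (M\<lparr>carrier := N\<rparr>) E \<longrightarrow>
       (\<exists>g \<in> LinearCombinations.module_hom R M E. \<forall>x\<in>N. g x = f x))"

text \<open>
  Existence of an exact sequence \<open>0 \<rightarrow> M \<rightarrow> E 0 \<rightarrow> \<dots> \<rightarrow> E n \<rightarrow> 0\<close> with all \<open>E j\<close> injective. The
  \<open>E j\<close> live in \<^typ>\<open>nat \<Rightarrow> 'a\<close>: over a nonzero noetherian ring with carrier in \<^typ>\<open>'a\<close>, the terms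
  of the minimal injective resolution of a finitely generated module have cardinality at most
  that of the ring or countable, so they have copies in this type.
\<close>

definition finite_injective_dimension ::
  "('a, 'r) ring_scheme \<Rightarrow> ('a, 'b, 'c) module_scheme \<Rightarrow> bool" where
  "finite_injective_dimension R M \<longleftrightarrow>
    (\<exists>(n::nat) (E :: nat \<Rightarrow> ('a, nat \<Rightarrow> 'a) module) \<epsilon> \<delta>.
       (\<forall>j\<le>n. injective_module R (E j)) \<and>
       Module.module R (E (Suc n)) \<and> carrier (E (Suc n)) = {\<zero>\<^bsub>E (Suc n)\<^esub>} \<and>
       \<epsilon> \<in> LinearCombinations.module_hom R M (E 0) \<and> inj_on \<epsilon> (carrier M) \<and>
       (\<forall>j\<le>n. \<delta> j \<in> LinearCombinations.module_hom R (E j) (E (Suc j))) \<and>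
       \<epsilon> ` carrier M = a_kernel (E 0) (E 1) (\<delta> 0) \<and>
       (\<forall>j<n. \<delta> j ` carrier (E j) = a_kernel (E (Suc j)) (E (Suc (Suc j))) (\<delta> (Suc j))))"

text \<open>Only meant for noetherian local rings.\<close>

definition gorenstein :: "('a, 'r) ring_scheme \<Rightarrow> bool" where
  "gorenstein R \<longleftrightarrow> finite_injective_dimension R (ring_as_module R)"

definition fg_free_complex ::
  "('a, 'r) ring_scheme \<Rightarrow> (int \<Rightarrow> ('a, 'b, 'c) module_scheme) \<Rightarrow> (int \<Rightarrow> 'b \<Rightarrow> 'b) \<Rightarrow> bool" where
  "fg_free_complex R A d \<longleftrightarrow>
    (\<forall>i. fg_free_module R (A i)) \<and>
    (\<forall>i. d i \<in> LinearCombinations.module_hom R (A i) (A (i - 1))) \<and>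
    (\<forall>i. \<forall>x \<in> carrier (A (i + 1)). d i (d (i + 1) x) = \<zero>\<^bsub>A (i - 1)\<^esub>)"

definition homology_module ::
  "(int \<Rightarrow> ('a, 'b, 'c) module_scheme) \<Rightarrow> (int \<Rightarrow> 'b \<Rightarrow> 'b) \<Rightarrow> int \<Rightarrow> ('a, 'b set) module" where
  "homology_module A d i =
    quotient_module ((A i)\<lparr>carrier := a_kernel (A i) (A (i - 1)) (d i)\<rparr>)
      (d (i + 1) ` carrier (A (i + 1)))"

definition acyclic_complex ::
  "(int \<Rightarrow> ('a, 'b, 'c) module_scheme) \<Rightarrow> (int \<Rightarrow> 'b \<Rightarrow> 'b) \<Rightarrow> bool" where
  "acyclic_complex A d \<longleftrightarrow>
    (\<forall>i. carrier (homology_module A d i) = {\<zero>\<^bsub>homology_module A d i\<^esub>})"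

definition minimal_complex ::
  "('a, 'r) ring_scheme \<Rightarrow> 'a set \<Rightarrow> (int \<Rightarrow> ('a, 'b, 'c) module_scheme) \<Rightarrow> (int \<Rightarrow> 'b \<Rightarrow> 'b) \<Rightarrow> bool" where
  "minimal_complex R \<mm> A d \<longleftrightarrow>
    (\<forall>i. d i ` carrier (A i) \<subseteq> ideal_smult R \<mm> (A (i - 1)))"

definition nonzero_complex :: "(int \<Rightarrow> ('a, 'b, 'c) module_scheme) \<Rightarrow> bool" where
  "nonzero_complex A \<longleftrightarrow> (\<exists>i. carrier (A i) \<noteq> {\<zero>\<^bsub>A i\<^esub>})"

definition coker ::
  "(int \<Rightarrow> ('a, 'b, 'c) module_scheme) \<Rightarrow> (int \<Rightarrow> 'b \<Rightarrow> 'b) \<Rightarrow> int \<Rightarrow> ('a, 'b set) module" where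
  "coker A d i = quotient_module (A (i - 1)) (d i ` carrier (A i))"

end

theory Submission
  imports Defs
begin

text \<open>
  Write \<open>e\<close> and \<open>f\<close> for the lengths of \<open>\<mm>/\<mm>\<^sup>2\<close> and of \<open>\<mm>\<^sup>2\<close>, \<open>b\<^sub>i\<close> for the rank of \<open>A\<^sub>i\<close>, and \<open>Z\<^sub>i \<subseteq> A\<^sub>i\<close> for the cycles, which are also
  the boundaries; the cokernel of \<open>d\<^sub>i\<^sub>+\<^sub>2\<close> is isomorphic to \<open>Z\<^sub>i\<close>. Minimality and \<open>\<mm>\<^sup>3 = 0\<close> give \<open>\<mm>\<^sup>2A\<^sub>i \<subseteq> Z\<^sub>i \<subseteq> \<mm>A\<^sub>i\<close>.
  With \<open>t\<^sub>i\<close> the length of \<open>\<mm>\<^sup>2A\<^sub>i / \<mm>Z\<^sub>i\<close>, counting lengths along \<open>0 \<rightarrow> Z\<^sub>i\<^sub>+\<^sub>1 \<rightarrow> A\<^sub>i\<^sub>+\<^sub>1 \<rightarrow> Z\<^sub>i \<rightarrow> 0\<close> yields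
  \<open>b\<^sub>i\<^sub>+\<^sub>2 + f b\<^sub>i = e b\<^sub>i\<^sub>+\<^sub>1 + t\<^sub>i\<^sub>+\<^sub>1 + t\<^sub>i\<close> (\<open>rank_recurrence\<close>) and \<open>e b\<^sub>i\<^sub>+\<^sub>1 \<ge> f b\<^sub>i + (e - 1) t\<^sub>i\<close> (\<open>rank_lower_bound\<close>).

  The residue field \<open>k\<close> is a direct summand of \<open>Z\<^sub>i\<close> if and only if \<open>Z\<^sub>i\<close> has a minimal generator killed by \<open>\<mm>\<close>
  (\<open>residue_summand_iff\<close>). If it has none, then \<open>t\<^sub>i = 0\<close> (\<open>t_eq_0\<close>) and the socle of \<open>R\<close> is contained in \<open>\<mm>\<^sup>2\<close>
  (\<open>ring_socle\<close>). Then \<open>f = 1\<close> would mean that \<open>R\<close> has a simple socle, so that \<open>R\<close> is injective over itself and therefore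
  Gorenstein (\<open>gorenstein_if_simple_socle\<close>). Thus \<open>f \<ge> 2\<close>.

  Suppose that no \<open>Z\<^sub>i\<close> with \<open>i < \<kappa>\<close> has such a generator. To the left of \<open>\<kappa>\<close> the ranks then satisfy
  \<open>b\<^sub>i\<^sub>+\<^sub>1 = e b\<^sub>i - f b\<^sub>i\<^sub>-\<^sub>1\<close> in positive integers for all indices down to \<open>-\<infinity>\<close>, and for \<open>f \<ge> 2\<close> this is
  possible only if they are constant and \<open>e = f + 1\<close> (\<open>recurrence_constant\<close>). With \<open>e = f + 1\<close>, a generator killed by \<open>\<mm>\<close> in
  \<open>Z\<^sub>\<kappa>\<close> gives \<open>t\<^sub>\<kappa> > 0\<close> and strictly increasing ranks from \<open>\<kappa>\<close> on.

  So the point is that the indices \<open>i\<close> for which \<open>k\<close> is a summand of \<open>Z\<^sub>i\<close> are bounded below. The case \<open>f \<ge> e\<close>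
  does not occur (\<open>sqdim_less_embdim\<close>): by the lower bound the ranks would increase strictly on all of \<open>\<int>\<close>, or be constant
  towards \<open>-\<infinity>\<close> with \<open>e = f \<ge> 2\<close> instead of \<open>e = f + 1\<close>, or \<open>R\<close> would be Gorenstein with \<open>e = f = 1\<close>. If \<open>f < e\<close> and \<open>k\<close> is a
  summand of \<open>Z\<^sub>i\<close>, then the syzygies of \<open>k\<close> are summands of \<open>Z\<^sub>i\<^sub>+\<^sub>1, Z\<^sub>i\<^sub>+\<^sub>2, \<dots>\<close>, and their numbers of generators grow
  strictly; hence \<open>b\<^sub>i\<^sub>+\<^sub>n\<^sub>+\<^sub>1 > n\<close> (\<open>socle_gen_growth\<close>), and \<open>b\<^sub>0\<close> bounds \<open>-i\<close>.

  All lengths are lengths of intervals in lattices of submodules, which makes them additive for a purely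
  lattice-theoretic reason (\<open>ilen_add\<close>).
\<close>

section \<open>Submodules\<close>

definition cyclic_submodule :: "('a, 'r) ring_scheme \<Rightarrow> ('a, 'b, 'c) module_scheme \<Rightarrow> 'b \<Rightarrow> 'b set" where
  "cyclic_submodule R M x = {r \<odot>\<^bsub>M\<^esub> x | r. r \<in> carrier R}"

text \<open>
  The submodule \<open>I V\<close>. As the least submodule containing all products it needs no finite sums:
  an inclusion \<open>I V \<subseteq> W\<close> is checked on the products alone.
\<close>
definition scale :: "('a, 'r) ring_scheme \<Rightarrow> ('a, 'b, 'c) module_scheme \<Rightarrow> 'a set \<Rightarrow> 'b set \<Rightarrow> 'b set" where
  "scale R M I V = \<Inter>{W. submodule R W M \<and> (\<forall>r\<in>I. \<forall>x\<in>V. r \<odot>\<^bsub>M\<^esub> x \<in> W)}"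

lemma submoduleD:
  assumes "submodule R N M"
  shows "Module.module R M" "N \<subseteq> carrier M" "\<And>v w. v \<in> N \<Longrightarrow> w \<in> N \<Longrightarrow> v \<oplus>\<^bsub>M\<^esub> w \<in> N" "\<zero>\<^bsub>M\<^esub> \<in> N"
    "\<And>c v. c \<in> carrier R \<Longrightarrow> v \<in> N \<Longrightarrow> c \<odot>\<^bsub>M\<^esub> v \<in> N"
  using assms by (auto simp: submodule_def)

lemma mem_set_add_iff: "x \<in> U <+>\<^bsub>M\<^esub> V \<longleftrightarrow> (\<exists>u\<in>U. \<exists>v\<in>V. x = u \<oplus>\<^bsub>M\<^esub> v)"
  by (auto simp: set_add_def')

lemma set_addI: "u \<in> U \<Longrightarrow> v \<in> V \<Longrightarrow> u \<oplus>\<^bsub>M\<^esub> v \<in> U <+>\<^bsub>M\<^esub> V"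
  by (auto simp: mem_set_add_iff)

lemma set_addE: 
  assumes "x \<in> U <+>\<^bsub>M\<^esub> V" 
  obtains u v where "u \<in> U" "v \<in> V" "x = u \<oplus>\<^bsub>M\<^esub> v"
  using assms by (auto simp: mem_set_add_iff)

context Module.module begin

lemma submodule_neg: "submodule R N M \<Longrightarrow> x \<in> N \<Longrightarrow> \<ominus>\<^bsub>M\<^esub> x \<in> N"
  using submoduleD[of R N M] smult_minus_1[of x] by (metis R.add.inv_closed R.one_closed subsetD)

lemma submodule_minus: "submodule R N M \<Longrightarrow> x \<in> N \<Longrightarrow> y \<in> N \<Longrightarrow> x \<ominus>\<^bsub>M\<^esub> y \<in> N"
  using submodule_neg[of N y] submoduleD(3)[of R N M] by (simp add: a_minus_def)

lemma submodule_add_cancel: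
  assumes N: "submodule R N M" and "x \<in> N" "y \<in> carrier M" "x \<oplus>\<^bsub>M\<^esub> y \<in> N"
  shows "y \<in> N"
proof -
  have "x \<in> carrier M" using assms submoduleD(2) by blast
  then have "y = (x \<oplus>\<^bsub>M\<^esub> y) \<ominus>\<^bsub>M\<^esub> x" using assms(3)
    by (simp add: a_minus_def M.add.m_comm[of x y] M.add.m_assoc M.r_neg)
  then show ?thesis using submodule_minus[OF N assms(4,2)] by simp
qed

lemma submodule_carrier: "submodule R (carrier M) M"
  using module_axioms by (auto simp: submodule_def)

lemma submodule_zero: "submodule R {\<zero>\<^bsub>M\<^esub>} M"
  using module_axioms by (auto simp: submodule_def)

lemma submodule_Int: "submodule R U M \<Longrightarrow> submodule R V M \<Longrightarrow> submodule R (U \<inter> V) M"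
  by (auto simp: submodule_def)

lemma submodule_set_add:
  assumes "submodule R U M" "submodule R V M"
  shows "submodule R (U <+>\<^bsub>M\<^esub> V) M"
proof -
  note u = submoduleD[OF assms(1)] and v = submoduleD[OF assms(2)]
  show ?thesis
    unfolding submodule_def
  proof (intro conjI allI impI subsetI)
    show "Module.module R M" by (fact u)
    fix x assume "x \<in> U <+>\<^bsub>M\<^esub> V" then show "x \<in> carrier M" using u v
      by (auto simp: mem_set_add_iff)
  next
    fix x y assume "x \<in> U <+>\<^bsub>M\<^esub> V" "y \<in> U <+>\<^bsub>M\<^esub> V"
    then obtain a b c d where *: "a \<in> U" "b \<in> V" "c \<in> U" "d \<in> V" "x = a \<oplus>\<^bsub>M\<^esub> b" "y = c \<oplus>\<^bsub>M\<^esub> d"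
      by (auto simp: mem_set_add_iff)
    then have "x \<oplus>\<^bsub>M\<^esub> y = (a \<oplus>\<^bsub>M\<^esub> c) \<oplus>\<^bsub>M\<^esub> (b \<oplus>\<^bsub>M\<^esub> d)"
      using u(2) v(2) by (auto simp: subset_iff M.add.m_ac)
    then show "x \<oplus>\<^bsub>M\<^esub> y \<in> U <+>\<^bsub>M\<^esub> V" using * u(3) v(3) by (metis set_addI)
  next
    show "\<zero>\<^bsub>M\<^esub> \<in> U <+>\<^bsub>M\<^esub> V" using u(4) v(4) by (force simp: mem_set_add_iff)
  next
    fix c x assume c: "c \<in> carrier R" and "x \<in> U <+>\<^bsub>M\<^esub> V"
    then obtain a b where *: "a \<in> U" "b \<in> V" "x = a \<oplus>\<^bsub>M\<^esub> b"
      by (auto simp: mem_set_add_iff)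
    then have "c \<odot>\<^bsub>M\<^esub> x = c \<odot>\<^bsub>M\<^esub> a \<oplus>\<^bsub>M\<^esub> c \<odot>\<^bsub>M\<^esub> b" using u(2) v(2) c by (auto simp: subset_iff smult_r_distr)
    then show "c \<odot>\<^bsub>M\<^esub> x \<in> U <+>\<^bsub>M\<^esub> V" using * c u(5) v(5) by (metis set_addI)
  qed
qed

lemma set_add_upper:
  assumes "submodule R U M" "submodule R V M"
  shows "U \<subseteq> U <+>\<^bsub>M\<^esub> V" "V \<subseteq> U <+>\<^bsub>M\<^esub> V"
proof -
  note u = submoduleD[OF assms(1)] and v = submoduleD[OF assms(2)]
  show "U \<subseteq> U <+>\<^bsub>M\<^esub> V"
  proof
    fix x assume "x \<in> U" then show "x \<in> U <+>\<^bsub>M\<^esub> V" using u(2) v(4) 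
      by (intro iffD2[OF mem_set_add_iff] bexI[of _ x] bexI[of _ "\<zero>\<^bsub>M\<^esub>"]) auto
  qed
  show "V \<subseteq> U <+>\<^bsub>M\<^esub> V"
  proof
    fix x assume "x \<in> V" then show "x \<in> U <+>\<^bsub>M\<^esub> V" using v(2) u(4) 
      by (intro iffD2[OF mem_set_add_iff] bexI[of _ x] bexI[of _ "\<zero>\<^bsub>M\<^esub>"]) auto
  qed
qed

lemma set_add_least: "submodule R W M \<Longrightarrow> U \<subseteq> W \<Longrightarrow> V \<subseteq> W \<Longrightarrow> U <+>\<^bsub>M\<^esub> V \<subseteq> W"
  using submoduleD(3)[of R W M] by (blast elim: set_addE)

lemma set_add_absorb: "submodule R U M \<Longrightarrow> submodule R V M \<Longrightarrow> U \<subseteq> V \<Longrightarrow> U <+>\<^bsub>M\<^esub> V = V"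
  using set_add_upper[of U V] set_add_least[of V U V] by blast

lemma modular_law:
  assumes U: "submodule R U M" and V: "submodule R V M" and W: "submodule R W M" and "U \<subseteq> W"
  shows "W \<inter> (U <+>\<^bsub>M\<^esub> V) = U <+>\<^bsub>M\<^esub> (W \<inter> V)"
proof
  show "U <+>\<^bsub>M\<^esub> (W \<inter> V) \<subseteq> W \<inter> (U <+>\<^bsub>M\<^esub> V)"
    using \<open>U \<subseteq> W\<close> submoduleD(3)[OF W] by (blast elim: set_addE intro: set_addI)
  show "W \<inter> (U <+>\<^bsub>M\<^esub> V) \<subseteq> U <+>\<^bsub>M\<^esub> (W \<inter> V)"
  proof
    fix x assume x: "x \<in> W \<inter> (U <+>\<^bsub>M\<^esub> V)"
    then obtain u v where uv: "u \<in> U" "v \<in> V" "x = u \<oplus>\<^bsub>M\<^esub> v" by (auto simp: mem_set_add_iff)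
    then have "v \<in> W" using submodule_add_cancel[OF W, of u v] x assms submoduleD(2)[OF V] by blast
    then show "x \<in> U <+>\<^bsub>M\<^esub> (W \<inter> V)" using uv by (auto simp: mem_set_add_iff)
  qed
qed

lemma submodule_cyclic:
  assumes x: "x \<in> carrier M" shows "submodule R (cyclic_submodule R M x) M"
  unfolding submodule_def
proof (intro conjI allI impI subsetI)
  show "Module.module R M" by (rule module_axioms)
  show "v \<in> carrier M" if "v \<in> cyclic_submodule R M x" for v
    using that x by (auto simp: cyclic_submodule_def)
  show "\<zero>\<^bsub>M\<^esub> \<in> cyclic_submodule R M x"
    using smult_l_null[OF x, symmetric] R.zero_closed unfolding cyclic_submodule_def by blast
  show "v \<oplus>\<^bsub>M\<^esub> w \<in> cyclic_submodule R M x" if "v \<in> cyclic_submodule R M x" "w \<in> cyclic_submodule R M x" for v w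
  proof -
    obtain r s where "r \<in> carrier R" "s \<in> carrier R" "v = r \<odot>\<^bsub>M\<^esub> x" "w = s \<odot>\<^bsub>M\<^esub> x"
      using \<open>v \<in> _\<close> \<open>w \<in> _\<close> unfolding cyclic_submodule_def by blast
    then have "r \<oplus> s \<in> carrier R" "v \<oplus>\<^bsub>M\<^esub> w = (r \<oplus> s) \<odot>\<^bsub>M\<^esub> x" using x by (simp_all add: smult_l_distr)
    then show ?thesis unfolding cyclic_submodule_def by blast
  qed
  show "c \<odot>\<^bsub>M\<^esub> v \<in> cyclic_submodule R M x" if c: "c \<in> carrier R" and "v \<in> cyclic_submodule R M x" for c v
  proof -
    obtain r where "r \<in> carrier R" "v = r \<odot>\<^bsub>M\<^esub> x"
      using \<open>v \<in> _\<close> unfolding cyclic_submodule_def by blast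
    then have "c \<otimes> r \<in> carrier R" "c \<odot>\<^bsub>M\<^esub> v = (c \<otimes> r) \<odot>\<^bsub>M\<^esub> x" using x c by (simp_all add: smult_assoc1)
    then show ?thesis unfolding cyclic_submodule_def by blast
  qed
qed

lemma self_in_cyclic: "x \<in> carrier M \<Longrightarrow> x \<in> cyclic_submodule R M x"
  unfolding cyclic_submodule_def using smult_one[of x, symmetric] R.one_closed by blast

lemma cyclic_least: "submodule R W M \<Longrightarrow> x \<in> W \<Longrightarrow> cyclic_submodule R M x \<subseteq> W"
  using submoduleD(5)[of R W M] by (auto simp: cyclic_submodule_def)

lemma scale_least: "submodule R W M \<Longrightarrow> (\<And>r x. r \<in> I \<Longrightarrow> x \<in> V \<Longrightarrow> r \<odot>\<^bsub>M\<^esub> x \<in> W) \<Longrightarrow> scale R M I V \<subseteq> W"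
  unfolding scale_def by blast

lemma scaleI: "r \<in> I \<Longrightarrow> x \<in> V \<Longrightarrow> r \<odot>\<^bsub>M\<^esub> x \<in> scale R M I V"
  unfolding scale_def by blast

lemma submodule_scale:
  assumes "I \<subseteq> carrier R" "V \<subseteq> carrier M"
  shows "submodule R (scale R M I V) M"
proof -
  have "scale R M I V \<subseteq> carrier M" using assms by (intro scale_least submodule_carrier) blast
  then show ?thesis
    unfolding submodule_def
  proof (intro conjI allI impI)
    show "Module.module R M" by (rule module_axioms)
  qed (auto simp: scale_def submodule_def)
qed

lemma scale_mono: "I \<subseteq> J \<Longrightarrow> V \<subseteq> W \<Longrightarrow> scale R M I V \<subseteq> scale R M J W"
  unfolding scale_def by blast

lemma scale_subset: "I \<subseteq> carrier R \<Longrightarrow> submodule R V M \<Longrightarrow> scale R M I V \<subseteq> V"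
  by (rule scale_least) (auto dest: submoduleD(5))

lemma scale_carrier: "submodule R V M \<Longrightarrow> scale R M (carrier R) V = V"
proof
  assume V: "submodule R V M"
  show "scale R M (carrier R) V \<subseteq> V" using V scale_subset by blast
  show "V \<subseteq> scale R M (carrier R) V"
  proof
    fix x assume "x \<in> V" 
    then show "x \<in> scale R M (carrier R) V" using scaleI[of "\<one>" "carrier R" x V] submoduleD(2)[OF V] by auto
  qed
qed

lemma scale_set_add:
  assumes I: "I \<subseteq> carrier R" and U: "submodule R U M" and V: "submodule R V M"
  shows "scale R M I (U <+>\<^bsub>M\<^esub> V) = scale R M I U <+>\<^bsub>M\<^esub> scale R M I V"
proof
  note u = submoduleD[OF U] and v = submoduleD[OF V]
  have su: "submodule R (scale R M I U) M" and sv: "submodule R (scale R M I V) M"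
    using submodule_scale I u(2) v(2) by auto
  show "scale R M I (U <+>\<^bsub>M\<^esub> V) \<subseteq> scale R M I U <+>\<^bsub>M\<^esub> scale R M I V"
  proof (rule scale_least[OF submodule_set_add[OF su sv]])
    fix r x assume r: "r \<in> I" and "x \<in> U <+>\<^bsub>M\<^esub> V"
    then obtain a b where *: "a \<in> U" "b \<in> V" "x = a \<oplus>\<^bsub>M\<^esub> b"
      by (auto simp: mem_set_add_iff)
    then have "r \<odot>\<^bsub>M\<^esub> x = r \<odot>\<^bsub>M\<^esub> a \<oplus>\<^bsub>M\<^esub> r \<odot>\<^bsub>M\<^esub> b" using u(2) v(2) r I by (auto simp: subset_iff smult_r_distr)
    then show "r \<odot>\<^bsub>M\<^esub> x \<in> scale R M I U <+>\<^bsub>M\<^esub> scale R M I V"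
      unfolding mem_set_add_iff using * r scaleI by blast
  qed
  show "scale R M I U <+>\<^bsub>M\<^esub> scale R M I V \<subseteq> scale R M I (U <+>\<^bsub>M\<^esub> V)"
    using submodule_scale[OF I submoduleD(2)[OF submodule_set_add[OF U V]]] set_add_upper[OF U V]
    by (intro set_add_least scale_mono) auto
qed

lemma set_add_assoc:
  assumes "submodule R U M" "submodule R V M" "submodule R W M"
  shows "U <+>\<^bsub>M\<^esub> V <+>\<^bsub>M\<^esub> W = U <+>\<^bsub>M\<^esub> (V <+>\<^bsub>M\<^esub> W)" (is "?L = ?R")
proof -
  note s = assms submodule_set_add set_add_upper
  have L: "submodule R ?L M" and R: "submodule R ?R M" using s by auto
  have "U \<subseteq> ?L" "V \<subseteq> ?L" "W \<subseteq> ?L" "U \<subseteq> ?R" "V \<subseteq> ?R" "W \<subseteq> ?R"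
    using set_add_upper[OF assms(1,2)] set_add_upper[OF assms(2,3)]
      set_add_upper[OF submodule_set_add[OF assms(1,2)] assms(3)]
      set_add_upper[OF assms(1) submodule_set_add[OF assms(2,3)]] by auto
  then show ?thesis using L R by (intro equalityI set_add_least)
qed

lemma set_add_commute:
  assumes "submodule R U M" "submodule R V M"
  shows "U <+>\<^bsub>M\<^esub> V = V <+>\<^bsub>M\<^esub> U"
  using set_add_upper[OF assms] set_add_upper[OF assms(2,1)]
    submodule_set_add[OF assms] submodule_set_add[OF assms(2,1)]
  by (intro equalityI set_add_least)

lemma set_add_mono: "U \<subseteq> U' \<Longrightarrow> V \<subseteq> V' \<Longrightarrow> U <+>\<^bsub>M\<^esub> V \<subseteq> U' <+>\<^bsub>M\<^esub> V'"
  unfolding set_add_def' by blast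

end

lemma (in mod_hom) submodule_image:
  assumes "submodule R V M" shows "submodule R (f ` V) N"
  unfolding submodule_def
proof (intro conjI allI impI subsetI)
  note v = submoduleD[OF assms]
  show "Module.module R N" by (rule N.module_axioms)
  show "x \<in> carrier N" if "x \<in> f ` V" for x using that v(2) by auto
  show "x \<oplus>\<^bsub>N\<^esub> y \<in> f ` V" if "x \<in> f ` V" "y \<in> f ` V" for x y
    using that v(2,3) by (auto simp: subset_iff simp flip: f_add)
  show "\<zero>\<^bsub>N\<^esub> \<in> f ` V" using v(4) f0_is_0 by (metis imageI)
  show "c \<odot>\<^bsub>N\<^esub> x \<in> f ` V" if "c \<in> carrier R" "x \<in> f ` V" for c x
    using that v(2,5) by (auto simp: subset_iff simp flip: f_smult)
qed

lemma (in mod_hom) submodule_vimage: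
  assumes "submodule R V M" "submodule R W N" shows "submodule R (V \<inter> f -` W) M"
  using submoduleD[OF assms(1)] submoduleD[OF assms(2)]
  by (auto simp: submodule_def subset_iff)

lemma (in mod_hom) image_scale:
  assumes I: "I \<subseteq> carrier R" and V: "submodule R V M"
  shows "f ` scale R M I V = scale R N I (f ` V)"
proof
  note v = submoduleD[OF V]
  have s: "submodule R (scale R N I (f ` V)) N" using I v by (intro N.submodule_scale) auto
  have t: "submodule R (scale R M I V) M" using I v by (intro M.submodule_scale)
  have "scale R M I V \<subseteq> carrier M \<inter> f -` scale R N I (f ` V)"
    using I v(2) N.scaleI[of _ I _ "f ` V"]
    by (intro M.scale_least submodule_vimage M.submodule_carrier s) (auto simp: subset_iff)
  then show "f ` scale R M I V \<subseteq> scale R N I (f ` V)" by blast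
  show "scale R N I (f ` V) \<subseteq> f ` scale R M I V"
  proof (rule N.scale_least[OF submodule_image[OF t]])
    fix r x assume r: "r \<in> I" "x \<in> f ` V"
    then obtain y where y: "y \<in> V" "x = f y" by blast
    then have "r \<odot>\<^bsub>N\<^esub> x = f (r \<odot>\<^bsub>M\<^esub> y)" using r I v(2) by (auto simp: subset_iff)
    then show "r \<odot>\<^bsub>N\<^esub> x \<in> f ` scale R M I V" using r(1) y(1) M.scaleI by blast
  qed
qed

lemma (in mod_hom) image_set_add:
  assumes "submodule R U M" "submodule R V M"
  shows "f ` (U <+>\<^bsub>M\<^esub> V) = f ` U <+>\<^bsub>N\<^esub> f ` V"
proof -
  note u = submoduleD(2)[OF assms(1)] and v = submoduleD(2)[OF assms(2)]
  show ?thesis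
  proof (intro equalityI subsetI)
    fix y assume "y \<in> f ` (U <+>\<^bsub>M\<^esub> V)"
    then obtain a b where "a \<in> U" "b \<in> V" "y = f (a \<oplus>\<^bsub>M\<^esub> b)" by (auto simp: mem_set_add_iff)
    moreover from this have "y = f a \<oplus>\<^bsub>N\<^esub> f b" using f_add[of a b] u v by (auto simp: subset_iff)
    ultimately show "y \<in> f ` U <+>\<^bsub>N\<^esub> f ` V" by (metis imageI set_addI)
  next
    fix y assume "y \<in> f ` U <+>\<^bsub>N\<^esub> f ` V"
    then obtain a b where *: "a \<in> U" "b \<in> V" "y = f a \<oplus>\<^bsub>N\<^esub> f b" by (auto simp: mem_set_add_iff)
    moreover from this have "y = f (a \<oplus>\<^bsub>M\<^esub> b)" using f_add[of a b] u v by (auto simp: subset_iff)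
    ultimately show "y \<in> f ` (U <+>\<^bsub>M\<^esub> V)" by (metis imageI set_addI)
  qed
qed

section \<open>Length of an interval of submodules\<close>

definition submodule_chain ::
  "('a, 'r) ring_scheme \<Rightarrow> ('a, 'b, 'c) module_scheme \<Rightarrow> 'b set \<Rightarrow> 'b set \<Rightarrow> nat \<Rightarrow> bool" where
  "submodule_chain R M U V n \<longleftrightarrow>
    (\<exists>N. (\<forall>i\<le>n. submodule R (N i) M \<and> U \<subseteq> N i \<and> N i \<subseteq> V) \<and> (\<forall>i<n. N i \<subset> N (Suc i)))"

text \<open>
  The length of \<open>V/U\<close>, expressed inside the ambient module by the submodules between \<open>U\<close> and \<open>V\<close>.
  All lengths below are of subquotients of the free modules in the complex, so they can be compared
  without forming quotients.
\<close>
definition ilen :: "('a, 'r) ring_scheme \<Rightarrow> ('a, 'b, 'c) module_scheme \<Rightarrow> 'b set \<Rightarrow> 'b set \<Rightarrow> enat" where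
  "ilen R M U V = (SUP n \<in> {n. submodule_chain R M U V n}. enat n)"

lemma submodule_chain_antimono: "submodule_chain R M U V n \<Longrightarrow> m \<le> n \<Longrightarrow> submodule_chain R M U V m"
  unfolding submodule_chain_def by (meson le_trans less_le_trans)

lemma submodule_chain_le_ilen: "submodule_chain R M U V n \<Longrightarrow> enat n \<le> ilen R M U V"
  unfolding ilen_def by (rule SUP_upper) simp

lemma ilen_ge_iff:
  assumes "submodule R U M" "U \<subseteq> V"
  shows "enat n \<le> ilen R M U V \<longleftrightarrow> submodule_chain R M U V n"
proof
  assume le: "enat n \<le> ilen R M U V"
  show "submodule_chain R M U V n"
  proof (rule ccontr)
    assume no: "\<not> submodule_chain R M U V n"
    have "submodule_chain R M U V 0" using assms by (auto simp: submodule_chain_def)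
    then have "n \<noteq> 0" using no by metis
    have "ilen R M U V \<le> enat (n - 1)"
      unfolding ilen_def
    proof (rule SUP_least)
      fix m assume "m \<in> {n. submodule_chain R M U V n}"
      then have "m < n" using no submodule_chain_antimono[of R M U V m n] by (metis linorder_not_less mem_Collect_eq)
      then show "enat m \<le> enat (n - 1)" by simp
    qed
    with le have "enat n \<le> enat (n - 1)" by (rule order_trans)
    then show False using \<open>n \<noteq> 0\<close> by simp
  qed
qed (rule submodule_chain_le_ilen)

lemma ilen_mono: "U' \<subseteq> U \<Longrightarrow> V \<subseteq> V' \<Longrightarrow> ilen R M U V \<le> ilen R M U' V'"
  unfolding ilen_def submodule_chain_def by (intro SUP_subset_mono) (auto, blast)

text \<open>
  A weakly increasing sequence yields a chain whose length is its number of strict steps. Intersecting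
  a chain with a submodule, or adding a submodule to it, produces such sequences.
\<close>
lemma submodule_chain_of_mono:
  assumes "\<And>i. i \<le> n \<Longrightarrow> submodule R (X i) M \<and> U \<subseteq> X i \<and> X i \<subseteq> V"
    and "\<And>i. i < n \<Longrightarrow> X i \<subseteq> X (Suc i)"
  shows "submodule_chain R M U V (card {i. i < n \<and> X i \<noteq> X (Suc i)})"
proof -
  let ?J = "\<lambda>n. {i. i < n \<and> X i \<noteq> X (Suc i)}"
  have "\<exists>N. (\<forall>i\<le>card (?J n). submodule R (N i) M \<and> U \<subseteq> N i \<and> N i \<subseteq> V) \<and>
    (\<forall>i<card (?J n). N i \<subset> N (Suc i)) \<and> N (card (?J n)) = X n"
    using assms
  proof (induction n)
    case 0
    then show ?case by (intro exI[of _ "\<lambda>_. X 0"]) auto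
  next
    case (Suc n)
    have "\<exists>N. (\<forall>i\<le>card (?J n). submodule R (N i) M \<and> U \<subseteq> N i \<and> N i \<subseteq> V) \<and>
      (\<forall>i<card (?J n). N i \<subset> N (Suc i)) \<and> N (card (?J n)) = X n"
      using Suc.prems by (intro Suc.IH) auto
    then obtain N where N: "\<And>i. i \<le> card (?J n) \<Longrightarrow> submodule R (N i) M \<and> U \<subseteq> N i \<and> N i \<subseteq> V"
      "\<And>i. i < card (?J n) \<Longrightarrow> N i \<subset> N (Suc i)" "N (card (?J n)) = X n" by blast
    show ?case
    proof (cases "X n = X (Suc n)")
      case True
      then have "?J (Suc n) = ?J n" by (auto simp: less_Suc_eq)
      then show ?thesis using N True by (intro exI[of _ N]) auto
    next
      case False
      then have eq: "?J (Suc n) = insert n (?J n)" by (auto simp: less_Suc_eq)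
      have c: "card (?J (Suc n)) = Suc (card (?J n))" unfolding eq by (subst card_insert_disjoint) auto
      have "X n \<subset> X (Suc n)" using False Suc.prems(2)[of n] by auto
      then show ?thesis unfolding c using N Suc.prems(1)[of "Suc n"]
        by (intro exI[of _ "N(Suc (card (?J n)) := X (Suc n))"]) (auto simp: le_Suc_eq less_Suc_eq)
    qed
  qed
  then show ?thesis unfolding submodule_chain_def by blast
qed

lemma submodule_chain_append:
  assumes "submodule_chain R M U V a" "submodule_chain R M V W b" "U \<subseteq> V" "V \<subseteq> W" "submodule R V M"
  shows "submodule_chain R M U W (a + b)"
proof -
  obtain N where N: "\<And>i. i \<le> a \<Longrightarrow> submodule R (N i) M \<and> U \<subseteq> N i \<and> N i \<subseteq> V"
    "\<And>i. i < a \<Longrightarrow> N i \<subset> N (Suc i)" using assms(1) unfolding submodule_chain_def by blast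
  obtain N' where N': "\<And>i. i \<le> b \<Longrightarrow> submodule R (N' i) M \<and> V \<subseteq> N' i \<and> N' i \<subseteq> W"
    "\<And>i. i < b \<Longrightarrow> N' i \<subset> N' (Suc i)" using assms(2) unfolding submodule_chain_def by blast
  let ?X = "\<lambda>i. if i \<le> a then N i else N' (i - a)"
  show ?thesis
    unfolding submodule_chain_def
  proof (intro exI[of _ ?X] conjI allI impI)
    fix i assume i: "i \<le> a + b"
    have "submodule R (?X i) M \<and> U \<subseteq> ?X i \<and> ?X i \<subseteq> W"
    proof (cases "i \<le> a")
      case True then show ?thesis using N(1)[of i] assms(4) by auto
    next
      case False
      then have "i - a \<le> b" using i by simp
      then show ?thesis using N'(1)[of "i - a"] assms(3) False by auto
    qed
    then show "submodule R (?X i) M" "U \<subseteq> ?X i" "?X i \<subseteq> W" by blast+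
  next
    fix i assume i: "i < a + b"
    consider "i < a" | "i = a" | "i > a" by linarith
    then show "?X i \<subset> ?X (Suc i)"
    proof cases
      case 1 then show ?thesis using N(2)[of i] by auto
    next
      case 2 
      then have "N a \<subseteq> V" "V \<subseteq> N' 0" "N' 0 \<subset> N' 1" using N(1)[of a] N'(1)[of 0] N'(2)[of 0] i by auto
      then have "N a \<subset> N' 1" by blast
      then show ?thesis using 2 by simp
    next
      case 3 then show ?thesis using N'(2)[of "i - a"] i by (auto simp: Suc_diff_le)
    qed
  qed
qed

context Module.module begin

text \<open>
  Additivity of length without the Jordan--Hoelder theorem. Chains below and above \<open>V\<close> can be joined,
  and conversely a chain from \<open>U\<close> to \<open>W\<close> is pushed into the two parts by \<open>X \<mapsto> X \<inter> V\<close> and \<open>X \<mapsto> X + V\<close>; by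
  the modular law each of its steps stays strict in at least one part.
\<close>
lemma ilen_add:
  assumes U: "submodule R U M" and V: "submodule R V M" and W: "submodule R W M" and UV: "U \<subseteq> V" and VW: "V \<subseteq> W"
  shows "ilen R M U W = ilen R M U V + ilen R M V W"
proof (rule antisym)
  show "ilen R M U V + ilen R M V W \<le> ilen R M U W"
  proof (cases "ilen R M U V = \<infinity> \<or> ilen R M V W = \<infinity>")
    case True
    then show ?thesis using ilen_mono[of U U V W R M] ilen_mono[of U V W W R M] UV VW by auto
  next
    case False
    then obtain a b where ab: "ilen R M U V = enat a" "ilen R M V W = enat b" by auto
    have "submodule_chain R M U V a" using ab ilen_ge_iff[OF U UV, of a] by simp
    moreover have "submodule_chain R M V W b" using ab ilen_ge_iff[OF V VW, of b] by simp
    ultimately show ?thesis using submodule_chain_le_ilen[OF submodule_chain_append] ab UV VW V by fastforce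
  qed
  show "ilen R M U W \<le> ilen R M U V + ilen R M V W"
    unfolding ilen_def[of R M U W]
  proof (rule SUP_least)
    fix n assume "n \<in> {n. submodule_chain R M U W n}"
    then obtain N where N: "\<And>i. i \<le> n \<Longrightarrow> submodule R (N i) M \<and> U \<subseteq> N i \<and> N i \<subseteq> W"
      "\<And>i. i < n \<Longrightarrow> N i \<subset> N (Suc i)" unfolding submodule_chain_def by blast
    let ?X = "\<lambda>i. N i \<inter> V" and ?Y = "\<lambda>i. N i <+>\<^bsub>M\<^esub> V"
    let ?JX = "{i. i < n \<and> ?X i \<noteq> ?X (Suc i)}" and ?JY = "{i. i < n \<and> ?Y i \<noteq> ?Y (Suc i)}"
    have "submodule_chain R M U V (card ?JX)"
    proof (intro submodule_chain_of_mono conjI)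
      show "submodule R (?X i) M" "U \<subseteq> ?X i" "?X i \<subseteq> V" if "i \<le> n" for i
        using N(1)[OF that] UV V submodule_Int by auto
      show "?X i \<subseteq> ?X (Suc i)" if "i < n" for i using N(2)[OF that] by auto
    qed
    then have 1: "enat (card ?JX) \<le> ilen R M U V" by (rule submodule_chain_le_ilen)
    have "submodule_chain R M V W (card ?JY)"
    proof (intro submodule_chain_of_mono conjI)
      fix i assume i: "i \<le> n"
      show "submodule R (?Y i) M" "V \<subseteq> ?Y i" using submodule_set_add set_add_upper V N(1)[OF i] by auto
      show "?Y i \<subseteq> W" using set_add_least[OF W] N(1)[OF i] VW by auto
    next
      fix i assume i: "i < n"
      show "?Y i \<subseteq> ?Y (Suc i)" using set_add_mono N(2)[OF i] by blast
    qed
    then have 2: "enat (card ?JY) \<le> ilen R M V W" by (rule submodule_chain_le_ilen)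
    have "{..<n} \<subseteq> ?JX \<union> ?JY"
    proof (rule ccontr)
      assume "\<not> {..<n} \<subseteq> ?JX \<union> ?JY"
      then obtain i where i: "i < n" "?X i = ?X (Suc i)" "?Y i = ?Y (Suc i)" by blast
      have s: "submodule R (N i) M" "submodule R (N (Suc i)) M" using N(1) i(1) by auto
      have "N (Suc i) = N (Suc i) \<inter> (N (Suc i) <+>\<^bsub>M\<^esub> V)" using set_add_upper(1)[OF s(2) V] by blast
      also have "\<dots> = N (Suc i) \<inter> (N i <+>\<^bsub>M\<^esub> V)" using i(3) by simp
      also have "\<dots> = N i <+>\<^bsub>M\<^esub> (N (Suc i) \<inter> V)" using s V N(2)[OF i(1)] by (intro modular_law) auto
      also have "\<dots> = N i <+>\<^bsub>M\<^esub> (N i \<inter> V)" using i(2) by simp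
      also have "\<dots> \<subseteq> N i" using s(1) by (intro set_add_least) auto
      finally show False using N(2)[OF i(1)] by blast
    qed
    then have "n \<le> card (?JX \<union> ?JY)" using card_mono[of "?JX \<union> ?JY" "{..<n}"] by simp
    also have "\<dots> \<le> card ?JX + card ?JY" by (rule card_Un_le)
    finally have "enat n \<le> enat (card ?JX) + enat (card ?JY)" by simp
    also have "\<dots> \<le> ilen R M U V + ilen R M V W" using 1 2 by (rule add_mono)
    finally show "enat n \<le> ilen R M U V + ilen R M V W" .
  qed
qed

lemma ilen_self: "ilen R M U U = 0"
proof -
  have "ilen R M U U \<le> enat 0"
    unfolding ilen_def
  proof (rule SUP_least)
    fix n assume "n \<in> {n. submodule_chain R M U U n}"
    then obtain N where N: "\<And>i. i \<le> n \<Longrightarrow> U \<subseteq> N i \<and> N i \<subseteq> U"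
      "\<And>i. i < n \<Longrightarrow> N i \<subset> N (Suc i)" unfolding submodule_chain_def by blast
    have "n = 0" using N(1)[of 0] N(1)[of 1] N(2)[of 0] by fastforce
    then show "enat n \<le> enat 0" by simp
  qed
  then show ?thesis by (simp flip: zero_enat_def)
qed

lemma ilen_psubset:
  assumes "submodule R U M" "submodule R V M" "U \<subset> V" shows "1 \<le> ilen R M U V"
proof -
  have "submodule_chain R M U V 1"
    unfolding submodule_chain_def using assms by (intro exI[of _ "\<lambda>i. if i = 0 then U else V"]) auto
  then show ?thesis using submodule_chain_le_ilen by (simp add: one_enat_def)
qed

lemma ilen_eq_0_iff:
  assumes "submodule R U M" "submodule R V M" "U \<subseteq> V" shows "ilen R M U V = 0 \<longleftrightarrow> U = V"
proof
  assume "ilen R M U V = 0"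
  then show "U = V" using ilen_psubset[of U V] assms by (cases "U = V") auto
qed (simp add: ilen_self)

end

lemma ilen_le_of_strict_mono:
  assumes "\<And>X. submodule R X M \<Longrightarrow> U \<subseteq> X \<Longrightarrow> X \<subseteq> V \<Longrightarrow> submodule R' (\<phi> X) M' \<and> U' \<subseteq> \<phi> X \<and> \<phi> X \<subseteq> V'"
    and "\<And>X Y. submodule R X M \<Longrightarrow> U \<subseteq> X \<Longrightarrow> submodule R Y M \<Longrightarrow> Y \<subseteq> V \<Longrightarrow> X \<subset> Y \<Longrightarrow> \<phi> X \<subset> \<phi> Y"
  shows "ilen R M U V \<le> ilen R' M' U' V'"
  unfolding ilen_def
proof (rule SUP_subset_mono[OF _ order_refl], safe)
  fix n assume "submodule_chain R M U V n"
  then obtain N where N: "\<And>i. i \<le> n \<Longrightarrow> submodule R (N i) M \<and> U \<subseteq> N i \<and> N i \<subseteq> V"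
      "\<And>i. i < n \<Longrightarrow> N i \<subset> N (Suc i)" unfolding submodule_chain_def by blast
  then show "submodule_chain R' M' U' V' n"
    unfolding submodule_chain_def using assms
    by (intro exI[of _ "\<lambda>i. \<phi> (N i)"] conjI allI impI) (simp_all add: less_imp_le)
qed

text \<open>
  The isomorphism \<open>V / (V \<inter> f\<inverse> U) \<cong> (U + f V) / U\<close>, in the form of mutually inverse monotone maps
  \<open>X \<mapsto> U + f X\<close> and \<open>Y \<mapsto> V \<inter> f\<inverse> Y\<close> between intervals of submodules. The isomorphism theorems used later
  are special cases.
\<close>
lemma (in mod_hom) ilen_hom:
  assumes U: "submodule R U N" and V: "submodule R V M"
  shows "ilen R N U (U <+>\<^bsub>N\<^esub> f ` V) = ilen R M (V \<inter> f -` U) V"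
proof -
  have fV: "submodule R (f ` V) N" by (rule submodule_image[OF V])
  have K: "submodule R (V \<inter> f -` U) M" by (rule submodule_vimage[OF V U])
  let ?\<phi> = "\<lambda>X. U <+>\<^bsub>N\<^esub> f ` X" and ?\<psi> = "\<lambda>Y. V \<inter> f -` Y"
  have \<psi>\<phi>: "?\<psi> (?\<phi> X) = X" if X: "submodule R X M" "V \<inter> f -` U \<subseteq> X" "X \<subseteq> V" for X
  proof
    have "f ` X \<subseteq> ?\<phi> X" by (rule N.set_add_upper(2)[OF U submodule_image[OF X(1)]])
    then show "X \<subseteq> ?\<psi> (?\<phi> X)" using X(3) by blast
    show "?\<psi> (?\<phi> X) \<subseteq> X"
    proof
      fix v assume v: "v \<in> ?\<psi> (?\<phi> X)"
      then obtain u x where ux: "u \<in> U" "x \<in> X" "f v = u \<oplus>\<^bsub>N\<^esub> f x" by (auto elim: set_addE)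
      have c: "v \<in> carrier M" "x \<in> carrier M" "u \<in> carrier N"
        using v ux X(1) submoduleD(2)[OF V] submoduleD(2)[OF X(1)] submoduleD(2)[OF U] by auto
      have "f (v \<ominus>\<^bsub>M\<^esub> x) = u" using c ux(3) by (simp add: a_minus_def N.M.add.m_assoc N.M.r_neg)
      moreover have "v \<ominus>\<^bsub>M\<^esub> x \<in> V" using v ux X(3) M.submodule_minus[OF V] by blast
      ultimately have "v \<ominus>\<^bsub>M\<^esub> x \<in> X" using ux(1) X(2) by blast
      then have "(v \<ominus>\<^bsub>M\<^esub> x) \<oplus>\<^bsub>M\<^esub> x \<in> X" using ux(2) submoduleD(3)[OF X(1)] by blast
      then show "v \<in> X" using c by (simp add: a_minus_def M.M.add.m_assoc M.M.l_neg)
    qed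
  qed
  have \<phi>\<psi>: "?\<phi> (?\<psi> Y) = Y" if Y: "submodule R Y N" "U \<subseteq> Y" "Y \<subseteq> U <+>\<^bsub>N\<^esub> f ` V" for Y
  proof
    show "?\<phi> (?\<psi> Y) \<subseteq> Y" using Y by (intro N.set_add_least) auto
    show "Y \<subseteq> ?\<phi> (?\<psi> Y)"
    proof
      fix y assume y: "y \<in> Y"
      then obtain u v where uv: "u \<in> U" "v \<in> V" "y = u \<oplus>\<^bsub>N\<^esub> f v" using Y(3) by (blast elim: set_addE)
      then have "f v \<in> Y"
        using N.submodule_add_cancel[OF Y(1), of u "f v"] y Y(2) submoduleD(2)[OF fV] by blast
      then show "y \<in> ?\<phi> (?\<psi> Y)" using uv by (auto intro!: set_addI)
    qed
  qed
  show ?thesis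
  proof (rule antisym)
    show "ilen R N U (U <+>\<^bsub>N\<^esub> f ` V) \<le> ilen R M (V \<inter> f -` U) V"
    proof (rule ilen_le_of_strict_mono[where \<phi> = ?\<psi>])
      show "submodule R (?\<psi> X) M \<and> V \<inter> f -` U \<subseteq> ?\<psi> X \<and> ?\<psi> X \<subseteq> V" if "submodule R X N" "U \<subseteq> X" for X
        using submodule_vimage[OF V that(1)] that(2) by blast
      show "?\<psi> X \<subset> ?\<psi> Y" if "submodule R X N" "U \<subseteq> X" "submodule R Y N" "Y \<subseteq> U <+>\<^bsub>N\<^esub> f ` V" "X \<subset> Y" for X Y
      proof -
        have "?\<phi> (?\<psi> X) = X" "?\<phi> (?\<psi> Y) = Y" using that by (intro \<phi>\<psi>; auto)+
        then have "?\<psi> X \<noteq> ?\<psi> Y" using \<open>X \<subset> Y\<close> by (metis psubset_eq)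
        then show ?thesis using \<open>X \<subset> Y\<close> by blast
      qed
    qed
    show "ilen R M (V \<inter> f -` U) V \<le> ilen R N U (U <+>\<^bsub>N\<^esub> f ` V)"
    proof (rule ilen_le_of_strict_mono[where \<phi> = ?\<phi>])
      show "submodule R (?\<phi> X) N \<and> U \<subseteq> ?\<phi> X \<and> ?\<phi> X \<subseteq> U <+>\<^bsub>N\<^esub> f ` V" if "submodule R X M" "X \<subseteq> V" for X
        using N.submodule_set_add[OF U submodule_image[OF that(1)]]
          N.set_add_upper(1)[OF U submodule_image[OF that(1)]]
          N.set_add_mono[of U U "f ` X" "f ` V"] that(2) by blast
      show "?\<phi> X \<subset> ?\<phi> Y" if "submodule R X M" "V \<inter> f -` U \<subseteq> X" "submodule R Y M" "Y \<subseteq> V" "X \<subset> Y" for X Y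
      proof -
        have "?\<psi> (?\<phi> X) = X" "?\<psi> (?\<phi> Y) = Y" using that by (intro \<psi>\<phi>; auto)+
        then have "?\<phi> X \<noteq> ?\<phi> Y" using \<open>X \<subset> Y\<close> by (metis psubset_eq)
        moreover have "?\<phi> X \<subseteq> ?\<phi> Y" using \<open>X \<subset> Y\<close> by (intro N.set_add_mono) auto
        ultimately show ?thesis by blast
      qed
    qed
  qed
qed

lemma (in mod_hom) ilen_image:
  assumes V: "submodule R V M"
  shows "ilen R N {\<zero>\<^bsub>N\<^esub>} (f ` V) = ilen R M (V \<inter> f -` {\<zero>\<^bsub>N\<^esub>}) V"
proof -
  have "{\<zero>\<^bsub>N\<^esub>} <+>\<^bsub>N\<^esub> f ` V = f ` V"
    using submodule_image[OF V] submoduleD(4) N.submodule_zero by (intro N.set_add_absorb) auto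
  then show ?thesis using ilen_hom[OF N.submodule_zero V] by simp
qed

context Module.module begin

lemma ilen_second_iso:
  assumes "submodule R U M" "submodule R V M"
  shows "ilen R M U (U <+>\<^bsub>M\<^esub> V) = ilen R M (V \<inter> U) V"
proof -
  have "mod_hom R M M (\<lambda>x. x)"
    unfolding mod_hom_def mod_hom_axioms_def LinearCombinations.module_hom_def using module_axioms by auto
  from mod_hom.ilen_hom[OF this assms] show ?thesis unfolding image_ident vimage_ident .
qed

lemma ilen_set_add_le:
  assumes "submodule R U M" "submodule R U' M" "submodule R V M" "submodule R V' M" "U \<subseteq> V" "U' \<subseteq> V'"
  shows "ilen R M (U <+>\<^bsub>M\<^esub> U') (V <+>\<^bsub>M\<^esub> V') \<le> ilen R M U V + ilen R M U' V'"
proof -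
  have step: "ilen R M (A <+>\<^bsub>M\<^esub> C) (B <+>\<^bsub>M\<^esub> C) \<le> ilen R M A B"
    if s: "submodule R A M" "submodule R B M" "submodule R C M" "A \<subseteq> B" for A B C
  proof -
    have AC: "submodule R (A <+>\<^bsub>M\<^esub> C) M" using s submodule_set_add by blast
    have "(A <+>\<^bsub>M\<^esub> C) <+>\<^bsub>M\<^esub> B = B <+>\<^bsub>M\<^esub> (A <+>\<^bsub>M\<^esub> C)" using AC s by (intro set_add_commute)
    also have "\<dots> = (B <+>\<^bsub>M\<^esub> A) <+>\<^bsub>M\<^esub> C" using s by (intro set_add_assoc[symmetric])
    also have "B <+>\<^bsub>M\<^esub> A = B" using s set_add_absorb set_add_commute by metis
    finally have "ilen R M (A <+>\<^bsub>M\<^esub> C) (B <+>\<^bsub>M\<^esub> C) = ilen R M (B \<inter> (A <+>\<^bsub>M\<^esub> C)) B"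
      using ilen_second_iso[OF AC s(2)] by simp
    also have "\<dots> \<le> ilen R M A B" using set_add_upper(1)[OF s(1,3)] s(4) by (intro ilen_mono) auto
    finally show ?thesis .
  qed
  have 1: "ilen R M (U <+>\<^bsub>M\<^esub> U') (V <+>\<^bsub>M\<^esub> U') \<le> ilen R M U V" by (rule step) (use assms in auto)
  have 2: "ilen R M (V <+>\<^bsub>M\<^esub> U') (V <+>\<^bsub>M\<^esub> V') \<le> ilen R M U' V'"
    using step[of U' V' V] assms set_add_commute[of V U'] set_add_commute[of V V'] by simp
  have "ilen R M (U <+>\<^bsub>M\<^esub> U') (V <+>\<^bsub>M\<^esub> V') =
      ilen R M (U <+>\<^bsub>M\<^esub> U') (V <+>\<^bsub>M\<^esub> U') + ilen R M (V <+>\<^bsub>M\<^esub> U') (V <+>\<^bsub>M\<^esub> V')"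
    using assms by (intro ilen_add submodule_set_add set_add_mono order_refl)
  then show ?thesis using add_mono[OF 1 2] by simp
qed

end

section \<open>The ring as a module\<close>

lemma ring_as_module_simps [simp]:
  "carrier (ring_as_module R) = carrier R" "zero (ring_as_module R) = zero R"
  "add (ring_as_module R) = add R" "smult (ring_as_module R) = monoid.mult R"
  by (simp_all add: ring_as_module_def)

lemma (in cring) module_ring_as_module: "Module.module R (ring_as_module R)"
proof -
  have "abelian_group (ring_as_module R)"
  proof (rule abelian_groupI)
    fix x assume "x \<in> carrier (ring_as_module R)"
    then show "\<exists>y\<in>carrier (ring_as_module R). y \<oplus>\<^bsub>ring_as_module R\<^esub> x = \<zero>\<^bsub>ring_as_module R\<^esub>"
      by (intro bexI[of _ "\<ominus> x"]) (auto simp: l_neg)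
  qed (auto simp: a_ac)
  then show ?thesis
    by (intro moduleI) (auto simp: is_cring l_distr r_distr m_assoc)
qed

lemma (in cring) submodule_of_ideal: "ideal I R \<Longrightarrow> submodule R I (ring_as_module R)"
  using module_ring_as_module
  by (auto simp: submodule_def ideal.I_l_closed additive_subgroup.zero_closed additive_subgroup.a_closed
        ideal.axioms(1) dest: ideal.Icarr)

context Module.module begin

lemma mod_hom_smult:
  assumes x: "x \<in> carrier M" shows "mod_hom R (ring_as_module R) M (\<lambda>r. r \<odot>\<^bsub>M\<^esub> x)"
proof -
  have "(\<lambda>r. r \<odot>\<^bsub>M\<^esub> x) \<in> LinearCombinations.module_hom R (ring_as_module R) M"
    using x by (auto simp: LinearCombinations.module_hom_def smult_l_distr smult_assoc1)
  then show ?thesis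
    unfolding mod_hom_def mod_hom_axioms_def using module_axioms R.module_ring_as_module by blast
qed

lemma scale_cyclic:
  assumes x: "x \<in> carrier M" and I: "submodule R I (ring_as_module R)"
  shows "scale R M I (cyclic_submodule R M x) = (\<lambda>r. r \<odot>\<^bsub>M\<^esub> x) ` I"
proof
  interpret h: mod_hom R "ring_as_module R" M "\<lambda>r. r \<odot>\<^bsub>M\<^esub> x" using x by (rule mod_hom_smult)
  have Ic: "I \<subseteq> carrier R" using submoduleD(2)[OF I] by simp
  show "scale R M I (cyclic_submodule R M x) \<subseteq> (\<lambda>r. r \<odot>\<^bsub>M\<^esub> x) ` I"
  proof (rule scale_least[OF h.submodule_image[OF I]])
    fix r y assume r: "r \<in> I" and "y \<in> cyclic_submodule R M x"
    then obtain s where s: "s \<in> carrier R" "y = s \<odot>\<^bsub>M\<^esub> x" by (auto simp: cyclic_submodule_def)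
    have "r \<odot>\<^bsub>M\<^esub> y = (s \<otimes> r) \<odot>\<^bsub>M\<^esub> x" using r s Ic x by (simp add: smult_assoc1[symmetric] R.m_comm subset_iff)
    moreover have "s \<otimes> r \<in> I" using submoduleD(5)[OF I s(1) r] by simp
    ultimately show "r \<odot>\<^bsub>M\<^esub> y \<in> (\<lambda>r. r \<odot>\<^bsub>M\<^esub> x) ` I" by blast
  qed
  show "(\<lambda>r. r \<odot>\<^bsub>M\<^esub> x) ` I \<subseteq> scale R M I (cyclic_submodule R M x)"
    using scaleI self_in_cyclic[OF x] by blast
qed

lemma submodule_colon:
  assumes I: "I \<subseteq> carrier R" and W: "submodule R W M"
  shows "submodule R {x \<in> carrier M. \<forall>r\<in>I. r \<odot>\<^bsub>M\<^esub> x \<in> W} M"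
  unfolding submodule_def
proof (intro conjI allI impI)
  note w = submoduleD[OF W]
  show "Module.module R M" by (rule module_axioms)
  show "\<zero>\<^bsub>M\<^esub> \<in> {x \<in> carrier M. \<forall>r\<in>I. r \<odot>\<^bsub>M\<^esub> x \<in> W}" using I w(4) by (auto simp: subset_iff)
  fix v w assume "v \<in> {x \<in> carrier M. \<forall>r\<in>I. r \<odot>\<^bsub>M\<^esub> x \<in> W}" "w \<in> {x \<in> carrier M. \<forall>r\<in>I. r \<odot>\<^bsub>M\<^esub> x \<in> W}"
  then show "v \<oplus>\<^bsub>M\<^esub> w \<in> {x \<in> carrier M. \<forall>r\<in>I. r \<odot>\<^bsub>M\<^esub> x \<in> W}"
    using I w(3) by (auto simp: subset_iff smult_r_distr)
next
  note w = submoduleD[OF W]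
  fix c v assume c: "c \<in> carrier R" and "v \<in> {x \<in> carrier M. \<forall>r\<in>I. r \<odot>\<^bsub>M\<^esub> x \<in> W}"
  then have v: "v \<in> carrier M" "\<And>r. r \<in> I \<Longrightarrow> r \<odot>\<^bsub>M\<^esub> v \<in> W" by auto
  have "r \<odot>\<^bsub>M\<^esub> (c \<odot>\<^bsub>M\<^esub> v) \<in> W" if r: "r \<in> I" for r
  proof -
    have "r \<odot>\<^bsub>M\<^esub> (c \<odot>\<^bsub>M\<^esub> v) = c \<odot>\<^bsub>M\<^esub> (r \<odot>\<^bsub>M\<^esub> v)" 
      using r I c v(1) by (simp add: smult_assoc1[symmetric] R.m_comm subset_iff)
    then show ?thesis using w(5)[OF c v(2)[OF r]] by simp
  qed
  then show "c \<odot>\<^bsub>M\<^esub> v \<in> {x \<in> carrier M. \<forall>r\<in>I. r \<odot>\<^bsub>M\<^esub> x \<in> W}" using v c by auto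
qed auto

end

section \<open>Generators\<close>

text \<open>
  \<open>generated R M n F\<close>: the submodule \<open>F\<close> has \<open>n\<close> generators, possibly redundant ones. Adding the
  generators one at a time is what the length estimates need for their inductions.
\<close>
inductive generated :: "('a, 'r) ring_scheme \<Rightarrow> ('a, 'b, 'c) module_scheme \<Rightarrow> nat \<Rightarrow> 'b set \<Rightarrow> bool"
  for R M where
    generated_0: "generated R M 0 {\<zero>\<^bsub>M\<^esub>}"
  | generated_Suc: "generated R M n F \<Longrightarrow> x \<in> carrier M \<Longrightarrow> generated R M (Suc n) (F <+>\<^bsub>M\<^esub> cyclic_submodule R M x)"

context Module.module begin

lemma submodule_generated: "generated R M n F \<Longrightarrow> submodule R F M"
  by (induction rule: generated.induct) (auto intro: submodule_zero submodule_set_add submodule_cyclic)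

lemma finite_set_generates:
  assumes "finite A" "A \<subseteq> carrier M"
  shows "\<exists>F. generated R M (card A) F \<and> A \<subseteq> F \<and> (\<forall>W. submodule R W M \<longrightarrow> A \<subseteq> W \<longrightarrow> F \<subseteq> W)"
  using assms
proof (induction A rule: finite_induct)
  case empty
  then show ?case using generated_0[of R M] submoduleD(4) by (intro exI[of _ "{\<zero>\<^bsub>M\<^esub>}"]) auto
next
  case (insert x A)
  then obtain F where F: "generated R M (card A) F" "A \<subseteq> F" "\<And>W. submodule R W M \<Longrightarrow> A \<subseteq> W \<Longrightarrow> F \<subseteq> W"
    by auto
  have x: "x \<in> carrier M" using insert by auto
  have s: "submodule R F M" "submodule R (cyclic_submodule R M x) M"
    using submodule_generated[OF F(1)] submodule_cyclic[OF x] by auto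
  have "generated R M (Suc (card A)) (F <+>\<^bsub>M\<^esub> cyclic_submodule R M x)" by (rule generated_Suc[OF F(1) x])
  moreover have "insert x A \<subseteq> F <+>\<^bsub>M\<^esub> cyclic_submodule R M x"
    using set_add_upper[OF s] F(2) self_in_cyclic[OF x] by blast
  moreover have "F <+>\<^bsub>M\<^esub> cyclic_submodule R M x \<subseteq> W" if "submodule R W M" "insert x A \<subseteq> W" for W
    using that F(3) cyclic_least by (intro set_add_least) auto
  ultimately show ?case using insert.hyps by auto
qed

text \<open>
  With \<open>n\<close> generators \<open>F\<close> is a quotient of \<open>R\<^sup>n\<close>, so that \<open>J F / I F\<close> is a quotient of \<open>(J/I)\<^sup>n\<close>. This is the source
  of all upper bounds.
\<close>
lemma ilen_scale_generated_le:
  assumes I: "submodule R I (ring_as_module R)" and J: "submodule R J (ring_as_module R)" and IJ: "I \<subseteq> J"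
    and "generated R M n F"
  shows "ilen R M (scale R M I F) (scale R M J F) \<le> enat n * ilen R (ring_as_module R) I J"
  using assms(4)
proof (induction rule: generated.induct)
  case generated_0
  have "scale R M K {\<zero>\<^bsub>M\<^esub>} = {\<zero>\<^bsub>M\<^esub>}" if "submodule R K (ring_as_module R)" for K
  proof -
    have K: "K \<subseteq> carrier R" using submoduleD(2)[OF that] by simp
    have "scale R M K {\<zero>\<^bsub>M\<^esub>} \<subseteq> {\<zero>\<^bsub>M\<^esub>}" using K by (intro scale_subset submodule_zero)
    then show ?thesis using submoduleD(4)[OF submodule_scale[OF K, of "{\<zero>\<^bsub>M\<^esub>}"]] by auto
  qed
  then show ?case using I J by (simp add: ilen_self)
next
  case (generated_Suc n F x)
  interpret h: mod_hom R "ring_as_module R" M "\<lambda>r. r \<odot>\<^bsub>M\<^esub> x" using generated_Suc.hyps(2) by (rule mod_hom_smult)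
  let ?C = "cyclic_submodule R M x"
  have Ic: "I \<subseteq> carrier R" and Jc: "J \<subseteq> carrier R" using submoduleD(2)[OF I] submoduleD(2)[OF J] by auto
  have F: "submodule R F M" using submodule_generated generated_Suc.hyps by blast
  have C: "submodule R ?C M" using submodule_cyclic generated_Suc.hyps by blast
  have s: "submodule R (scale R M I F) M" "submodule R (scale R M I ?C) M"
    "submodule R (scale R M J F) M" "submodule R (scale R M J ?C) M"
    using submodule_scale Ic Jc submoduleD(2)[OF F] submoduleD(2)[OF C] by auto
  have "ilen R M (scale R M I ?C) (scale R M J ?C) \<le> ilen R (ring_as_module R) I J"
  proof -
    have "scale R M J ?C = scale R M I ?C <+>\<^bsub>M\<^esub> scale R M J ?C"
      using s IJ by (intro set_add_absorb[symmetric] scale_mono) auto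
    then have "ilen R M (scale R M I ?C) (scale R M J ?C) =
        ilen R M (scale R M I ?C) (scale R M I ?C <+>\<^bsub>M\<^esub> (\<lambda>r. r \<odot>\<^bsub>M\<^esub> x) ` J)"
      using scale_cyclic[OF generated_Suc.hyps(2) J] by simp
    also have "\<dots> = ilen R (ring_as_module R) (J \<inter> (\<lambda>r. r \<odot>\<^bsub>M\<^esub> x) -` scale R M I ?C) J"
      by (rule h.ilen_hom[OF s(2) J])
    also have "\<dots> \<le> ilen R (ring_as_module R) I J"
      using IJ scale_cyclic[OF generated_Suc.hyps(2) I] by (intro ilen_mono) auto
    finally show ?thesis .
  qed
  moreover have "ilen R M (scale R M I (F <+>\<^bsub>M\<^esub> ?C)) (scale R M J (F <+>\<^bsub>M\<^esub> ?C)) \<le>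
      ilen R M (scale R M I F) (scale R M J F) + ilen R M (scale R M I ?C) (scale R M J ?C)"
    unfolding scale_set_add[OF Ic F C] scale_set_add[OF Jc F C]
    using s IJ by (intro ilen_set_add_le scale_mono) auto
  ultimately have "ilen R M (scale R M I (F <+>\<^bsub>M\<^esub> ?C)) (scale R M J (F <+>\<^bsub>M\<^esub> ?C)) \<le>
      enat n * ilen R (ring_as_module R) I J + ilen R (ring_as_module R) I J"
    using generated_Suc.IH by (meson add_mono order_trans)
  also have "\<dots> = enat (Suc n) * ilen R (ring_as_module R) I J"
    by (simp add: eSuc_enat[symmetric] mult_eSuc add.commute)
  finally show ?case .
qed

end

section \<open>Local rings with radical cube zero\<close>

text \<open>
  Every finite length statement below comes from this setting: \<open>\<mm>/\<mm>\<^sup>2\<close> and \<open>\<mm>\<^sup>2\<close> are finite-dimensional over the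
  residue field because \<open>\<mm>\<close> and \<open>\<mm>\<^sup>2\<close> are finitely generated and \<open>\<mm>\<^sup>3 = 0\<close>.
\<close>
locale cube_zero_local_ring =
  fixes R (structure) and \<mm>
  assumes local_ring: "noetherian_local_ring R \<mm>"
    and cube_zero: "ideal_prod R \<mm> (ideal_prod R \<mm> \<mm>) = {\<zero>\<^bsub>R\<^esub>}"
begin

sublocale cring R using local_ring by (simp add: noetherian_local_ring_def)

sublocale max: maximalideal \<mm> R using local_ring by (simp add: noetherian_local_ring_def)

abbreviation \<mm>2 where "\<mm>2 \<equiv> ideal_prod R \<mm> \<mm>"
abbreviation RR where "RR \<equiv> ring_as_module R"

lemma \<mm>_carrier: "\<mm> \<subseteq> carrier R" using max.Icarr by blast

lemma ideal_\<mm>: "ideal \<mm> R" by (rule max.ideal_axioms)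

lemma ideal_\<mm>2: "ideal \<mm>2 R" using ideal_prod_is_ideal[OF ideal_\<mm> ideal_\<mm>] .

lemma \<mm>2_subset: "\<mm>2 \<subseteq> \<mm>" using ideal_prod_inter[OF ideal_\<mm> ideal_\<mm>] by blast

lemma \<mm>2_carrier: "\<mm>2 \<subseteq> carrier R" using \<mm>2_subset \<mm>_carrier by blast

sublocale RR: Module.module R RR
  rewrites "carrier RR = carrier R" and "zero RR = zero R" and "add RR = add R" and "smult RR = monoid.mult R"
  by (rule module_ring_as_module) simp_all

lemma mult_\<mm>_\<mm>2: "x \<in> \<mm> \<Longrightarrow> y \<in> \<mm>2 \<Longrightarrow> x \<otimes> y = \<zero>"
  using ideal_prod.prod[of x \<mm> y \<mm>2 R] cube_zero by auto

lemma mult_\<mm>_\<mm>: "x \<in> \<mm> \<Longrightarrow> y \<in> \<mm> \<Longrightarrow> x \<otimes> y \<in> \<mm>2"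
  by (rule ideal_prod.prod)

text \<open>
  Since \<open>\<mm>\<close> is maximal, \<open>1 = a + r x\<close> for some \<open>a \<in> \<mm>\<close>, and \<open>1 - a\<close> has the inverse \<open>1 + a + a\<^sup>2\<close>.
\<close>
lemma unit_if_not_mem:
  assumes x: "x \<in> carrier R" "x \<notin> \<mm>"
  shows "\<exists>y\<in>carrier R. y \<otimes> x = \<one>"
proof -
  let ?J = "\<mm> <+>\<^bsub>R\<^esub> PIdl x"
  have J: "ideal ?J R" using add_ideals[OF ideal_\<mm> cgenideal_ideal[OF x(1)]] .
  have z: "\<zero> \<in> \<mm>" "\<zero> \<in> PIdl x" using additive_subgroup.zero_closed ideal.axioms(1) ideal_\<mm> cgenideal_ideal[OF x(1)] by auto
  have "\<mm> \<subseteq> ?J"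
  proof
    fix a assume a: "a \<in> \<mm>"
    then have "a \<oplus> \<zero> \<in> ?J" using z by (intro set_addI)
    then show "a \<in> ?J" using a \<mm>_carrier by auto
  qed
  moreover have "x \<in> ?J"
  proof -
    have "\<zero> \<oplus> x \<in> ?J" using z cgenideal_self[OF x(1)] by (intro set_addI)
    then show ?thesis using x by simp
  qed
  ultimately have "?J = carrier R" using max.I_maximal[OF J] ideal.Icarr[OF J] x(2) by blast
  then have "\<one> \<in> ?J" by simp
  then obtain a r where ar: "a \<in> \<mm>" "r \<in> carrier R" "\<one> = a \<oplus> r \<otimes> x"
    by (auto elim!: set_addE simp: cgenideal_def)
  have c: "a \<in> carrier R" using ar \<mm>_carrier by auto
  \<comment> \<open>The remaining computation is \<open>(1 + a + a\<^sup>2)(1 - a) = 1 - a\<^sup>3 = 1\<close>.\<close>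
  have a3: "a \<otimes> (a \<otimes> a) = \<zero>" using mult_\<mm>_\<mm>2 mult_\<mm>_\<mm> ar(1) by blast
  have "r \<otimes> x = \<one> \<ominus> a" using ar(2) x(1) c unfolding ar(3) by algebra
  then have "(\<one> \<oplus> a \<oplus> a \<otimes> a) \<otimes> (r \<otimes> x) = (\<one> \<oplus> a \<oplus> a \<otimes> a) \<otimes> (\<one> \<ominus> a)" by simp
  also have "\<dots> = \<one> \<ominus> a \<otimes> (a \<otimes> a)" using c by algebra
  also have "\<dots> = \<one>" using a3 by (simp add: minus_eq)
  finally have "((\<one> \<oplus> a \<oplus> a \<otimes> a) \<otimes> r) \<otimes> x = \<one>" using c ar(2) x(1) by (simp add: m_assoc)
  then show ?thesis using c ar(2) by blast
qed

end

context cube_zero_local_ring begin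

lemma submodule_RR [simp]:
  "submodule R \<mm> RR" "submodule R \<mm>2 RR" "submodule R (carrier R) RR" "submodule R {\<zero>} RR"
  using submodule_of_ideal ideal_\<mm> ideal_\<mm>2 oneideal zeroideal by auto

lemma submodule_RR_one:
  assumes "submodule R I RR" "x \<in> I" "x \<notin> \<mm>" shows "I = carrier R"
proof -
  have I: "I \<subseteq> carrier R" using submoduleD(2)[OF assms(1)] by simp
  then obtain y where y: "y \<in> carrier R" "y \<otimes> x = \<one>" using unit_if_not_mem assms by blast
  have "\<one> \<in> I" using submoduleD(5)[OF assms(1) y(1) assms(2)] y(2) by simp
  then have "r \<in> I" if "r \<in> carrier R" for r using submoduleD(5)[OF assms(1) that, of \<one>] that by simp
  then show ?thesis using I by blast
qed

lemma one_not_in_\<mm>: "\<one> \<notin> \<mm>"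
  using max.one_imp_carrier max.I_notcarr by blast

lemma ilen_\<mm>_carrier: "ilen R RR \<mm> (carrier R) = 1"
proof (rule antisym)
  show "1 \<le> ilen R RR \<mm> (carrier R)"
    using \<mm>_carrier one_not_in_\<mm> by (intro RR.ilen_psubset) auto
  have "ilen R RR \<mm> (carrier R) \<le> enat 1"
    unfolding ilen_def
  proof (rule SUP_least)
    fix n assume "n \<in> {n. submodule_chain R RR \<mm> (carrier R) n}"
    then obtain N where N: "\<And>i. i \<le> n \<Longrightarrow> submodule R (N i) RR \<and> \<mm> \<subseteq> N i \<and> N i \<subseteq> carrier R"
      "\<And>i. i < n \<Longrightarrow> N i \<subset> N (Suc i)" unfolding submodule_chain_def by blast
    have "\<not> n \<ge> 2"
    proof
      assume n: "n \<ge> 2"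
      have "\<mm> \<subset> N 1" using N(1)[of 0] N(2)[of 0] n by auto
      then obtain x where "x \<in> N 1" "x \<notin> \<mm>" by blast
      then have "N 1 = carrier R" using submodule_RR_one N(1)[of 1] n by auto
      then show False using N(1)[of 2] N(2)[of 1] n by (auto simp: numeral_2_eq_2)
    qed
    then show "enat n \<le> enat 1" by simp
  qed
  then show "ilen R RR \<mm> (carrier R) \<le> 1" by (simp add: one_enat_def)
qed

lemma ideal_of_submodule:
  assumes F: "submodule R F RR" shows "ideal F R"
proof (rule idealI[OF ring_axioms])
  have c: "F \<subseteq> carrier R" using submoduleD(2)[OF F] by simp
  have mult: "c \<otimes> v \<in> F" if "c \<in> carrier R" "v \<in> F" for c v using submoduleD(5)[OF F that] by simp
  have neg: "\<ominus> a \<in> F" if a: "a \<in> F" for a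
    using mult[OF _ a, of "\<ominus> \<one>"] a c by (simp add: l_minus subset_iff)
  show "subgroup F (add_monoid R)"
    using c neg submoduleD(3,4)[OF F] by (auto simp: subgroup_def simp flip: a_inv_def)
  show "x \<otimes> a \<in> F" if "a \<in> F" "x \<in> carrier R" for a x using mult that by blast
  show "a \<otimes> x \<in> F" if "a \<in> F" "x \<in> carrier R" for a x using mult[OF that(2,1)] m_comm[of a x] that c by auto
qed

text \<open>
  \<open>I/\<mm>I\<close> has length at most the number of generators of \<open>I\<close>.
\<close>
lemma finite_ilen_ideal:
  assumes I: "ideal I R"
  shows "\<exists>n. ilen R RR (scale R RR \<mm> I) I = enat n"
proof -
  obtain A where A: "A \<subseteq> carrier R" "finite A" "I = Idl A"
    using local_ring I by (auto simp: noetherian_local_ring_def noetherian_ring_def noetherian_ring_axioms_def)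
  obtain F where F: "generated R RR (card A) F" "A \<subseteq> F" "\<And>W. submodule R W RR \<Longrightarrow> A \<subseteq> W \<Longrightarrow> F \<subseteq> W"
    using RR.finite_set_generates[OF A(2,1)] by auto
  have sF: "submodule R F RR" using F(1) by (rule RR.submodule_generated)
  have "F = I"
  proof
    have "A \<subseteq> I" using genideal_self[OF A(1)] unfolding A(3) .
    then show "F \<subseteq> I" by (rule F(3)[OF submodule_of_ideal[OF I]])
    have "ideal F R" by (rule ideal_of_submodule[OF sF])
    then show "I \<subseteq> F" unfolding A(3) by (rule genideal_minimal[OF _ F(2)])
  qed
  have "ilen R RR (scale R RR \<mm> F) (scale R RR (carrier R) F) \<le> enat (card A) * ilen R RR \<mm> (carrier R)"
    using \<mm>_carrier by (intro RR.ilen_scale_generated_le F(1)) auto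
  then have "ilen R RR (scale R RR \<mm> I) I \<le> enat (card A)"
    using RR.scale_carrier[OF sF] \<open>F = I\<close> by (simp add: ilen_\<mm>_carrier)
  then show ?thesis by (cases "ilen R RR (scale R RR \<mm> I) I") auto
qed

lemma scale_RR: "ideal I R \<Longrightarrow> ideal J R \<Longrightarrow> scale R RR I J = ideal_prod R I J"
proof
  assume I: "ideal I R" and J: "ideal J R"
  have c: "I \<subseteq> carrier R" "J \<subseteq> carrier R" using ideal.Icarr[OF I] ideal.Icarr[OF J] by auto
  show "scale R RR I J \<subseteq> ideal_prod R I J"
    using RR.scale_least[OF submodule_of_ideal[OF ideal_prod_is_ideal[OF I J]]] ideal_prod.prod[of _ I _ J R] by simp
  show "ideal_prod R I J \<subseteq> scale R RR I J"
  proof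
    fix x assume "x \<in> ideal_prod R I J"
    then show "x \<in> scale R RR I J"
      by (induction rule: ideal_prod.induct)
        (use RR.scaleI[of _ I _ J] submoduleD(3)[OF RR.submodule_scale[OF c]] in auto)
  qed
qed

text \<open>
  The two lengths that control the ring. The first is the embedding dimension, the number called \<open>e\<close> in the
  theorem; the second is the length of \<open>\<mm>\<^sup>2\<close>, called \<open>f\<close> in the comments. Both are finite, so
  that nothing is lost by taking natural numbers.
\<close>
definition embdim where "embdim = the_enat (ilen R RR \<mm>2 \<mm>)"
definition sqdim where "sqdim = the_enat (ilen R RR {\<zero>} \<mm>2)"

lemma ilen_\<mm>2_\<mm>: "ilen R RR \<mm>2 \<mm> = enat embdim"
  using finite_ilen_ideal[OF ideal_\<mm>] scale_RR[OF ideal_\<mm> ideal_\<mm>] unfolding embdim_def by auto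

lemma ilen_0_\<mm>2: "ilen R RR {\<zero>} \<mm>2 = enat sqdim"
  using finite_ilen_ideal[OF ideal_\<mm>2] scale_RR[OF ideal_\<mm> ideal_\<mm>2] cube_zero unfolding sqdim_def by auto

lemma ilen_RR: "ilen R RR {\<zero>} (carrier R) = enat (1 + embdim + sqdim)"
proof -
  have "ilen R RR {\<zero>} (carrier R) = ilen R RR {\<zero>} \<mm>2 + ilen R RR \<mm>2 (carrier R)"
    using \<mm>2_carrier submoduleD(4)[OF submodule_RR(2)] by (intro RR.ilen_add) auto
  also have "ilen R RR \<mm>2 (carrier R) = ilen R RR \<mm>2 \<mm> + ilen R RR \<mm> (carrier R)"
    using \<mm>_carrier \<mm>2_subset by (intro RR.ilen_add) auto
  finally show ?thesis by (simp add: ilen_\<mm>2_\<mm> ilen_0_\<mm>2 ilen_\<mm>_carrier one_enat_def)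
qed

end

locale cube_zero_module = cube_zero_local_ring R \<mm> + Module.module R M for R (structure) and \<mm> and M (structure)
begin

abbreviation mS where "mS V \<equiv> scale R M \<mm> V"
abbreviation m2S where "m2S V \<equiv> scale R M \<mm>2 V"

lemma submodule_mS: "submodule R V M \<Longrightarrow> submodule R (mS V) M"
  using submodule_scale[OF \<mm>_carrier] submoduleD(2) by blast

lemma submodule_m2S: "submodule R V M \<Longrightarrow> submodule R (m2S V) M"
  using submodule_scale[OF \<mm>2_carrier] submoduleD(2) by blast

lemma mS_subset: "submodule R V M \<Longrightarrow> mS V \<subseteq> V"
  by (rule scale_subset[OF \<mm>_carrier])

lemma m2S_subset_mS: "m2S V \<subseteq> mS V"
  by (rule scale_mono[OF \<mm>2_subset]) simp

lemma mS_mS: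
  assumes V: "submodule R V M" shows "mS (mS V) = m2S V"
proof
  note v = submoduleD[OF V]
  have "mS V \<subseteq> {x \<in> carrier M. \<forall>r\<in>\<mm>. r \<odot>\<^bsub>M\<^esub> x \<in> m2S V}"
  proof (rule scale_least[OF submodule_colon[OF \<mm>_carrier submodule_m2S[OF V]]])
    fix r x assume r: "r \<in> \<mm>" "x \<in> V"
    have "s \<odot>\<^bsub>M\<^esub> (r \<odot>\<^bsub>M\<^esub> x) \<in> m2S V" if "s \<in> \<mm>" for s
    proof -
      have "s \<odot>\<^bsub>M\<^esub> (r \<odot>\<^bsub>M\<^esub> x) = (s \<otimes> r) \<odot>\<^bsub>M\<^esub> x" using that r v(2) \<mm>_carrier by (simp add: smult_assoc1 subset_iff)
      then show ?thesis using scaleI[OF mult_\<mm>_\<mm>[OF that r(1)] r(2)] by simp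
    qed
    then show "r \<odot>\<^bsub>M\<^esub> x \<in> {x \<in> carrier M. \<forall>r\<in>\<mm>. r \<odot>\<^bsub>M\<^esub> x \<in> m2S V}"
      using r v(2) \<mm>_carrier by auto
  qed
  then show "mS (mS V) \<subseteq> m2S V" by (intro scale_least submodule_m2S V) blast
  show "m2S V \<subseteq> mS (mS V)"
  proof (rule scale_least[OF submodule_mS[OF submodule_mS[OF V]]])
    fix r x assume "r \<in> \<mm>2" and x: "x \<in> V"
    then have xc: "x \<in> carrier M" using v by auto
    from \<open>r \<in> \<mm>2\<close> show "r \<odot>\<^bsub>M\<^esub> x \<in> mS (mS V)"
    proof (induction rule: ideal_prod.induct)
      case (prod i j)
      then have "(i \<otimes> j) \<odot>\<^bsub>M\<^esub> x = i \<odot>\<^bsub>M\<^esub> (j \<odot>\<^bsub>M\<^esub> x)" using xc \<mm>_carrier by (simp add: smult_assoc1 subset_iff)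
      then show ?case using prod x scaleI by metis
    next
      case (sum s t)
      then have "s \<in> carrier R" "t \<in> carrier R" using \<mm>2_carrier by auto
      then show ?case using sum xc submoduleD(3)[OF submodule_mS[OF submodule_mS[OF V]]] by (simp add: smult_l_distr)
    qed
  qed
qed

lemma mS_m2S:
  assumes V: "submodule R V M" shows "mS (m2S V) = {\<zero>\<^bsub>M\<^esub>}"
proof
  note v = submoduleD[OF V]
  have "m2S V \<subseteq> {x \<in> carrier M. \<forall>r\<in>\<mm>. r \<odot>\<^bsub>M\<^esub> x \<in> {\<zero>\<^bsub>M\<^esub>}}"
  proof (rule scale_least[OF submodule_colon[OF \<mm>_carrier submodule_zero]])
    fix r x assume r: "r \<in> \<mm>2" "x \<in> V"
    have "s \<odot>\<^bsub>M\<^esub> (r \<odot>\<^bsub>M\<^esub> x) \<in> {\<zero>\<^bsub>M\<^esub>}" if "s \<in> \<mm>" for s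
    proof -
      have "s \<odot>\<^bsub>M\<^esub> (r \<odot>\<^bsub>M\<^esub> x) = (s \<otimes> r) \<odot>\<^bsub>M\<^esub> x" using that r v(2) \<mm>_carrier \<mm>2_carrier by (simp add: smult_assoc1 subset_iff)
      then show ?thesis using mult_\<mm>_\<mm>2[OF that r(1)] r(2) v(2) by auto
    qed
    then show "r \<odot>\<^bsub>M\<^esub> x \<in> {x \<in> carrier M. \<forall>r\<in>\<mm>. r \<odot>\<^bsub>M\<^esub> x \<in> {\<zero>\<^bsub>M\<^esub>}}"
      using r v(2) \<mm>2_carrier by auto
  qed
  then show "mS (m2S V) \<subseteq> {\<zero>\<^bsub>M\<^esub>}" by (intro scale_least submodule_zero) blast
  show "{\<zero>\<^bsub>M\<^esub>} \<subseteq> mS (m2S V)" using submoduleD(4)[OF submodule_mS[OF submodule_m2S[OF V]]] by simp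
qed

lemma m2S_mS: "submodule R V M \<Longrightarrow> m2S (mS V) = {\<zero>\<^bsub>M\<^esub>}"
  using mS_mS[of "mS V"] mS_mS[of V] mS_m2S[of V] submodule_mS by metis

text \<open>
  Nakayama's lemma, by iterating \<open>V \<subseteq> U + \<mm>V\<close>: as \<open>\<mm>\<^sup>3 = 0\<close>, three steps suffice for every module.
\<close>
lemma nakayama:
  assumes U: "submodule R U M" and V: "submodule R V M" and sub: "V \<subseteq> U <+>\<^bsub>M\<^esub> mS V"
  shows "V \<subseteq> U"
proof -
  have *: "mS W \<subseteq> U <+>\<^bsub>M\<^esub> mS (mS V)" if "W \<subseteq> U <+>\<^bsub>M\<^esub> mS V" for W
  proof -
    have "mS W \<subseteq> mS (U <+>\<^bsub>M\<^esub> mS V)" using that by (intro scale_mono) auto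
    also have "\<dots> = mS U <+>\<^bsub>M\<^esub> mS (mS V)" by (intro scale_set_add \<mm>_carrier U submodule_mS V)
    also have "\<dots> \<subseteq> U <+>\<^bsub>M\<^esub> mS (mS V)" by (intro set_add_mono mS_subset U order_refl)
    finally show ?thesis .
  qed
  have s: "submodule R (mS V) M" "submodule R (m2S V) M" using submodule_mS submodule_m2S V by auto
  have 1: "mS V \<subseteq> U <+>\<^bsub>M\<^esub> m2S V" using *[OF sub] mS_mS[OF V] by simp
  have "m2S V \<subseteq> U"
  proof -
    have "m2S V = mS (mS V)" using mS_mS[OF V] by simp
    also have "\<dots> \<subseteq> mS (U <+>\<^bsub>M\<^esub> m2S V)" using 1 by (intro scale_mono) auto
    also have "\<dots> = mS U <+>\<^bsub>M\<^esub> mS (m2S V)" by (intro scale_set_add \<mm>_carrier U s)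
    also have "\<dots> \<subseteq> U" using mS_m2S[OF V] submoduleD(4)[OF U] mS_subset[OF U] by (intro set_add_least U) auto
    finally show ?thesis .
  qed
  then have "mS V \<subseteq> U" using 1 set_add_least[OF U order_refl] by blast
  then show ?thesis using sub set_add_least[OF U order_refl] by blast
qed

lemma ilen_add_cyclic_le:
  assumes U: "submodule R U M" and x: "x \<in> carrier M" and mx: "\<And>r. r \<in> \<mm> \<Longrightarrow> r \<odot>\<^bsub>M\<^esub> x \<in> U"
  shows "ilen R M U (U <+>\<^bsub>M\<^esub> cyclic_submodule R M x) \<le> 1"
proof -
  interpret h: mod_hom R RR M "\<lambda>r. r \<odot>\<^bsub>M\<^esub> x" using x by (rule mod_hom_smult)
  have "cyclic_submodule R M x = (\<lambda>r. r \<odot>\<^bsub>M\<^esub> x) ` carrier R" by (auto simp: cyclic_submodule_def)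
  then have "ilen R M U (U <+>\<^bsub>M\<^esub> cyclic_submodule R M x) = ilen R RR (carrier R \<inter> (\<lambda>r. r \<odot>\<^bsub>M\<^esub> x) -` U) (carrier R)"
    using h.ilen_hom[OF U submodule_RR(3)] by simp
  also have "\<dots> \<le> ilen R RR \<mm> (carrier R)" using mx \<mm>_carrier by (intro ilen_mono) auto
  finally show ?thesis by (simp add: ilen_\<mm>_carrier)
qed

lemma ilen_add_cyclic:
  assumes U: "submodule R U M" and x: "x \<in> carrier M" "x \<notin> U" and mx: "\<And>r. r \<in> \<mm> \<Longrightarrow> r \<odot>\<^bsub>M\<^esub> x \<in> U"
  shows "ilen R M U (U <+>\<^bsub>M\<^esub> cyclic_submodule R M x) = 1"
proof (rule antisym[OF ilen_add_cyclic_le[OF U x(1) mx]])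
  note s = submodule_cyclic[OF x(1)]
  show "1 \<le> ilen R M U (U <+>\<^bsub>M\<^esub> cyclic_submodule R M x)"
    using set_add_upper[OF U s] self_in_cyclic[OF x(1)] x(2) by (intro ilen_psubset U submodule_set_add s) auto
qed

text \<open>
  A subquotient \<open>V/U\<close> of length \<open>n\<close> that is killed by \<open>\<mm>\<close> is a vector space of dimension \<open>n\<close> over the residue
  field, so \<open>n\<close> elements of \<open>V\<close> generate it modulo \<open>U\<close>. They are lifted along \<open>f\<close> at the same time: applied to the
  differentials this yields the submodules of \<open>A\<^sub>j\<^sub>+\<^sub>1\<close> that cover given submodules of \<open>A\<^sub>j\<close>.
\<close>
lemma exists_generated_lift:
  assumes h: "mod_hom R N M f"
    and V: "submodule R V M" and Vf: "V \<subseteq> f ` carrier N"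
    and "submodule R U M" "mS V \<subseteq> U" "U \<subseteq> V" "ilen R M U V = enat n"
  shows "\<exists>F. generated R N n F \<and> U <+>\<^bsub>M\<^esub> f ` F = V"
  using assms(4-)
proof (induction n arbitrary: U)
  interpret h: mod_hom R N M f by (rule h)
  {
    case 0
    then have "U = V" using ilen_eq_0_iff[OF 0(1) V 0(3)] by (simp add: zero_enat_def)
    moreover have "U <+>\<^bsub>M\<^esub> {\<zero>\<^bsub>M\<^esub>} = U"
      using 0 submoduleD(4)[OF 0(1)] set_add_absorb[OF submodule_zero 0(1)] set_add_commute[OF submodule_zero 0(1)] by simp
    ultimately show ?case using generated_0[of R N] by (intro exI[of _ "{\<zero>\<^bsub>N\<^esub>}"]) auto
  next
    case (Suc n)
    note U = Suc.prems(1)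
    have "U \<noteq> V" using Suc.prems ilen_self[of U] by (auto simp: zero_enat_def)
    then obtain x where x: "x \<in> V" "x \<notin> U" using Suc.prems by blast
    then obtain y where y: "y \<in> carrier N" "x = f y" using Vf by blast
    have xc: "x \<in> carrier M" using x(1) submoduleD(2)[OF V] by blast
    let ?U = "U <+>\<^bsub>M\<^esub> cyclic_submodule R M x"
    note C = submodule_cyclic[OF xc]
    have U': "submodule R ?U M" by (intro submodule_set_add U C)
    have UV: "?U \<subseteq> V" using Suc.prems cyclic_least[OF V x(1)] by (intro set_add_least V) auto
    have "ilen R M U V = ilen R M U ?U + ilen R M ?U V"
      using set_add_upper[OF U C] UV by (intro ilen_add U U' V)
    moreover have "ilen R M U ?U = 1" using x xc Suc.prems(2) scaleI[of _ \<mm> x V] by (intro ilen_add_cyclic U) auto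
    ultimately have "ilen R M ?U V = enat n" using Suc.prems(4)
      by (cases "ilen R M ?U V") (auto simp: one_enat_def)
    then obtain F where F: "generated R N n F" "?U <+>\<^bsub>M\<^esub> f ` F = V"
      using Suc.IH[OF U' _ UV] Suc.prems(2) set_add_upper[OF U C] by blast
    have sF: "submodule R F N" by (rule h.M.submodule_generated[OF F(1)])
    have Cy: "submodule R (cyclic_submodule R N y) N" by (rule h.M.submodule_cyclic[OF y(1)])
    have fC: "f ` cyclic_submodule R N y = cyclic_submodule R M x"
      using y unfolding cyclic_submodule_def by (auto simp: image_iff) (metis h.f_smult)+
    have "U <+>\<^bsub>M\<^esub> f ` (F <+>\<^bsub>N\<^esub> cyclic_submodule R N y) = U <+>\<^bsub>M\<^esub> (f ` F <+>\<^bsub>M\<^esub> cyclic_submodule R M x)"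
      using h.image_set_add[OF sF Cy] fC by simp
    also have "\<dots> = U <+>\<^bsub>M\<^esub> (cyclic_submodule R M x <+>\<^bsub>M\<^esub> f ` F)"
      using set_add_commute[OF h.submodule_image[OF sF] C] by simp
    also have "\<dots> = V" using set_add_assoc[OF U C h.submodule_image[OF sF]] F(2) by simp
    finally show ?case using generated_Suc[OF F(1) y(1)] by blast
  }
qed

lemma exists_generated:
  assumes "submodule R V M" "submodule R U M" "mS V \<subseteq> U" "U \<subseteq> V" "ilen R M U V = enat n"
  shows "\<exists>F. generated R M n F \<and> U <+>\<^bsub>M\<^esub> F = V"
proof -
  have "mod_hom R M M (\<lambda>x. x)"
    unfolding mod_hom_def mod_hom_axioms_def LinearCombinations.module_hom_def using module_axioms by auto
  from exists_generated_lift[OF this assms(1) _ assms(2-)] show ?thesis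
    using submoduleD(2)[OF assms(1)] by simp
qed

text \<open>
  The copy \<open>R y\<close> of the residue field is complemented in \<open>V\<close>: a submodule containing \<open>\<mm>V\<close> and maximal among those
  that avoid \<open>y\<close> is a complement. Maximality is expressed by minimality of the colength.
\<close>
lemma socle_element_splits:
  assumes V: "submodule R V M" and y: "y \<in> V" "y \<notin> mS V" and my: "\<And>r. r \<in> \<mm> \<Longrightarrow> r \<odot>\<^bsub>M\<^esub> y = \<zero>\<^bsub>M\<^esub>"
    and fin: "ilen R M (mS V) V \<noteq> \<infinity>"
  shows "\<exists>L. submodule R L M \<and> L \<subseteq> V \<and> L \<inter> cyclic_submodule R M y = {\<zero>\<^bsub>M\<^esub>} \<and>
    L <+>\<^bsub>M\<^esub> cyclic_submodule R M y = V"
proof -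
  let ?good = "\<lambda>L. submodule R L M \<and> mS V \<subseteq> L \<and> L \<subseteq> V \<and> y \<notin> L"
  let ?P = "\<lambda>k. \<exists>L. ?good L \<and> ilen R M L V = k"
  have "?P (ilen R M (mS V) V)" using y submodule_mS[OF V] mS_subset[OF V] by blast
  then have "?P (LEAST k. ?P k)" by (rule LeastI)
  then obtain L where L: "?good L" "ilen R M L V = (LEAST k. ?P k)" by blast
  have min: "ilen R M L V \<le> ilen R M L' V" if "?good L'" for L' unfolding L(2) by (rule Least_le) (use that in blast)
  have Ls: "submodule R L M" using L by blast
  have yc: "y \<in> carrier M" using y submoduleD(2)[OF V] by blast
  note C = submodule_cyclic[OF yc]
  have finL: "ilen R M L V \<noteq> \<infinity>" 
  proof -
    have "ilen R M L V \<le> ilen R M (mS V) V" using L(1) by (intro ilen_mono) auto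
    then show ?thesis using fin by (cases "ilen R M L V") auto
  qed
  have div: "\<exists>s\<in>carrier R. s \<odot>\<^bsub>M\<^esub> (r \<odot>\<^bsub>M\<^esub> x) = x" if "r \<in> carrier R" "r \<notin> \<mm>" "x \<in> carrier M" for r x
    using unit_if_not_mem[OF that(1,2)] that smult_assoc1 smult_one by metis
  have "L <+>\<^bsub>M\<^esub> cyclic_submodule R M y = V"
  proof (rule ccontr)
    assume ne: "L <+>\<^bsub>M\<^esub> cyclic_submodule R M y \<noteq> V"
    have "L <+>\<^bsub>M\<^esub> cyclic_submodule R M y \<subseteq> V" using L cyclic_least[OF V y(1)] by (intro set_add_least V) auto
    then obtain x where x: "x \<in> V" "x \<notin> L <+>\<^bsub>M\<^esub> cyclic_submodule R M y" using ne by blast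
    have xc: "x \<in> carrier M" using x submoduleD(2)[OF V] by blast
    note Cx = submodule_cyclic[OF xc]
    let ?L = "L <+>\<^bsub>M\<^esub> cyclic_submodule R M x"
    have mx: "r \<odot>\<^bsub>M\<^esub> x \<in> L" if "r \<in> \<mm>" for r using scaleI[OF that x(1)] L(1) by blast
    have "y \<notin> ?L"
    proof
      assume "y \<in> ?L"
      then obtain l r where lr: "l \<in> L" "r \<in> carrier R" "y = l \<oplus>\<^bsub>M\<^esub> r \<odot>\<^bsub>M\<^esub> x"
        by (auto elim!: set_addE simp: cyclic_submodule_def)
      show False
      proof (cases "r \<in> \<mm>")
        case True
        then have "y \<in> L" using lr mx submoduleD(3)[OF Ls] by blast
        then show False using L by blast
      next
        case False
        then obtain s where s: "s \<in> carrier R" "s \<odot>\<^bsub>M\<^esub> (r \<odot>\<^bsub>M\<^esub> x) = x" using div lr xc by blast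
        have W: "submodule R (L <+>\<^bsub>M\<^esub> cyclic_submodule R M y) M" by (intro submodule_set_add Ls C)
        have "l \<oplus>\<^bsub>M\<^esub> r \<odot>\<^bsub>M\<^esub> x \<in> L <+>\<^bsub>M\<^esub> cyclic_submodule R M y"
          using set_add_upper(2)[OF Ls C] self_in_cyclic[OF yc] lr(3) by blast
        moreover have "l \<in> L <+>\<^bsub>M\<^esub> cyclic_submodule R M y" using set_add_upper(1)[OF Ls C] lr(1) by blast
        ultimately have "r \<odot>\<^bsub>M\<^esub> x \<in> L <+>\<^bsub>M\<^esub> cyclic_submodule R M y"
          using submodule_add_cancel[OF W] lr(2) xc by blast
        then show False using submoduleD(5)[OF W s(1)] s(2) x(2) by metis
      qed
    qed
    moreover have "L \<subseteq> ?L" by (rule set_add_upper(1)[OF Ls Cx])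
    moreover have "?L \<subseteq> V" using cyclic_least[OF V x(1)] L(1) by (intro set_add_least V) auto
    ultimately have good: "?good ?L" using submodule_set_add[OF Ls Cx] L(1) by blast
    have "x \<notin> L" using x(2) set_add_upper(1)[OF Ls C] by blast
    then have "ilen R M L ?L = 1" using mx xc by (intro ilen_add_cyclic Ls)
    moreover have sum: "ilen R M L V = ilen R M L ?L + ilen R M ?L V"
      using good \<open>L \<subseteq> ?L\<close> by (intro ilen_add Ls V) auto
    ultimately have "1 + ilen R M ?L V \<le> ilen R M ?L V" using min[OF good] by simp
    then show False using finL sum by (cases "ilen R M ?L V") (auto simp: one_enat_def)
  qed
  moreover have "L \<inter> cyclic_submodule R M y = {\<zero>\<^bsub>M\<^esub>}"
  proof
    show "{\<zero>\<^bsub>M\<^esub>} \<subseteq> L \<inter> cyclic_submodule R M y" using submoduleD(4)[OF Ls] submoduleD(4)[OF C] by simp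
    show "L \<inter> cyclic_submodule R M y \<subseteq> {\<zero>\<^bsub>M\<^esub>}"
    proof
      fix z assume z: "z \<in> L \<inter> cyclic_submodule R M y"
      then obtain r where r: "r \<in> carrier R" "z = r \<odot>\<^bsub>M\<^esub> y" by (auto simp: cyclic_submodule_def)
      have "r \<in> \<mm>" using div[OF r(1) _ yc] z r submoduleD(5)[OF Ls] L(1) by (metis IntD1)
      then show "z \<in> {\<zero>\<^bsub>M\<^esub>}" using my r by simp
    qed
  qed
  ultimately show ?thesis using L(1) by blast
qed

end

section \<open>Free modules\<close>
context cube_zero_module begin

text \<open>
  Freeness of rank \<open>n\<close> as a length condition: a surjection \<open>R\<^sup>n \<rightarrow> M\<close> is an isomorphism as soon as \<open>M\<close> has the same
  length as \<open>R\<^sup>n\<close>. In this form no bases have to be chosen or lifted.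
\<close>
definition free_of_rank where
  "free_of_rank n \<longleftrightarrow> generated R M n (carrier M) \<and>
    ilen R M {\<zero>\<^bsub>M\<^esub>} (carrier M) = enat n * ilen R RR {\<zero>} (carrier R)"

lemma scale_zero:
  assumes "submodule R V M" shows "scale R M {\<zero>} V = {\<zero>\<^bsub>M\<^esub>}"
proof
  show "scale R M {\<zero>} V \<subseteq> {\<zero>\<^bsub>M\<^esub>}"
    using submoduleD(2)[OF assms] by (intro scale_least submodule_zero) auto
  show "{\<zero>\<^bsub>M\<^esub>} \<subseteq> scale R M {\<zero>} V"
    using submoduleD(4)[OF submodule_scale[of "{\<zero>}" V]] submoduleD(2)[OF assms] by simp
qed

text \<open>
  The lengths of \<open>I M\<close>, \<open>J M / I M\<close> and \<open>M / J M\<close> are at most \<open>n\<close> times the lengths of \<open>I\<close>, \<open>J/I\<close> and \<open>R/J\<close>, and the sums agree by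
  hypothesis; hence all three bounds are attained.
\<close>
lemma free_ilen:
  assumes free: "free_of_rank n"
    and I: "submodule R I RR" and J: "submodule R J RR" and IJ: "I \<subseteq> J"
  shows "ilen R M (scale R M I (carrier M)) (scale R M J (carrier M)) = enat n * ilen R RR I J"
proof -
  let ?S = "\<lambda>I. scale R M I (carrier M)" and ?l = "ilen R RR" and ?L = "ilen R M"
  have c: "I \<subseteq> carrier R" "J \<subseteq> carrier R" "\<zero> \<in> I" using submoduleD[OF I] submoduleD(2)[OF J] by auto
  have sI: "submodule R (?S I) M" and sJ: "submodule R (?S J) M" using c by (intro submodule_scale; simp)+
  have S0: "?S {\<zero>} = {\<zero>\<^bsub>M\<^esub>}" and S1: "?S (carrier R) = carrier M"
    using scale_zero scale_carrier submodule_carrier by auto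
  have le: "?L (?S A) (?S B) \<le> enat n * ?l A B" if "submodule R A RR" "submodule R B RR" "A \<subseteq> B" for A B
    using free that unfolding free_of_rank_def by (intro ilen_scale_generated_le) auto
  have "?l {\<zero>} (carrier R) = ?l {\<zero>} I + ?l I (carrier R)" "?l I (carrier R) = ?l I J + ?l J (carrier R)"
    using c IJ I J by (intro RR.ilen_add; simp)+
  then have 1: "?l {\<zero>} I + (?l I J + ?l J (carrier R)) = enat (1 + embdim + sqdim)" using ilen_RR by simp
  then obtain x1 x2 x3 where x: "?l {\<zero>} I = enat x1" "?l I J = enat x2" "?l J (carrier R) = enat x3"
    by (cases "?l {\<zero>} I"; cases "?l I J"; cases "?l J (carrier R)") auto
  have "?L {\<zero>\<^bsub>M\<^esub>} (carrier M) = ?L {\<zero>\<^bsub>M\<^esub>} (?S I) + ?L (?S I) (carrier M)"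
    using sI submoduleD[OF sI] by (intro ilen_add submodule_zero submodule_carrier) auto
  also have "?L (?S I) (carrier M) = ?L (?S I) (?S J) + ?L (?S J) (carrier M)"
    using sI sJ IJ submoduleD(2)[OF sJ] by (intro ilen_add submodule_carrier scale_mono) auto
  finally have 2: "?L {\<zero>\<^bsub>M\<^esub>} (?S I) + (?L (?S I) (?S J) + ?L (?S J) (carrier M)) = enat n * enat (x1 + x2 + x3)"
    using free 1 x ilen_RR unfolding free_of_rank_def by (simp add: add.assoc)
  then obtain y1 y2 y3 where y: "?L {\<zero>\<^bsub>M\<^esub>} (?S I) = enat y1" "?L (?S I) (?S J) = enat y2" "?L (?S J) (carrier M) = enat y3"
    by (cases "?L {\<zero>\<^bsub>M\<^esub>} (?S I)"; cases "?L (?S I) (?S J)"; cases "?L (?S J) (carrier M)") auto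
  have "y1 \<le> n * x1" "y2 \<le> n * x2" "y3 \<le> n * x3"
    using le[of "{\<zero>}" I] le[of I J] le[of J "carrier R"] I J IJ c x y S0 S1 by auto
  moreover have "y1 + y2 + y3 = n * x1 + n * x2 + n * x3" using 2 y by (simp add: algebra_simps)
  ultimately have "y2 = n * x2" by linarith
  then show ?thesis using x y by simp
qed

text \<open>
  Adding a vector \<open>x\<close> to an independent set adds a copy of \<open>R\<close>, because \<open>r x\<close> lies in the old span only
  for \<open>r = 0\<close>.
\<close>
lemma ilen_span_of_independent:
  assumes "finite A" "A \<subseteq> carrier M" "\<not> lin_dep A"
  shows "ilen R M {\<zero>\<^bsub>M\<^esub>} (span A) = enat (card A) * ilen R RR {\<zero>} (carrier R)"
  using assms
proof (induction A rule: finite_induct)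
  case empty
  have "span {} = {\<zero>\<^bsub>M\<^esub>}" by (auto simp: span_def lincomb_def)
  then show ?case by (simp add: ilen_self flip: zero_enat_def)
next
  case (insert x A)
  have x: "x \<in> carrier M" and A: "A \<subseteq> carrier M" using insert.prems by auto
  have "\<not> lin_dep A" using insert.prems(2) unfolding lin_dep_def by blast
  note IH = insert.IH[OF A this]
  let ?C = "cyclic_submodule R M x"
  have sA: "submodule R (span A) M" and sxA: "submodule R (span (insert x A)) M"
    using span_is_submodule A x by auto
  note C = submodule_cyclic[OF x]
  have span: "span (insert x A) = span A <+>\<^bsub>M\<^esub> ?C"
  proof
    have 1: "A \<subseteq> span A" using in_own_span[OF A] .
    have "insert x A \<subseteq> span A <+>\<^bsub>M\<^esub> ?C" using 1 set_add_upper[OF sA C] self_in_cyclic[OF x] by blast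
    then show "span (insert x A) \<subseteq> span A <+>\<^bsub>M\<^esub> ?C" using submodule_set_add[OF sA C] by (rule span_is_subset)
    have 2: "insert x A \<subseteq> span (insert x A)" using x A by (intro in_own_span) auto
    show "span A <+>\<^bsub>M\<^esub> ?C \<subseteq> span (insert x A)"
      using 2 span_is_subset[OF _ sxA, of A] cyclic_least[OF sxA] by (intro set_add_least sxA) auto
  qed
  have key: "r = \<zero>" if r: "r \<in> carrier R" "r \<odot>\<^bsub>M\<^esub> x \<in> span A" for r
  proof (rule ccontr)
    assume nz: "r \<noteq> \<zero>"
    obtain a where a: "a \<in> A \<rightarrow> carrier R" "lincomb a A = r \<odot>\<^bsub>M\<^esub> x"
      using finite_in_span[OF insert.hyps(1) A r(2)] by blast
    define b where "b = a(x := \<ominus> r)"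
    have b: "b \<in> insert x A \<rightarrow> carrier R" and bx: "b x = \<ominus> r" using a r by (auto simp: b_def)
    have "lincomb b (insert x A) = (b x) \<odot>\<^bsub>M\<^esub> x \<oplus>\<^bsub>M\<^esub> lincomb b A"
      using insert.hyps insert.prems b unfolding lincomb_def by (subst finsum_insert) (auto simp: Pi_iff subset_iff)
    also have "lincomb b A = lincomb a A" using insert.hyps a A by (intro lincomb_cong) (auto simp: b_def)
    also have "b x \<odot>\<^bsub>M\<^esub> x \<oplus>\<^bsub>M\<^esub> lincomb a A = \<zero>\<^bsub>M\<^esub>"
      using a(2) r x bx by (simp add: smult_l_minus M.l_neg)
    finally have "lin_dep (insert x A)"
      using b bx nz r insert.hyps unfolding lin_dep_def
      by (intro exI[of _ "insert x A"] exI[of _ b] exI[of _ x]) auto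
    then show False using insert.prems by blast
  qed
  interpret h: mod_hom R RR M "\<lambda>r. r \<odot>\<^bsub>M\<^esub> x" using x by (rule mod_hom_smult)
  have Ci: "?C = (\<lambda>r. r \<odot>\<^bsub>M\<^esub> x) ` carrier R" by (auto simp: cyclic_submodule_def)
  have "ilen R M (span A) (span (insert x A)) = ilen R RR (carrier R \<inter> (\<lambda>r. r \<odot>\<^bsub>M\<^esub> x) -` span A) (carrier R)"
    unfolding span Ci using h.ilen_hom[OF sA submodule_RR(3)] .
  also have "carrier R \<inter> (\<lambda>r. r \<odot>\<^bsub>M\<^esub> x) -` span A = {\<zero>}"
    using key x submoduleD(4)[OF sA] by auto
  finally have "ilen R M {\<zero>\<^bsub>M\<^esub>} (span (insert x A)) =
      enat (card A) * ilen R RR {\<zero>} (carrier R) + ilen R RR {\<zero>} (carrier R)"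
    using IH ilen_add[OF submodule_zero sA sxA] submoduleD(4)[OF sA] set_add_upper(1)[OF sA C] span by simp
  then show ?case using insert.hyps by (simp add: eSuc_enat[symmetric] mult_eSuc add.commute)
qed

lemma free_of_rank_if_finite_basis:
  assumes "finite_basis R M B" shows "free_of_rank (card B)"
proof -
  have B: "finite B" "B \<subseteq> carrier M" "\<not> lin_dep B" "span B = carrier M"
    using assms by (auto simp: finite_basis_def)
  obtain F where F: "generated R M (card B) F" "B \<subseteq> F"
    using finite_set_generates[OF B(1,2)] by blast
  have sF: "submodule R F M" using submodule_generated[OF F(1)] .
  have "F = carrier M" using span_is_subset[OF F(2) sF] B(4) submoduleD(2)[OF sF] by blast
  then show ?thesis unfolding free_of_rank_def using F ilen_span_of_independent[OF B(1-3)] B(4) by simp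
qed

lemma ilen_top_of_free: "free_of_rank n \<Longrightarrow> ilen R M (mS (carrier M)) (carrier M) = enat n"
  using free_ilen[of n \<mm> "carrier R"] \<mm>_carrier scale_carrier[OF submodule_carrier]
  by (simp add: ilen_\<mm>_carrier)

lemma free_rank_eq:
  assumes "fg_free_module R M"
  shows "free_of_rank (free_rank R M)"
proof -
  obtain B where B: "finite_basis R M B" using assms by (auto simp: fg_free_module_def)
  have "free_rank R M = card B"
    unfolding free_rank_def
  proof (rule the_equality)
    show "\<exists>B'. finite_basis R M B' \<and> card B' = card B" using B by blast
    fix n assume "\<exists>B'. finite_basis R M B' \<and> card B' = n"
    then have "free_of_rank n" using free_of_rank_if_finite_basis by blast
    then show "n = card B" using ilen_top_of_free free_of_rank_if_finite_basis[OF B] by (metis enat.inject)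
  qed
  then show ?thesis using free_of_rank_if_finite_basis[OF B] by simp
qed

lemma ideal_smult_eq: "ideal_smult R \<mm> M = mS (carrier M)"
proof
  let ?X = "{r \<odot>\<^bsub>M\<^esub> x | r x. r \<in> \<mm> \<and> x \<in> carrier M}"
  have X: "?X \<subseteq> carrier M" using \<mm>_carrier by auto
  show "ideal_smult R \<mm> M \<subseteq> mS (carrier M)"
    unfolding ideal_smult_def using scaleI by (intro span_is_subset submodule_mS submodule_carrier) auto
  show "mS (carrier M) \<subseteq> ideal_smult R \<mm> M"
    unfolding ideal_smult_def using in_own_span[OF X] by (intro scale_least span_is_submodule X) auto
qed

end

section \<open>Minimal acyclic complexes\<close>

locale minimal_acyclic_complex = cube_zero_local_ring R \<mm>
  for R :: "('a, 'r) ring_scheme" (structure) and \<mm> :: "'a set" +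
  fixes A :: "int \<Rightarrow> ('a, 'b, 'c) module_scheme" and d :: "int \<Rightarrow> 'b \<Rightarrow> 'b"
  assumes complex: "fg_free_complex R A d"
    and minimal: "minimal_complex R \<mm> A d"
    and acyclic: "acyclic_complex A d"
begin

text \<open>
  The syzygies of the complex: the boundaries in \<open>A\<^sub>i\<close>, which by acyclicity are also the cycles. The cokernel of
  \<open>d\<^sub>i\<^sub>+\<^sub>2\<close> is isomorphic to \<open>Z\<^sub>i\<close>.
\<close>
definition Z where "Z i = d (i + 1) ` carrier (A (i + 1))"
definition b where "b i = free_rank R (A i)"

abbreviation mA where "mA i \<equiv> scale R (A i) \<mm> (carrier (A i))"
abbreviation m2A where "m2A i \<equiv> scale R (A i) \<mm>2 (carrier (A i))"
abbreviation mZ where "mZ i \<equiv> scale R (A i) \<mm> (Z i)"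

lemma fg_free: "fg_free_module R (A i)"
  using complex by (simp add: fg_free_complex_def)

sublocale A: cube_zero_module R \<mm> "A i" for i
  using fg_free cube_zero_local_ring_axioms
  by (auto simp: cube_zero_module_def fg_free_module_def)

sublocale d: mod_hom R "A (i + 1)" "A i" "d (i + 1)" for i
proof -
  have "d (i + 1) \<in> LinearCombinations.module_hom R (A (i + 1)) (A (i + 1 - 1))"
    using complex unfolding fg_free_complex_def by blast
  then show "mod_hom R (A (i + 1)) (A i) (d (i + 1))"
    unfolding mod_hom_def mod_hom_axioms_def using A.module_axioms by simp
qed

lemma free: "A.free_of_rank i (b i)"
  unfolding b_def by (rule A.free_rank_eq[OF fg_free])

lemma submodule_Z: "submodule R (Z i) (A i)"
  unfolding Z_def by (intro d.submodule_image A.submodule_carrier)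

lemma kernel_eq_Z: "{x \<in> carrier (A (i + 1)). d (i + 1) x = \<zero>\<^bsub>A i\<^esub>} = Z (i + 1)"
proof -
  let ?K = "a_kernel (A (i + 1)) (A i) (d (i + 1))"
  let ?M = "(A (i + 1))\<lparr>carrier := ?K\<rparr>"
  have K: "?K = {x \<in> carrier (A (i + 1)). d (i + 1) x = \<zero>\<^bsub>A i\<^esub>}" by (rule a_kernel_def')
  have "d (i + 1) (d (i + 1 + 1) x) = \<zero>\<^bsub>A (i + 1 - 1)\<^esub>" if "x \<in> carrier (A (i + 1 + 1))" for x
    using complex that unfolding fg_free_complex_def by blast
  then have "Z (i + 1) \<subseteq> ?K" unfolding K Z_def using d.f_im[of _ "i + 1"] by auto
  moreover have "?K \<subseteq> Z (i + 1)"
  proof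
    fix x assume x: "x \<in> ?K"
    have "carrier (homology_module A d (i + 1)) = {\<zero>\<^bsub>homology_module A d (i + 1)\<^esub>}"
      using acyclic unfolding acyclic_complex_def by blast
    then have "a_rcosets\<^bsub>?M\<^esub> (Z (i + 1)) = {Z (i + 1)}"
      by (simp add: homology_module_def quotient_module_def Z_def)
    moreover have "Z (i + 1) +>\<^bsub>?M\<^esub> x \<in> a_rcosets\<^bsub>?M\<^esub> (Z (i + 1))"
      using x unfolding A_RCOSETS_def' by auto
    ultimately have "Z (i + 1) +>\<^bsub>?M\<^esub> x = Z (i + 1)" by blast
    then have "\<zero>\<^bsub>A (i + 1)\<^esub> \<oplus>\<^bsub>A (i + 1)\<^esub> x \<in> Z (i + 1)"
      using submoduleD(4)[OF submodule_Z] unfolding a_r_coset_def' by auto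
    then show "x \<in> Z (i + 1)" using x unfolding K by simp
  qed
  ultimately show ?thesis unfolding K by blast
qed

lemma submodules [simp]:
  "submodule R (mA i) (A i)" "submodule R (m2A i) (A i)" "submodule R (Z i) (A i)" "submodule R (mZ i) (A i)"
  "submodule R (carrier (A i)) (A i)" "submodule R {\<zero>\<^bsub>A i\<^esub>} (A i)"
  using A.submodule_mS A.submodule_m2S A.submodule_carrier A.submodule_zero submodule_Z by auto

lemma Z_subset_mA: "Z i \<subseteq> mA i"
proof -
  have "d (i + 1) ` carrier (A (i + 1)) \<subseteq> ideal_smult R \<mm> (A (i + 1 - 1))"
    using minimal unfolding minimal_complex_def by blast
  then show ?thesis by (simp add: Z_def A.ideal_smult_eq)
qed

lemma image_mA: "d (i + 1) ` mA (i + 1) = mZ i"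
  using d.image_scale[OF \<mm>_carrier A.submodule_carrier] unfolding Z_def .

text \<open>
  \<open>d\<close> maps \<open>\<mm>\<^sup>2 A\<^sub>i\<close> into \<open>\<mm>\<^sup>2 \<cdot> \<mm> A\<^sub>i\<^sub>-\<^sub>1 = 0\<close>. Together with minimality, \<open>\<mm>\<^sup>2 A\<^sub>i \<subseteq> Z\<^sub>i \<subseteq> \<mm> A\<^sub>i\<close>: this sandwich is what makes
  the length count below possible.
\<close>
lemma m2A_subset_Z: "m2A i \<subseteq> Z i"
proof -
  obtain j where i: "i = j + 1" by (metis diff_add_cancel)
  have "d (j + 1) ` m2A (j + 1) = scale R (A j) \<mm>2 (Z j)"
    using d.image_scale[OF \<mm>2_carrier A.submodule_carrier] unfolding Z_def .
  also have "\<dots> \<subseteq> scale R (A j) \<mm>2 (mA j)" using Z_subset_mA by (intro A.scale_mono) auto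
  also have "\<dots> = {\<zero>\<^bsub>A j\<^esub>}" by (intro A.m2S_mS A.submodule_carrier)
  finally have "m2A (j + 1) \<subseteq> {x \<in> carrier (A (j + 1)). d (j + 1) x = \<zero>\<^bsub>A j\<^esub>}"
    using submoduleD(2)[OF submodules(2)[of "j + 1"]] by auto
  then show ?thesis unfolding kernel_eq_Z i .
qed

lemma mZ_subset_m2A: "mZ i \<subseteq> m2A i"
  using A.scale_mono[OF order_refl[of \<mm>] Z_subset_mA[of i], of i] A.mS_mS[OF A.submodule_carrier] by metis

lemma m2Z: "scale R (A i) \<mm>2 (Z i) = {\<zero>\<^bsub>A i\<^esub>}"
proof
  show "scale R (A i) \<mm>2 (Z i) \<subseteq> {\<zero>\<^bsub>A i\<^esub>}"
    using A.scale_mono[OF order_refl[of \<mm>2] Z_subset_mA[of i], of i] A.m2S_mS[OF A.submodule_carrier] by metis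
  show "{\<zero>\<^bsub>A i\<^esub>} \<subseteq> scale R (A i) \<mm>2 (Z i)" using submoduleD(4)[OF A.submodule_m2S[OF submodule_Z]] by simp
qed

lemma ilen_mA_A: "ilen R (A i) (mA i) (carrier (A i)) = enat (b i)"
  by (rule A.ilen_top_of_free[OF free])

lemma ilen_m2A_mA: "ilen R (A i) (m2A i) (mA i) = enat (embdim * b i)"
  using A.free_ilen[OF free submodule_RR(2,1) \<mm>2_subset] by (simp add: ilen_\<mm>2_\<mm> mult.commute)

lemma ilen_0_m2A: "ilen R (A i) {\<zero>\<^bsub>A i\<^esub>} (m2A i) = enat (sqdim * b i)"
proof -
  have "{\<zero>} \<subseteq> \<mm>2" using submoduleD(4)[OF submodule_RR(2)] by simp
  from A.free_ilen[OF free submodule_RR(4,2) this, of i] show ?thesis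
    by (simp add: ilen_0_\<mm>2 mult.commute A.scale_zero[OF A.submodule_carrier])
qed

lemma ilen_Z_mA: "ilen R (A (i + 1)) (Z (i + 1)) (mA (i + 1)) = ilen R (A i) {\<zero>\<^bsub>A i\<^esub>} (mZ i)"
proof -
  have "mA (i + 1) \<inter> d (i + 1) -` {\<zero>\<^bsub>A i\<^esub>} = Z (i + 1)"
    using kernel_eq_Z[of i] Z_subset_mA[of "i + 1"] submoduleD(2)[OF submodules(1)[of "i + 1"]] by auto
  then show ?thesis using d.ilen_image[OF submodules(1)[of "i + 1"]] image_mA[of i] by simp
qed

lemma ilen_Z_A: "ilen R (A (i + 1)) (Z (i + 1)) (carrier (A (i + 1))) = ilen R (A i) {\<zero>\<^bsub>A i\<^esub>} (Z i)"
proof -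
  have "carrier (A (i + 1)) \<inter> d (i + 1) -` {\<zero>\<^bsub>A i\<^esub>} = Z (i + 1)"
    using kernel_eq_Z[of i] by auto
  then show ?thesis using d.ilen_image[OF submodules(5)[of "i + 1"]] unfolding Z_def[of i] by simp
qed

lemma vimage_mZ: "carrier (A (i + 1)) \<inter> d (i + 1) -` mZ i = mA (i + 1)"
proof
  show "mA (i + 1) \<subseteq> carrier (A (i + 1)) \<inter> d (i + 1) -` mZ i"
    using image_mA submoduleD(2)[OF submodules(1)[of "i + 1"]] by blast
  show "carrier (A (i + 1)) \<inter> d (i + 1) -` mZ i \<subseteq> mA (i + 1)"
  proof
    fix x assume x: "x \<in> carrier (A (i + 1)) \<inter> d (i + 1) -` mZ i"
    then obtain y where y: "y \<in> mA (i + 1)" "d (i + 1) x = d (i + 1) y" using image_mA[of i] by auto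
    have yc: "y \<in> carrier (A (i + 1))" using y(1) submoduleD(2)[OF submodules(1)[of "i + 1"]] by blast
    have "d (i + 1) (x \<ominus>\<^bsub>A (i + 1)\<^esub> y) = \<zero>\<^bsub>A i\<^esub>" using x y yc d.f_im[OF yc] by (simp add: a_minus_def A.M.r_neg)
    then have "x \<ominus>\<^bsub>A (i + 1)\<^esub> y \<in> mA (i + 1)"
      using kernel_eq_Z[of i] Z_subset_mA[of "i + 1"] x yc by auto
    then have "y \<oplus>\<^bsub>A (i + 1)\<^esub> (x \<ominus>\<^bsub>A (i + 1)\<^esub> y) \<in> mA (i + 1)"
      using submoduleD(3)[OF submodules(1)] y(1) by blast
    then show "x \<in> mA (i + 1)" using x yc 
      by (simp add: a_minus_def A.M.add.m_lcomm A.M.r_neg)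
  qed
qed

text \<open>
  Minimality makes \<open>A\<^sub>i\<^sub>+\<^sub>1 \<rightarrow> Z\<^sub>i\<close> a minimal cover: both sides have the same top.
\<close>
lemma ilen_mZ_Z: "ilen R (A i) (mZ i) (Z i) = enat (b (i + 1))"
proof -
  have "mZ i <+>\<^bsub>A i\<^esub> d (i + 1) ` carrier (A (i + 1)) = Z i"
    unfolding Z_def[of i, symmetric] by (intro A.set_add_absorb A.mS_subset submodules)
  then show ?thesis
    using d.ilen_hom[OF submodules(4)[of i] submodules(5)[of "i + 1"]] vimage_mZ[of i] ilen_mA_A by simp
qed

lemma zero_in: "submodule R V (A i) \<Longrightarrow> {\<zero>\<^bsub>A i\<^esub>} \<subseteq> V"
  using submoduleD(4) by blast

text \<open>
  The lengths of \<open>\<mm>Z\<^sub>i\<close>, of \<open>Z\<^sub>i / \<mm>\<^sup>2A\<^sub>i\<close> and of \<open>\<mm>\<^sup>2A\<^sub>i / \<mm>Z\<^sub>i\<close>, the layers of \<open>0 \<subseteq> \<mm>Z\<^sub>i \<subseteq> \<mm>\<^sup>2A\<^sub>i \<subseteq> Z\<^sub>i\<close>. The last one, \<open>t\<^sub>i\<close>, is the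
  error term in the recurrence for the ranks.
\<close>
definition z where "z i = the_enat (ilen R (A i) {\<zero>\<^bsub>A i\<^esub>} (mZ i))"
definition w where "w i = the_enat (ilen R (A i) (m2A i) (Z i))"
definition t where "t i = the_enat (ilen R (A i) (mZ i) (m2A i))"

lemma ilen_z: "ilen R (A i) {\<zero>\<^bsub>A i\<^esub>} (mZ i) = enat (z i)"
  and ilen_t: "ilen R (A i) (mZ i) (m2A i) = enat (t i)"
  and z_t: "z i + t i = sqdim * b i"
proof -
  have *: "ilen R (A i) {\<zero>\<^bsub>A i\<^esub>} (mZ i) + ilen R (A i) (mZ i) (m2A i) = enat (sqdim * b i)"
    using ilen_0_m2A A.ilen_add[OF submodules(6,4,2) zero_in mZ_subset_m2A] by simp
  then show 1: "ilen R (A i) {\<zero>\<^bsub>A i\<^esub>} (mZ i) = enat (z i)" and 2: "ilen R (A i) (mZ i) (m2A i) = enat (t i)"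
    unfolding z_def t_def
    by (cases "ilen R (A i) {\<zero>\<^bsub>A i\<^esub>} (mZ i)"; cases "ilen R (A i) (mZ i) (m2A i)"; simp)+
  show "z i + t i = sqdim * b i" using * unfolding 1 2 by simp
qed

lemma ilen_w: "ilen R (A i) (m2A i) (Z i) = enat (w i)"
  and t_w: "t i + w i = b (i + 1)"
proof -
  have *: "enat (t i) + ilen R (A i) (m2A i) (Z i) = enat (b (i + 1))"
    using ilen_mZ_Z A.ilen_add[OF submodules(4,2,3) mZ_subset_m2A m2A_subset_Z] by (simp add: ilen_t)
  then show 1: "ilen R (A i) (m2A i) (Z i) = enat (w i)"
    unfolding w_def by (cases "ilen R (A i) (m2A i) (Z i)"; simp)
  show "t i + w i = b (i + 1)" using * unfolding 1 by simp
qed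

lemma w_z: "w (i + 1) + z i = embdim * b (i + 1)"
  using ilen_m2A_mA[of "i + 1"] A.ilen_add[OF submodules(2,3,1) m2A_subset_Z Z_subset_mA, of "i + 1"]
  by (simp add: ilen_w ilen_Z_mA ilen_z)

text \<open>
  Modulo \<open>\<mm>\<^sup>2A\<^sub>i\<close> the syzygy has \<open>w\<^sub>i\<close> generators. Since \<open>\<mm>\<^sup>3 = 0\<close>, their multiples by \<open>\<mm>\<close> already fill \<open>\<mm>Z\<^sub>i\<close>, and since
  \<open>\<mm>\<^sup>2Z\<^sub>i = 0\<close>, each of them contributes at most \<open>\<mm>/\<mm>\<^sup>2\<close>.
\<close>
lemma z_le: "z i \<le> embdim * w i"
proof -
  obtain F where F: "generated R (A i) (w i) F" "m2A i <+>\<^bsub>A i\<^esub> F = Z i"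
    using A.exists_generated[OF submodules(3,2) mZ_subset_m2A m2A_subset_Z ilen_w] by blast
  have sF: "submodule R F (A i)" using A.submodule_generated[OF F(1)] .
  have FZ: "F \<subseteq> Z i" using A.set_add_upper(2)[OF submodules(2) sF] F(2) by blast
  have "mZ i = scale R (A i) \<mm> (m2A i) <+>\<^bsub>A i\<^esub> scale R (A i) \<mm> F"
    using A.scale_set_add[OF \<mm>_carrier submodules(2) sF] F(2) by simp
  also have "scale R (A i) \<mm> (m2A i) = {\<zero>\<^bsub>A i\<^esub>}" by (intro A.mS_m2S submodules)
  also have "\<dots> <+>\<^bsub>A i\<^esub> scale R (A i) \<mm> F = scale R (A i) \<mm> F"
    by (intro A.set_add_absorb submodules A.submodule_mS sF zero_in)
  finally have mZ: "mZ i = scale R (A i) \<mm> F" .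
  have "scale R (A i) \<mm>2 F = {\<zero>\<^bsub>A i\<^esub>}"
    using A.scale_mono[OF order_refl[of \<mm>2] FZ, of i] m2Z[of i] zero_in[OF A.submodule_m2S[OF sF]] by blast
  then have "enat (z i) \<le> enat (w i) * ilen R RR \<mm>2 \<mm>"
    using A.ilen_scale_generated_le[OF submodule_RR(2,1) \<mm>2_subset F(1)] mZ ilen_z[of i] by simp
  then show ?thesis by (simp add: ilen_\<mm>2_\<mm> mult.commute)
qed

lemma ilen_coker: "ilen R (A (i + 1)) (Z (i + 1)) (carrier (A (i + 1))) = enat (b (i + 1) + z i)"
  using A.ilen_add[OF submodules(6,4,3) zero_in A.mS_subset[OF submodules(3)], of i]
  by (simp add: ilen_Z_A ilen_z ilen_mZ_Z add.commute[of "z i"])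

lemma b_eq_0_iff: "b i = 0 \<longleftrightarrow> carrier (A i) = {\<zero>\<^bsub>A i\<^esub>}"
proof
  assume "b i = 0"
  then have "mA i = carrier (A i)"
    using A.ilen_eq_0_iff[OF submodules(1,5) A.mS_subset[OF submodules(5)]] ilen_mA_A[of i]
    by (simp add: zero_enat_def)
  then have "carrier (A i) \<subseteq> {\<zero>\<^bsub>A i\<^esub>} <+>\<^bsub>A i\<^esub> mA i"
    using A.set_add_upper(2)[OF submodules(6,1)[of i]] by simp
  then show "carrier (A i) = {\<zero>\<^bsub>A i\<^esub>}" using A.nakayama[OF submodules(6,5)] zero_in by blast
next
  assume "carrier (A i) = {\<zero>\<^bsub>A i\<^esub>}"
  then have "enat (b i) \<le> 0"
    using ilen_mA_A[of i] ilen_mono[OF zero_in[OF submodules(1)[of i]] order_refl, of R "A i" "carrier (A i)"]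
      A.ilen_self[of i "{\<zero>\<^bsub>A i\<^esub>}"] by simp
  then show "b i = 0" by (simp add: zero_enat_def)
qed

section \<open>Socle generators of syzygies\<close>

text \<open>
  A minimal generator of \<open>Z\<^sub>i\<close> that is killed by \<open>\<mm>\<close>. It exists exactly when the residue field is a direct
  summand of \<open>Z\<^sub>i\<close>, that is, of the cokernel of \<open>d\<^sub>i\<^sub>+\<^sub>2\<close>.
\<close>
definition socle_gen where
  "socle_gen i \<longleftrightarrow> (\<exists>y\<in>Z i. y \<notin> mZ i \<and> (\<forall>r\<in>\<mm>. r \<odot>\<^bsub>A i\<^esub> y = \<zero>\<^bsub>A i\<^esub>))"

text \<open>
  \<open>\<mm>\<^sup>2A\<^sub>i\<close> consists of elements of \<open>Z\<^sub>i\<close> killed by \<open>\<mm>\<close>; if none of them is a minimal generator, they all lie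
  in \<open>\<mm>Z\<^sub>i\<close>.
\<close>
lemma mZ_eq_m2A:
  assumes "\<not> socle_gen i" shows "mZ i = m2A i"
proof
  show "m2A i \<subseteq> mZ i"
  proof (rule A.scale_least[OF submodules(4)])
    fix r x assume r: "r \<in> \<mm>2" "x \<in> carrier (A i)"
    then have "r \<odot>\<^bsub>A i\<^esub> x \<in> m2A i" by (intro A.scaleI)
    then have "r \<odot>\<^bsub>A i\<^esub> x \<in> Z i" using m2A_subset_Z[of i] by blast
    moreover have "s \<odot>\<^bsub>A i\<^esub> (r \<odot>\<^bsub>A i\<^esub> x) = \<zero>\<^bsub>A i\<^esub>" if "s \<in> \<mm>" for s
    proof -
      have "s \<odot>\<^bsub>A i\<^esub> (r \<odot>\<^bsub>A i\<^esub> x) = (s \<otimes> r) \<odot>\<^bsub>A i\<^esub> x" using that r \<mm>_carrier \<mm>2_carrier by (simp add: A.smult_assoc1 subset_iff)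
      then show ?thesis using mult_\<mm>_\<mm>2[OF that r(1)] r(2) by simp
    qed
    ultimately show "r \<odot>\<^bsub>A i\<^esub> x \<in> mZ i" using assms unfolding socle_gen_def by blast
  qed
qed (rule mZ_subset_m2A)

lemma t_eq_0: "\<not> socle_gen i \<Longrightarrow> t i = 0"
  using ilen_t[of i] mZ_eq_m2A[of i] A.ilen_self[of i] by (simp add: zero_enat_def)

text \<open>
  By minimality a socle element \<open>x\<close> of \<open>R\<close> kills the image of \<open>d\<close>, so \<open>x A\<^sub>i\<close> consists of cycles killed by \<open>\<mm>\<close>, and these
  lie in \<open>\<mm>Z\<^sub>i \<subseteq> \<mm>\<^sup>2A\<^sub>i\<close>. Hence the ideals \<open>\<mm>\<^sup>2\<close> and \<open>\<mm>\<^sup>2 + R x\<close> have the same product with the free module \<open>A\<^sub>i\<close>, which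
  has positive rank, and they must be equal.
\<close>
lemma ring_socle_subset:
  assumes no: "\<not> socle_gen (i + 1)" and pos: "b (i + 1) > 0"
    and x: "x \<in> \<mm>" and mx: "\<And>r. r \<in> \<mm> \<Longrightarrow> r \<otimes> x = \<zero>"
  shows "x \<in> \<mm>2"
proof -
  let ?A = "A (i + 1)"
  have xc: "x \<in> carrier R" using x \<mm>_carrier by blast
  have xA: "x \<odot>\<^bsub>?A\<^esub> a \<in> m2A (i + 1)" if a: "a \<in> carrier ?A" for a
  proof -
    have "mA i \<subseteq> {v \<in> carrier (A i). \<forall>s\<in>{x}. s \<odot>\<^bsub>A i\<^esub> v \<in> {\<zero>\<^bsub>A i\<^esub>}}"
    proof (rule A.scale_least[OF A.submodule_colon[OF _ submodules(6)]])
      fix r v assume r: "r \<in> \<mm>" "v \<in> carrier (A i)"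
      have "x \<odot>\<^bsub>A i\<^esub> (r \<odot>\<^bsub>A i\<^esub> v) = (r \<otimes> x) \<odot>\<^bsub>A i\<^esub> v"
        using r \<mm>_carrier xc m_comm[of r x] by (simp add: A.smult_assoc1 subset_iff)
      then show "r \<odot>\<^bsub>A i\<^esub> v \<in> {v \<in> carrier (A i). \<forall>s\<in>{x}. s \<odot>\<^bsub>A i\<^esub> v \<in> {\<zero>\<^bsub>A i\<^esub>}}"
        using r \<mm>_carrier mx by auto
    qed (use xc in auto)
    moreover have "d (i + 1) a \<in> mA i" using Z_subset_mA a unfolding Z_def by blast
    ultimately have "d (i + 1) (x \<odot>\<^bsub>?A\<^esub> a) = \<zero>\<^bsub>A i\<^esub>" using a xc by auto
    moreover have "x \<odot>\<^bsub>?A\<^esub> a \<in> carrier ?A" using a xc by (rule A.smult_closed[rotated])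
    ultimately have xZ: "x \<odot>\<^bsub>?A\<^esub> a \<in> Z (i + 1)" unfolding kernel_eq_Z[of i, symmetric] by blast
    moreover have "r \<odot>\<^bsub>?A\<^esub> (x \<odot>\<^bsub>?A\<^esub> a) = \<zero>\<^bsub>?A\<^esub>" if "r \<in> \<mm>" for r
      using that \<mm>_carrier a xc mx by (simp add: subset_iff flip: A.smult_assoc1)
    ultimately have "x \<odot>\<^bsub>?A\<^esub> a \<in> mZ (i + 1)" using no xZ unfolding socle_gen_def by blast
    then show ?thesis using mZ_subset_m2A by blast
  qed
  let ?C = "cyclic_submodule R RR x"
  let ?J = "\<mm>2 <+>\<^bsub>RR\<^esub> ?C"
  have C: "submodule R ?C RR" using xc by (intro RR.submodule_cyclic) simp
  have J: "submodule R ?J RR" by (intro RR.submodule_set_add C) simp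
  have up: "\<mm>2 \<subseteq> ?J" "?C \<subseteq> ?J" using RR.set_add_upper[OF submodule_RR(2) C] by auto
  have "scale R ?A ?J (carrier ?A) \<subseteq> m2A (i + 1)"
  proof (rule A.scale_least[OF submodules(2)])
    fix r a assume r: "r \<in> ?J" and a: "a \<in> carrier ?A"
    from r obtain u s where us: "u \<in> \<mm>2" "s \<in> carrier R" "r = u \<oplus> s \<otimes> x"
      by (auto elim!: set_addE simp: cyclic_submodule_def)
    have uc: "u \<in> carrier R" using us \<mm>2_carrier by blast
    have "r \<odot>\<^bsub>?A\<^esub> a = u \<odot>\<^bsub>?A\<^esub> a \<oplus>\<^bsub>?A\<^esub> s \<odot>\<^bsub>?A\<^esub> (x \<odot>\<^bsub>?A\<^esub> a)"
      using us uc xc a by (simp add: A.smult_l_distr A.smult_assoc1)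
    then show "r \<odot>\<^bsub>?A\<^esub> a \<in> m2A (i + 1)"
      using A.scaleI[OF us(1) a] submoduleD(5)[OF submodules(2) us(2) xA[OF a]] submoduleD(3)[OF submodules(2)] by metis
  qed
  moreover have "m2A (i + 1) \<subseteq> scale R ?A ?J (carrier ?A)" using up by (intro A.scale_mono) auto
  ultimately have "enat (b (i + 1)) * ilen R RR \<mm>2 ?J = 0"
    using A.free_ilen[OF free submodule_RR(2) J up(1), of "i + 1"] A.ilen_self by simp
  then have "ilen R RR \<mm>2 ?J = 0" using pos by (cases "ilen R RR \<mm>2 ?J") (auto simp: zero_enat_def)
  then have "\<mm>2 = ?J" using RR.ilen_eq_0_iff[OF submodule_RR(2) J up(1)] by blast
  moreover have "x \<in> ?J" using RR.self_in_cyclic[of x] up(2) xc by auto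
  ultimately show ?thesis by blast
qed

end

section \<open>Two-sided integer recurrences\<close>

text \<open>
  The sequence \<open>c\<close> is the sequence of ranks read towards \<open>-\<infinity>\<close>. Its discriminant
  \<open>N\<^sub>n = c\<^sub>n c\<^sub>n\<^sub>+\<^sub>2 - c\<^sub>n\<^sub>+\<^sub>1\<^sup>2\<close> satisfies \<open>N\<^sub>n = f N\<^sub>n\<^sub>+\<^sub>1\<close>, so it is divisible by all powers of \<open>f \<ge> 2\<close> and vanishes. So \<open>c\<close> is
  geometric. The ratio \<open>c\<^sub>n / c\<^sub>n\<^sub>+\<^sub>1\<close> is a rational root of \<open>X\<^sup>2 - e X + f\<close> and therefore an integer; a geometric
  sequence of positive integers with such ratios is constant. For \<open>f = 1\<close> the statement fails: with \<open>e = 3\<close> every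
  second Fibonacci number gives a counterexample.
\<close>
lemma recurrence_constant:
  fixes c :: "nat \<Rightarrow> nat" and e f :: nat
  assumes pos: "\<And>n. c n > 0" and rec: "\<And>n. c n + f * c (n + 2) = e * c (n + 1)" and f: "f \<ge> 2"
  shows "c n = c 0" and "e = f + 1"
proof -
  define N :: "nat \<Rightarrow> int" where "N n = int (c n) * int (c (n + 2)) - int (c (n + 1)) * int (c (n + 1))" for n
  have N_step: "N n = int f * N (n + 1)" for n
  proof -
    have 1: "int (c n) = int e * int (c (n + 1)) - int f * int (c (n + 2))"
      using arg_cong[OF rec[of n], of int] by simp
    have 2: "int f * int (c (n + 3)) = int e * int (c (n + 2)) - int (c (n + 1))"
      using arg_cong[OF rec[of "n + 1"], of int] by (simp add: eval_nat_numeral)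
    have "int f * N (n + 1) = int (c (n + 1)) * (int f * int (c (n + 3))) - int f * int (c (n + 2)) * int (c (n + 2))"
      by (simp add: N_def algebra_simps eval_nat_numeral)
    also have "\<dots> = N n" unfolding 2 N_def 1 by (simp add: algebra_simps)
    finally show ?thesis by simp
  qed
  have N_pow: "N n = int f ^ k * N (n + k)" for n k
  proof (induction k)
    case (Suc k)
    then show ?case using N_step[of "n + k"] by simp
  qed simp
  have N0: "N n = 0" for n
  proof (rule ccontr)
    assume "N n \<noteq> 0"
    define k where "k = nat \<bar>N n\<bar>"
    have "int f ^ k dvd N n" using N_pow[of n k] by simp
    then have "\<bar>int f ^ k\<bar> \<le> \<bar>N n\<bar>" using \<open>N n \<noteq> 0\<close> dvd_imp_le_int by blast
    then have "int (f ^ k) \<le> int k" unfolding k_def by simp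
    then have "f ^ k \<le> k" by linarith
    moreover have "k < 2 ^ k" by (rule less_exp)
    moreover have "(2::nat) ^ k \<le> f ^ k" using f by (rule power_mono) simp
    ultimately show False by linarith
  qed
  have geo: "c n * c (n + 2) = c (n + 1) * c (n + 1)" for n
    using N0[of n] unfolding N_def by (simp flip: of_nat_mult)
  have dec: "c (n + 1) \<le> c n" for n
  proof -
    have nz: "gcd (c n) (c (n + 1)) \<noteq> 0" using pos[of n] by simp
    \<comment> \<open>With \<open>c\<^sub>n = u g\<close> and \<open>c\<^sub>n\<^sub>+\<^sub>1 = v g\<close> in lowest terms, \<open>u\<^sup>2 + f v\<^sup>2 = e u v\<close> shows that \<open>v\<close> divides \<open>u\<^sup>2\<close>.\<close>
    obtain u v where uv: "c n = u * gcd (c n) (c (n + 1))" "c (n + 1) = v * gcd (c n) (c (n + 1))" "coprime u v"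
      using gcd_coprime_exists[OF nz] by blast
    define g where "g = gcd (c n) (c (n + 1))"
    have g: "g > 0" using nz unfolding g_def by simp
    have "c n * c n + f * (c n * c (n + 2)) = e * (c n * c (n + 1))"
      using arg_cong[OF rec[of n], of "\<lambda>x. c n * x"] by (simp add: algebra_simps)
    then have "c n * c n + f * (c (n + 1) * c (n + 1)) = e * (c n * c (n + 1))" using geo[of n] by simp
    then have "(u * u + f * (v * v)) * (g * g) = (e * (u * v)) * (g * g)"
      using uv(1,2) unfolding g_def[symmetric] by (simp add: algebra_simps)
    then have "u * u + f * (v * v) = e * (u * v)" using g by simp
    then have "v dvd u * u + f * (v * v)" by simp
    then have "v dvd u * u" using dvd_add_left_iff[of v "f * (v * v)" "u * u"] by simp
    then have "v dvd u" using uv(3) by (simp add: coprime_commute coprime_dvd_mult_left_iff)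
    then have "c (n + 1) dvd c n" using uv(1,2) by (metis mult_dvd_mono dvd_refl)
    then show ?thesis using pos by (intro dvd_imp_le)
  qed
  \<comment> \<open>Being nonincreasing, the sequence repeats a value at its minimum; by geometricity it repeats it everywhere.\<close>
  obtain n0 where n0: "\<And>m. c n0 \<le> c m" using ex_has_least_nat[of "\<lambda>_. True" 0 c] by auto
  have eq0: "c (n0 + 1) = c n0" using n0[of "n0 + 1"] dec[of n0] by simp
  have up: "c (Suc n + 1) = c (Suc n)" if "c (n + 1) = c n" for n
    using geo[of n] that pos[of n] by simp
  have down: "c (n + 1) = c n" if "c (Suc n + 1) = c (Suc n)" for n
    using geo[of n] that pos[of "Suc n"] by simp
  have "c (n0 - k + 1) = c (n0 - k)" for k
  proof (induction k)
    case (Suc k)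
    then show ?case
    proof (cases "k < n0")
      case True
      then have "n0 - k = Suc (n0 - Suc k)" by simp
      then show ?thesis using Suc down[of "n0 - Suc k"] by simp
    qed auto
  qed (simp add: eq0[simplified])
  from this[of n0] have "c (0 + 1) = c 0" by simp
  then have step: "c (n + 1) = c n" for n by (induction n) (use up in auto)
  have const: "c n = c 0" for n by (induction n) (use step in auto)
  show "c n = c 0" by (rule const)
  have "c 0 * (f + 1) = c 0 * e" using rec[of 0] const[of "0 + 1"] const[of "0 + 2"] by (simp add: algebra_simps del: One_nat_def add_2_eq_Suc')
  then show "e = f + 1" using pos[of 0] by (metis mult_cancel1 not_gr_zero)
qed

section \<open>A socle generator forces growth\<close>

context Module.module begin

lemma ilen_direct_sum:
  assumes "submodule R P M" "submodule R Q M" "P \<inter> Q = {\<zero>\<^bsub>M\<^esub>}"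
  shows "ilen R M {\<zero>\<^bsub>M\<^esub>} (P <+>\<^bsub>M\<^esub> Q) = ilen R M {\<zero>\<^bsub>M\<^esub>} P + ilen R M {\<zero>\<^bsub>M\<^esub>} Q"
proof -
  have "Q \<inter> P = {\<zero>\<^bsub>M\<^esub>}" using assms(3) by blast
  then show ?thesis
    using ilen_add[OF submodule_zero assms(1) submodule_set_add[OF assms(1,2)]]
      ilen_second_iso[OF assms(1,2)] submoduleD(4)[OF assms(1)] set_add_upper(1)[OF assms(1,2)] by simp
qed

end

context minimal_acyclic_complex begin

lemma ilen_finite: "V \<subseteq> carrier (A i) \<Longrightarrow> \<zero>\<^bsub>A i\<^esub> \<in> U \<Longrightarrow> \<exists>n. ilen R (A i) U V = enat n"
proof -
  assume "V \<subseteq> carrier (A i)" "\<zero>\<^bsub>A i\<^esub> \<in> U"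
  then have "ilen R (A i) U V \<le> ilen R (A i) {\<zero>\<^bsub>A i\<^esub>} (carrier (A i))" by (intro ilen_mono) auto
  also have "\<dots> = enat (b i * (1 + embdim + sqdim))"
    using free[of i] ilen_RR unfolding A.free_of_rank_def by simp
  finally show ?thesis by (cases "ilen R (A i) U V") auto
qed

text \<open>
  The restriction of the minimal cover to a submodule \<open>P\<close>: \<open>F\<close> needs only as many generators as \<open>P\<close>, which bounds
  its length by that of a free module of this rank.
\<close>
lemma cover_summand:
  assumes P: "submodule R P (A j)" "P \<subseteq> Z j" and p: "ilen R (A j) (scale R (A j) \<mm> P) P = enat p"
  shows "\<exists>F. generated R (A (j + 1)) p F \<and> submodule R F (A (j + 1)) \<and> d (j + 1) ` F = P \<and>
    ilen R (A (j + 1)) {\<zero>\<^bsub>A (j + 1)\<^esub>} F \<le> enat (p * (1 + embdim + sqdim))"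
proof -
  have mP: "submodule R (scale R (A j) \<mm> P) (A j)" by (rule A.submodule_mS[OF P(1)])
  have "P \<subseteq> d (j + 1) ` carrier (A (j + 1))" using P(2) unfolding Z_def .
  from A.exists_generated_lift[OF d.mod_hom_axioms P(1) this mP order_refl A.mS_subset[OF P(1)] p]
  obtain F where F: "generated R (A (j + 1)) p F" "scale R (A j) \<mm> P <+>\<^bsub>A j\<^esub> d (j + 1) ` F = P" by blast
  have sF: "submodule R F (A (j + 1))" using A.submodule_generated[OF F(1)] .
  have dF: "submodule R (d (j + 1) ` F) (A j)" using d.submodule_image[OF sF] .
  have 1: "d (j + 1) ` F \<subseteq> P" using A.set_add_upper(2)[OF mP dF] F(2) by simp
  have "P \<subseteq> d (j + 1) ` F <+>\<^bsub>A j\<^esub> scale R (A j) \<mm> P" using F(2) A.set_add_commute[OF mP dF] by simp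
  then have 2: "P \<subseteq> d (j + 1) ` F" by (rule A.nakayama[OF dF P(1)])
  have "{\<zero>} \<subseteq> carrier R" by simp
  from A.ilen_scale_generated_le[OF submodule_RR(4,3) this F(1)]
  have "ilen R (A (j + 1)) {\<zero>\<^bsub>A (j + 1)\<^esub>} F \<le> enat (p * (1 + embdim + sqdim))"
    by (simp only: A.scale_zero[OF sF] A.scale_carrier[OF sF] ilen_RR times_enat_simps)
  then show ?thesis using F sF 1 2 by blast
qed

text \<open>
  \<open>Z\<^sub>j\<close> has a direct summand \<open>P\<close> with \<open>p\<close> minimal generators and \<open>\<mm>P\<close> of length \<open>y\<close>. Starting from \<open>P \<cong> k\<close> at a socle
  generator, the summands at the later indices are the syzygies of \<open>k\<close>, and \<open>p\<close> runs through the Betti numbers of \<open>k\<close>.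
\<close>
definition split_at where
  "split_at j p y \<longleftrightarrow> (\<exists>P Q. submodule R P (A j) \<and> submodule R Q (A j) \<and> P \<inter> Q = {\<zero>\<^bsub>A j\<^esub>} \<and>
     P <+>\<^bsub>A j\<^esub> Q = Z j \<and> ilen R (A j) (scale R (A j) \<mm> P) P = enat p \<and>
     ilen R (A j) {\<zero>\<^bsub>A j\<^esub>} (scale R (A j) \<mm> P) = enat y)"

text \<open>
  The induction step for the syzygies of a summand. Cover \<open>P\<close> and \<open>Q\<close> by submodules \<open>F\<close> and \<open>G\<close> of \<open>A\<^sub>j\<^sub>+\<^sub>1\<close> with \<open>p\<close> and \<open>q\<close>
  generators, where \<open>p + q\<close> is the rank of \<open>A\<^sub>j\<^sub>+\<^sub>1\<close>. By Nakayama they span \<open>A\<^sub>j\<^sub>+\<^sub>1\<close>, and comparing lengths shows that the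
  sum is direct and that \<open>F\<close> is as long as \<open>R\<^sup>p\<close>. Then the cycles in \<open>F\<close> and in \<open>G\<close> decompose \<open>Z\<^sub>j\<^sub>+\<^sub>1\<close>, and
  \<open>0 \<rightarrow> F \<inter> Z\<^sub>j\<^sub>+\<^sub>1 \<rightarrow> F \<rightarrow> P \<rightarrow> 0\<close> gives the numbers.
\<close>
lemma split_at_le: "split_at j p y \<Longrightarrow> p \<le> b (j + 1)"
  and split_at_step: "split_at j p y \<Longrightarrow>
    \<exists>p' y'. split_at (j + 1) p' y' \<and> y' \<le> sqdim * p \<and> p' + y' + y = embdim * p + sqdim * p"
proof -
  assume "split_at j p y"
  then obtain P Q where PQ: "submodule R P (A j)" "submodule R Q (A j)" "P \<inter> Q = {\<zero>\<^bsub>A j\<^esub>}"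
      "P <+>\<^bsub>A j\<^esub> Q = Z j" and p: "ilen R (A j) (scale R (A j) \<mm> P) P = enat p"
      and y: "ilen R (A j) {\<zero>\<^bsub>A j\<^esub>} (scale R (A j) \<mm> P) = enat y"
    unfolding split_at_def by blast
  let ?m = "\<lambda>V. scale R (A j) \<mm> V"
  have PZ: "P \<subseteq> Z j" and QZ: "Q \<subseteq> Z j" using A.set_add_upper[OF PQ(1,2)] PQ(4) by auto
  have mP: "submodule R (?m P) (A j)" and mQ: "submodule R (?m Q) (A j)" using A.submodule_mS PQ by auto
  obtain q where q: "ilen R (A j) (?m Q) Q = enat q"
    using ilen_finite[of Q j "?m Q"] submoduleD(2)[OF PQ(2)] submoduleD(4)[OF mQ] by blast
  obtain y2 where y2: "ilen R (A j) {\<zero>\<^bsub>A j\<^esub>} (?m Q) = enat y2"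
    using ilen_finite[of "?m Q" j "{\<zero>\<^bsub>A j\<^esub>}"] submoduleD(2)[OF mQ] by blast
  have lP: "ilen R (A j) {\<zero>\<^bsub>A j\<^esub>} P = enat (y + p)"
    using A.ilen_add[OF submodules(6) mP PQ(1) zero_in[OF mP] A.mS_subset[OF PQ(1)]] p y by simp
  have lQ: "ilen R (A j) {\<zero>\<^bsub>A j\<^esub>} Q = enat (y2 + q)"
    using A.ilen_add[OF submodules(6) mQ PQ(2) zero_in[OF mQ] A.mS_subset[OF PQ(2)]] q y2 by simp
  have mm: "?m P \<inter> ?m Q = {\<zero>\<^bsub>A j\<^esub>}"
    using PQ(3) A.mS_subset[OF PQ(1)] A.mS_subset[OF PQ(2)] zero_in[OF mP] zero_in[OF mQ] by blast
  have "mZ j = ?m P <+>\<^bsub>A j\<^esub> ?m Q" using A.scale_set_add[OF \<mm>_carrier PQ(1,2)] PQ(4) by simp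
  then have "enat (z j) = enat (y + y2)" using A.ilen_direct_sum[OF mP mQ mm] ilen_z[of j] y y2 by simp
  moreover have "ilen R (A j) {\<zero>\<^bsub>A j\<^esub>} (Z j) = enat (y + p + (y2 + q))"
    using A.ilen_direct_sum[OF PQ(1-3)] PQ(4) lP lQ by simp
  ultimately have pq: "p + q = b (j + 1)" using ilen_coker[of j] ilen_Z_A[of j] by simp
  then show "p \<le> b (j + 1)" by simp
  let ?A = "A (j + 1)" and ?d = "d (j + 1)" and ?n = "1 + embdim + sqdim"
  let ?M = "\<lambda>V. scale R ?A \<mm> V"
  obtain F where F: "generated R ?A p F" "submodule R F ?A" "?d ` F = P" "ilen R ?A {\<zero>\<^bsub>?A\<^esub>} F \<le> enat (p * ?n)"
    using cover_summand[OF PQ(1) PZ p] by blast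
  obtain G where G: "generated R ?A q G" "submodule R G ?A" "?d ` G = Q" "ilen R ?A {\<zero>\<^bsub>?A\<^esub>} G \<le> enat (q * ?n)"
    using cover_summand[OF PQ(2) QZ q] by blast
  have FG: "submodule R (F <+>\<^bsub>?A\<^esub> G) ?A" by (intro A.submodule_set_add F G)
  have Fc: "F \<subseteq> carrier ?A" and Gc: "G \<subseteq> carrier ?A" using submoduleD(2) F(2) G(2) by auto
  have ker: "x \<in> Z (j + 1)" if "x \<in> carrier ?A" "?d x = \<zero>\<^bsub>A j\<^esub>" for x
    using that kernel_eq_Z[of j] by blast
  have kerD: "?d x = \<zero>\<^bsub>A j\<^esub>" if "x \<in> Z (j + 1)" for x using that kernel_eq_Z[of j] by blast
  \<comment> \<open>\<open>F + G\<close> maps onto \<open>Z\<^sub>j\<close>, and the kernel \<open>Z\<^sub>j\<^sub>+\<^sub>1\<close> lies in \<open>\<mm>A\<^sub>j\<^sub>+\<^sub>1\<close>.\<close>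
  have "carrier ?A \<subseteq> (F <+>\<^bsub>?A\<^esub> G) <+>\<^bsub>?A\<^esub> mA (j + 1)"
  proof
    fix x assume x: "x \<in> carrier ?A"
    have "?d x \<in> P <+>\<^bsub>A j\<^esub> Q" using PQ(4) x unfolding Z_def by simp
    then obtain f g where fg: "f \<in> F" "g \<in> G" "?d x = ?d f \<oplus>\<^bsub>A j\<^esub> ?d g"
      using F(3) G(3) by (auto elim!: set_addE)
    have c: "f \<in> carrier ?A" "g \<in> carrier ?A" using fg Fc Gc by auto
    let ?u = "f \<oplus>\<^bsub>?A\<^esub> g"
    have uc: "?u \<in> carrier ?A" using c by simp
    have "?d (x \<ominus>\<^bsub>?A\<^esub> ?u) = ?d x \<ominus>\<^bsub>A j\<^esub> ?d ?u" using x uc by (rule d.f_minus)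
    also have "?d ?u = ?d x" using fg(3) d.f_add[OF c] by simp
    finally have "?d (x \<ominus>\<^bsub>?A\<^esub> ?u) = \<zero>\<^bsub>A j\<^esub>" using d.f_im[OF x] by (simp add: A.M.r_neg a_minus_def)
    then have "x \<ominus>\<^bsub>?A\<^esub> ?u \<in> mA (j + 1)" using ker[of "x \<ominus>\<^bsub>?A\<^esub> ?u"] x uc Z_subset_mA[of "j + 1"] by blast
    moreover have "?u \<in> F <+>\<^bsub>?A\<^esub> G" using fg by (intro set_addI)
    ultimately have "?u \<oplus>\<^bsub>?A\<^esub> (x \<ominus>\<^bsub>?A\<^esub> ?u) \<in> (F <+>\<^bsub>?A\<^esub> G) <+>\<^bsub>?A\<^esub> mA (j + 1)" by (rule set_addI[rotated])
    moreover have "?u \<oplus>\<^bsub>?A\<^esub> (x \<ominus>\<^bsub>?A\<^esub> ?u) = x"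
      using x uc A.M.add.m_lcomm[OF uc x, of "\<ominus>\<^bsub>?A\<^esub> ?u"] by (simp add: a_minus_def A.M.r_neg)
    ultimately show "x \<in> (F <+>\<^bsub>?A\<^esub> G) <+>\<^bsub>?A\<^esub> mA (j + 1)" by simp
  qed
  then have "carrier ?A \<subseteq> F <+>\<^bsub>?A\<^esub> G" by (rule A.nakayama[OF FG submodules(5)])
  then have car: "F <+>\<^bsub>?A\<^esub> G = carrier ?A" using submoduleD(2)[OF FG] by blast
  obtain lF where lF: "ilen R ?A {\<zero>\<^bsub>?A\<^esub>} F = enat lF" using F(4) by (cases "ilen R ?A {\<zero>\<^bsub>?A\<^esub>} F") auto
  have GF: "submodule R (G \<inter> F) ?A" by (intro A.submodule_Int F G)
  have eG: "ilen R ?A {\<zero>\<^bsub>?A\<^esub>} G = ilen R ?A {\<zero>\<^bsub>?A\<^esub>} (G \<inter> F) + ilen R ?A (G \<inter> F) G"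
    by (intro A.ilen_add submodules GF G zero_in) auto
  obtain l1 l2 where l12: "ilen R ?A {\<zero>\<^bsub>?A\<^esub>} (G \<inter> F) = enat l1" "ilen R ?A (G \<inter> F) G = enat l2"
    using G(4) unfolding eG
    by (cases "ilen R ?A {\<zero>\<^bsub>?A\<^esub>} (G \<inter> F)"; cases "ilen R ?A (G \<inter> F) G") auto
  have "ilen R ?A {\<zero>\<^bsub>?A\<^esub>} (carrier ?A) = ilen R ?A {\<zero>\<^bsub>?A\<^esub>} F + ilen R ?A F (F <+>\<^bsub>?A\<^esub> G)"
    unfolding car[symmetric] using A.set_add_upper(1)[OF F(2) G(2)] by (intro A.ilen_add submodules F FG zero_in)
  also have "\<dots> = enat (lF + l2)" using A.ilen_second_iso[OF F(2) G(2)] lF l12 by simp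
  finally have tot: "lF + l2 = (p + q) * ?n"
    using free[of "j + 1"] ilen_RR pq unfolding A.free_of_rank_def by simp
  have "lF \<le> p * ?n" "l1 + l2 \<le> q * ?n" using F(4) G(4) unfolding eG lF l12 by auto
  then have lFe: "lF = p * ?n" and l1: "l1 = 0" using tot unfolding add_mult_distrib by linarith+
  have "{\<zero>\<^bsub>?A\<^esub>} = G \<inter> F" using A.ilen_eq_0_iff[OF submodules(6) GF zero_in[OF GF]] l12(1) l1 by (simp add: zero_enat_def)
  then have FG0: "F \<inter> G = {\<zero>\<^bsub>?A\<^esub>}" by blast
  let ?P = "F \<inter> Z (j + 1)" and ?Q = "G \<inter> Z (j + 1)"
  have sP: "submodule R ?P ?A" and sQ: "submodule R ?Q ?A" by (intro A.submodule_Int F G submodules)+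
  have "?P \<inter> ?Q = {\<zero>\<^bsub>?A\<^esub>}" using FG0 zero_in[OF sP] zero_in[OF sQ] by blast
  moreover have "?P <+>\<^bsub>?A\<^esub> ?Q = Z (j + 1)"
  proof
    show "?P <+>\<^bsub>?A\<^esub> ?Q \<subseteq> Z (j + 1)" by (intro A.set_add_least submodules) auto
    show "Z (j + 1) \<subseteq> ?P <+>\<^bsub>?A\<^esub> ?Q"
    proof
      fix x assume x: "x \<in> Z (j + 1)"
      then have "x \<in> F <+>\<^bsub>?A\<^esub> G" unfolding car using submoduleD(2)[OF submodule_Z] by blast
      then obtain f g where fg: "f \<in> F" "g \<in> G" "x = f \<oplus>\<^bsub>?A\<^esub> g" by (auto elim!: set_addE)
      have c: "f \<in> carrier ?A" "g \<in> carrier ?A" using fg Fc Gc by auto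
      have dd: "?d f \<in> P" "?d g \<in> Q" using fg F(3) G(3) by auto
      have "?d f \<oplus>\<^bsub>A j\<^esub> ?d g = \<zero>\<^bsub>A j\<^esub>" using kerD[OF x] d.f_add[OF c] fg(3) by simp
      then have "?d f = \<ominus>\<^bsub>A j\<^esub> ?d g" using d.f_im[OF c(1)] d.f_im[OF c(2)] by (intro A.M.minus_equality[symmetric])
      then have "?d f \<in> Q" using A.submodule_neg[OF PQ(2) dd(2)] by simp
      then have "?d f = \<zero>\<^bsub>A j\<^esub>" using dd(1) PQ(3) by blast
      then have f: "f \<in> Z (j + 1)" by (rule ker[OF c(1)])
      then have "g \<in> Z (j + 1)" using A.submodule_add_cancel[OF submodule_Z f c(2)] x fg(3) by simp
      then show "x \<in> ?P <+>\<^bsub>?A\<^esub> ?Q" using f fg by (auto intro!: set_addI)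
    qed
  qed
  moreover obtain p' where p': "ilen R ?A (?M ?P) ?P = enat p'"
    using ilen_finite[of ?P "j + 1" "?M ?P"] submoduleD(2)[OF sP] submoduleD(4)[OF A.submodule_mS[OF sP]] by blast
  moreover obtain y' where y': "ilen R ?A {\<zero>\<^bsub>?A\<^esub>} (?M ?P) = enat y'"
    using ilen_finite[of "?M ?P" "j + 1" "{\<zero>\<^bsub>?A\<^esub>}"] submoduleD(2)[OF A.submodule_mS[OF sP]] by blast
  ultimately have split: "split_at (j + 1) p' y'" unfolding split_at_def using sP sQ by blast
  have MF: "submodule R (?M F) ?A" and MG: "submodule R (?M G) ?A" using A.submodule_mS F(2) G(2) by auto
  \<comment> \<open>The new summand lies in \<open>\<mm>F\<close>, so its multiples by \<open>\<mm>\<close> lie in \<open>\<mm>\<^sup>2F\<close>.\<close>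
  have "?P \<subseteq> F \<inter> mA (j + 1)" using Z_subset_mA[of "j + 1"] by blast
  also have "mA (j + 1) = ?M F <+>\<^bsub>?A\<^esub> ?M G" unfolding car[symmetric] by (rule A.scale_set_add[OF \<mm>_carrier F(2) G(2)])
  also have "F \<inter> (?M F <+>\<^bsub>?A\<^esub> ?M G) = ?M F <+>\<^bsub>?A\<^esub> (F \<inter> ?M G)"
    by (intro A.modular_law MF MG F A.mS_subset)
  also have "\<dots> \<subseteq> ?M F"
  proof (intro A.set_add_least MF order_refl)
    have "F \<inter> ?M G \<subseteq> {\<zero>\<^bsub>?A\<^esub>}" using FG0 A.mS_subset[OF G(2)] by blast
    then show "F \<inter> ?M G \<subseteq> ?M F" using zero_in[OF MF] by blast
  qed
  finally have "?M ?P \<subseteq> ?M (?M F)" by (intro A.scale_mono order_refl)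
  then have "?M ?P \<subseteq> scale R ?A \<mm>2 F" using A.mS_mS[OF F(2)] by simp
  then have "enat y' \<le> ilen R ?A {\<zero>\<^bsub>?A\<^esub>} (scale R ?A \<mm>2 F)" unfolding y'[symmetric] by (intro ilen_mono) auto
  also have "\<dots> \<le> enat p * enat sqdim"
    using A.ilen_scale_generated_le[OF submodule_RR(4,2) _ F(1)] submoduleD(4)[OF submodule_RR(2)]
    by (simp add: A.scale_zero[OF F(2)] ilen_0_\<mm>2)
  finally have 1: "y' \<le> sqdim * p" by (simp add: mult.commute)
  have "F \<inter> ?d -` {\<zero>\<^bsub>A j\<^esub>} = ?P" using ker kerD Fc by blast
  then have "ilen R ?A ?P F = enat (y + p)" using d.ilen_image[OF F(2)] F(3) lP by simp
  then have "lF = (y' + p') + (y + p)"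
    using A.ilen_add[OF submodules(6) sP F(2) zero_in[OF sP]]
      A.ilen_add[OF submodules(6) A.submodule_mS[OF sP] sP zero_in[OF A.submodule_mS[OF sP]] A.mS_subset[OF sP]]
      lF p' y' by simp
  then have "p' + y' + y = embdim * p + sqdim * p" using lFe by (simp add: algebra_simps)
  then show "\<exists>p' y'. split_at (j + 1) p' y' \<and> y' \<le> sqdim * p \<and> p' + y' + y = embdim * p + sqdim * p"
    using split 1 by blast
qed

lemma split_at_socle_gen:
  assumes "socle_gen i" shows "split_at i 1 0"
proof -
  obtain y where y: "y \<in> Z i" "y \<notin> mZ i" "\<And>r. r \<in> \<mm> \<Longrightarrow> r \<odot>\<^bsub>A i\<^esub> y = \<zero>\<^bsub>A i\<^esub>"
    using assms unfolding socle_gen_def by blast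
  have yc: "y \<in> carrier (A i)" using y(1) submoduleD(2)[OF submodule_Z] by blast
  let ?C = "cyclic_submodule R (A i) y"
  have C: "submodule R ?C (A i)" by (rule A.submodule_cyclic[OF yc])
  obtain L where L: "submodule R L (A i)" "L \<inter> ?C = {\<zero>\<^bsub>A i\<^esub>}" "L <+>\<^bsub>A i\<^esub> ?C = Z i"
    using A.socle_element_splits[OF submodule_Z y] ilen_mZ_Z[of i] by auto
  have "scale R (A i) \<mm> ?C \<subseteq> {\<zero>\<^bsub>A i\<^esub>}"
  proof (rule A.scale_least[OF submodules(6)])
    fix r x assume "r \<in> \<mm>" "x \<in> ?C"
    then obtain s where s: "s \<in> carrier R" "x = s \<odot>\<^bsub>A i\<^esub> y" by (auto simp: cyclic_submodule_def)
    have rc: "r \<in> carrier R" using \<open>r \<in> \<mm>\<close> \<mm>_carrier by blast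
    have "r \<odot>\<^bsub>A i\<^esub> x = (s \<otimes> r) \<odot>\<^bsub>A i\<^esub> y" 
      using s rc yc m_comm[OF rc s(1)] by (simp flip: A.smult_assoc1)
    also have "\<dots> = s \<odot>\<^bsub>A i\<^esub> (r \<odot>\<^bsub>A i\<^esub> y)" using s rc yc by (simp add: A.smult_assoc1)
    finally show "r \<odot>\<^bsub>A i\<^esub> x \<in> {\<zero>\<^bsub>A i\<^esub>}" using y(3)[OF \<open>r \<in> \<mm>\<close>] s by simp
  qed
  then have mC: "scale R (A i) \<mm> ?C = {\<zero>\<^bsub>A i\<^esub>}" using zero_in[OF A.submodule_mS[OF C]] by blast
  have "y \<notin> {\<zero>\<^bsub>A i\<^esub>}" using y(2) zero_in[OF submodules(4)[of i]] by blast
  then have "ilen R (A i) {\<zero>\<^bsub>A i\<^esub>} ({\<zero>\<^bsub>A i\<^esub>} <+>\<^bsub>A i\<^esub> ?C) = 1" using y(3) by (intro A.ilen_add_cyclic submodules yc) auto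
  then have 1: "ilen R (A i) {\<zero>\<^bsub>A i\<^esub>} ?C = enat 1"
    using A.set_add_absorb[OF submodules(6) C zero_in[OF C]] by (simp add: one_enat_def)
  have "?C \<inter> L = {\<zero>\<^bsub>A i\<^esub>}" using L(2) by blast
  then show ?thesis unfolding split_at_def
    using C L A.set_add_commute[OF C L(1)] mC 1 A.ilen_self[of i "{\<zero>\<^bsub>A i\<^esub>}"]
    by (intro exI[of _ ?C] exI[of _ L]) (auto simp: zero_enat_def)
qed

text \<open>
  The invariant \<open>y \<le> f (p - 1)\<close> holds at the start, where \<open>p = 1\<close> and \<open>y = 0\<close>, and it passes to the next syzygy because
  \<open>e > f\<close> makes \<open>p\<close> grow by at least \<open>f\<close>.
\<close>
lemma socle_gen_growth:
  assumes "socle_gen i" and ef: "embdim > sqdim" and f: "sqdim > 0"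
  shows "b (i + int n + 1) > n"
proof -
  have "\<exists>p y. split_at (i + int n) p y \<and> p > n \<and> y \<le> sqdim * (p - 1)" for n
  proof (induction n)
    case 0
    then show ?case using split_at_socle_gen[OF assms(1)] by (intro exI[of _ 1] exI[of _ 0]) simp
  next
    case (Suc n)
    then obtain p y where p: "split_at (i + int n) p y" "p > n" "y \<le> sqdim * (p - 1)" by blast
    obtain p' y' where p': "split_at (i + int n + 1) p' y'" "y' \<le> sqdim * p"
      "p' + y' + y = embdim * p + sqdim * p"
      using split_at_step[OF p(1)] by blast
    have a: "sqdim * (p - 1) + sqdim = sqdim * p" using p(2) by (cases p) auto
    have "(sqdim + 1) * p \<le> embdim * p" using ef by (intro mult_right_mono) auto
    then have c: "sqdim * p + p \<le> embdim * p" by simp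
    have pp: "p' \<ge> p + sqdim" using p'(2,3) p(3) a c by linarith
    then have "p \<le> p' - 1" using f by linarith
    then have "sqdim * p \<le> sqdim * (p' - 1)" by (rule mult_left_mono) simp
    then have "y' \<le> sqdim * (p' - 1)" by (rule order_trans[OF p'(2)])
    moreover have "p' > Suc n" using pp p(2) f by simp
    moreover have "i + int (Suc n) = i + int n + 1" by simp
    ultimately show ?case using p'(1) by metis
  qed
  then show ?thesis using split_at_le by (metis less_le_trans)
qed

end

section \<open>Artinian local rings with simple socle are self-injective\<close>

context cube_zero_local_ring begin

text \<open>
  Each generator of \<open>F\<close> imposes at most \<open>f\<close> linear conditions on \<open>\<mm>\<close>, as multiplication by it has values in \<open>\<mm>\<^sup>2\<close>.
\<close>
lemma ilen_annihilator_le: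
  assumes "generated R RR n F" "F \<subseteq> \<mm>"
  shows "ilen R RR (\<mm> \<inter> {y \<in> carrier R. \<forall>k\<in>F. k \<otimes> y \<in> {\<zero>}}) \<mm> \<le> enat (n * sqdim)"
  using assms
proof (induction rule: generated.induct)
  case generated_0
  have "\<mm> \<inter> {y \<in> carrier R. \<forall>k\<in>{\<zero>\<^bsub>RR\<^esub>}. k \<otimes> y \<in> {\<zero>}} = \<mm>" using \<mm>_carrier by auto
  then show ?case by (simp add: RR.ilen_self)
next
  case (generated_Suc n F x)
  let ?C = "cyclic_submodule R RR x"
  let ?T = "\<lambda>F. \<mm> \<inter> {y \<in> carrier R. \<forall>k\<in>F. k \<otimes> y \<in> {\<zero>}}"
  have x: "x \<in> carrier R" using generated_Suc.hyps by simp
  have F: "submodule R F RR" using RR.submodule_generated generated_Suc.hyps by blast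
  have C: "submodule R ?C RR" using RR.submodule_cyclic x by simp
  have up: "F \<subseteq> F <+>\<^bsub>RR\<^esub> ?C" "?C \<subseteq> F <+>\<^bsub>RR\<^esub> ?C" using RR.set_add_upper[OF F C] by auto
  have xm: "x \<in> \<mm>" using up(2) RR.self_in_cyclic[of x] x generated_Suc.prems by auto
  have Fc: "F \<subseteq> carrier R" using submoduleD(2)[OF F] by simp
  have sT: "submodule R (?T F) RR"
    using RR.submodule_Int[OF submodule_RR(1) RR.submodule_colon[OF Fc submodule_RR(4)]] by simp
  have sum: "(F <+>\<^bsub>RR\<^esub> ?C) \<subseteq> carrier R" using generated_Suc.prems \<mm>_carrier by blast
  have sT': "submodule R (?T (F <+>\<^bsub>RR\<^esub> ?C)) RR"
    using RR.submodule_Int[OF submodule_RR(1) RR.submodule_colon[OF sum submodule_RR(4)]] by simp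
  have xr: "x \<in> carrier RR" using x by simp
  interpret h: mod_hom R RR RR "\<lambda>r. r \<odot>\<^bsub>RR\<^esub> x" using RR.mod_hom_smult[of x] x by simp
  have eq: "?T F \<inter> (\<lambda>r. r \<odot>\<^bsub>RR\<^esub> x) -` {\<zero>\<^bsub>RR\<^esub>} = ?T (F <+>\<^bsub>RR\<^esub> ?C)"
  proof
    show "?T (F <+>\<^bsub>RR\<^esub> ?C) \<subseteq> ?T F \<inter> (\<lambda>r. r \<odot>\<^bsub>RR\<^esub> x) -` {\<zero>\<^bsub>RR\<^esub>}"
    proof
      fix y assume y: "y \<in> ?T (F <+>\<^bsub>RR\<^esub> ?C)"
      have "x \<in> F <+>\<^bsub>RR\<^esub> ?C" using up(2) RR.self_in_cyclic[of x] x by auto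
      then have "x \<otimes> y = \<zero>" using y by blast
      then show "y \<in> ?T F \<inter> (\<lambda>r. r \<odot>\<^bsub>RR\<^esub> x) -` {\<zero>\<^bsub>RR\<^esub>}" using y up(1) x m_comm[of x y] by auto
    qed
    show "?T F \<inter> (\<lambda>r. r \<odot>\<^bsub>RR\<^esub> x) -` {\<zero>\<^bsub>RR\<^esub>} \<subseteq> ?T (F <+>\<^bsub>RR\<^esub> ?C)"
    proof
      fix y assume y: "y \<in> ?T F \<inter> (\<lambda>r. r \<odot>\<^bsub>RR\<^esub> x) -` {\<zero>\<^bsub>RR\<^esub>}"
      then have yc: "y \<in> carrier R" "y \<otimes> x = \<zero>" by auto
      have "k \<otimes> y = \<zero>" if kF: "k \<in> F <+>\<^bsub>RR\<^esub> ?C" for k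
      proof -
        obtain a r where k: "a \<in> F" "r \<in> carrier R" "k = a \<oplus> r \<otimes> x"
          using kF by (auto elim!: set_addE simp: cyclic_submodule_def)
        have ac: "a \<in> carrier R" using k Fc by blast
        have "k \<otimes> y = a \<otimes> y \<oplus> r \<otimes> (y \<otimes> x)" unfolding k(3) using ac k(2) x yc(1) by algebra
        then show ?thesis using y k yc by auto
      qed
      then show "y \<in> ?T (F <+>\<^bsub>RR\<^esub> ?C)" using y by auto
    qed
  qed
  have "(\<lambda>r. r \<odot>\<^bsub>RR\<^esub> x) ` ?T F \<subseteq> \<mm>2" using mult_\<mm>_\<mm> xm by auto
  then have "ilen R RR {\<zero>\<^bsub>RR\<^esub>} ((\<lambda>r. r \<odot>\<^bsub>RR\<^esub> x) ` ?T F) \<le> ilen R RR {\<zero>} \<mm>2" by (intro ilen_mono) auto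
  then have 1: "ilen R RR (?T (F <+>\<^bsub>RR\<^esub> ?C)) (?T F) \<le> enat sqdim"
    using h.ilen_image[OF sT] ilen_0_\<mm>2 unfolding eq by simp
  have 2: "ilen R RR (?T F) \<mm> \<le> enat (n * sqdim)" using generated_Suc.IH up(1) generated_Suc.prems by blast
  have "?T (F <+>\<^bsub>RR\<^esub> ?C) \<subseteq> ?T F" using up(1) by blast
  then have "ilen R RR (?T (F <+>\<^bsub>RR\<^esub> ?C)) \<mm> = ilen R RR (?T (F <+>\<^bsub>RR\<^esub> ?C)) (?T F) + ilen R RR (?T F) \<mm>"
    using RR.ilen_add[OF sT' sT submodule_RR(1)] by blast
  also have "\<dots> \<le> enat sqdim + enat (n * sqdim)" using 1 2 by (rule add_mono)
  finally show ?case by simp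
qed

text \<open>
  The socle is \<open>\<mm>\<^sup>2\<close> and one-dimensional. For rings with \<open>\<mm>\<^sup>3 = 0 \<noteq> \<mm>\<^sup>2\<close> this is the Gorenstein property; the
  implication proved here is that such a ring is injective as a module over itself.
\<close>
definition simple_socle where
  "simple_socle \<longleftrightarrow> sqdim = 1 \<and> (\<forall>x\<in>\<mm>. (\<forall>r\<in>\<mm>. r \<otimes> x = \<zero>) \<longrightarrow> x \<in> \<mm>2)"

text \<open>
  Vanishing of \<open>Ext\<^sup>1(k, R)\<close>. Subtracting a multiplication, \<open>g\<close> may be assumed to vanish on \<open>\<mm>\<^sup>2 = R s\<close>; then it is a
  linear form on \<open>\<mm>/\<mm>\<^sup>2\<close> with values in the socle. The pairing \<open>\<mm>/\<mm>\<^sup>2 \<times> \<mm>/\<mm>\<^sup>2 \<rightarrow> \<mm>\<^sup>2\<close> has no kernel since \<open>\<mm>\<^sup>2\<close> is the socle, and so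
  every linear form is multiplication by an element of \<open>\<mm>\<close>.
\<close>
lemma linear_form_on_\<mm>:
  assumes soc: "simple_socle"
    and gc: "\<And>x. x \<in> \<mm> \<Longrightarrow> g x \<in> carrier R"
    and gadd: "\<And>x y. x \<in> \<mm> \<Longrightarrow> y \<in> \<mm> \<Longrightarrow> g (x \<oplus> y) = g x \<oplus> g y"
    and gmult: "\<And>r x. r \<in> carrier R \<Longrightarrow> x \<in> \<mm> \<Longrightarrow> g (r \<otimes> x) = r \<otimes> g x"
  shows "\<exists>c\<in>carrier R. \<forall>x\<in>\<mm>. g x = x \<otimes> c"
proof -
  have \<mm>c: "x \<in> carrier R" if "x \<in> \<mm>" for x using that \<mm>_carrier by blast
  have \<mm>mult: "r \<otimes> x \<in> \<mm>" if "r \<in> carrier R" "x \<in> \<mm>" for r x using that max.I_l_closed by blast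
  have zm: "\<zero> \<in> \<mm>" using submoduleD(4)[OF submodule_RR(1)] by simp
  have "\<mm>2 \<noteq> {\<zero>}" using soc ilen_0_\<mm>2 RR.ilen_self[of "{\<zero>}"] unfolding simple_socle_def
    by (auto simp: zero_enat_def)
  then obtain s where s: "s \<in> \<mm>2" "s \<noteq> \<zero>" using submoduleD(4)[OF submodule_RR(2)] by auto
  have sm: "s \<in> \<mm>" and sc: "s \<in> carrier R" using s \<mm>2_subset \<mm>2_carrier by auto
  have ms: "r \<otimes> s = \<zero>" if "r \<in> \<mm>" for r using mult_\<mm>_\<mm>2[OF that s(1)] .
  let ?S = "cyclic_submodule R RR s"
  have S: "submodule R ?S RR" using RR.submodule_cyclic sc by simp
  have "{\<zero>} <+>\<^bsub>RR\<^esub> ?S = ?S" using RR.set_add_absorb[OF submodule_RR(4) S] submoduleD(4)[OF S] by simp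
  moreover have "?S \<subseteq> \<mm>2" using RR.cyclic_least[OF submodule_RR(2) s(1)] .
  moreover have z: "{\<zero>} \<subseteq> ?S" using submoduleD(4)[OF S] by simp
  moreover have c0: "cube_zero_module R \<mm> RR"
    by (intro cube_zero_module.intro cube_zero_local_ring_axioms module_ring_as_module)
  have len1: "ilen R RR U (U <+>\<^bsub>RR\<^esub> cyclic_submodule R RR x) = 1"
    if "submodule R U RR" "x \<in> carrier R" "x \<notin> U" "\<And>r. r \<in> \<mm> \<Longrightarrow> r \<otimes> x \<in> U" for U x
    using cube_zero_module.ilen_add_cyclic[OF c0, of U x] that by simp
  ultimately have "ilen R RR {\<zero>} ?S = 1" using len1[of "{\<zero>}" s] sc s ms by simp
  then have "ilen R RR ?S \<mm>2 = 0"
    using RR.ilen_add[OF submodule_RR(4) S submodule_RR(2) z \<open>?S \<subseteq> \<mm>2\<close>] ilen_0_\<mm>2 soc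
    unfolding simple_socle_def by (cases "ilen R RR ?S \<mm>2") (auto simp: one_enat_def zero_enat_def)
  then have "?S = \<mm>2" using RR.ilen_eq_0_iff[OF S submodule_RR(2) \<open>?S \<subseteq> \<mm>2\<close>] by simp
  then have mem2: "\<exists>a\<in>carrier R. x = a \<otimes> s" if "x \<in> \<mm>2" for x
    using that unfolding cyclic_submodule_def by auto
  have socle: "x \<in> \<mm>2" if x: "x \<in> carrier R" "\<And>r. r \<in> \<mm> \<Longrightarrow> r \<otimes> x = \<zero>" for x
  proof -
    have "x \<in> \<mm>"
    proof (rule ccontr)
      assume "x \<notin> \<mm>"
      then obtain y where y: "y \<in> carrier R" "y \<otimes> x = \<one>" using unit_if_not_mem[OF x(1)] by blast
      have "s = s \<otimes> (y \<otimes> x)" using y sc by simp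
      also have "\<dots> = y \<otimes> (s \<otimes> x)" using y(1) sc x(1) by algebra
      also have "\<dots> = \<zero>" using x(2)[OF sm] y(1) by simp
      finally show False using s by simp
    qed
    then show ?thesis using soc x(2) unfolding simple_socle_def by blast
  qed
  have g0: "g \<zero> = \<zero>" using gmult[of \<zero> \<zero>] gc[OF zm] zm by simp
  have "g s \<in> \<mm>2"
  proof (rule socle[OF gc[OF sm]])
    show "r \<otimes> g s = \<zero>" if "r \<in> \<mm>" for r using gmult[OF \<mm>c[OF that] sm] ms[OF that] g0 by simp
  qed
  then obtain l where l: "l \<in> carrier R" "g s = l \<otimes> s" using mem2 by blast
  define h where "h x = g x \<ominus> l \<otimes> x" for x
  have hc: "h x \<in> carrier R" if "x \<in> \<mm>" for x using gc[OF that] \<mm>c[OF that] l by (simp add: h_def)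
  have hadd: "h (x \<oplus> y) = h x \<oplus> h y" if "x \<in> \<mm>" "y \<in> \<mm>" for x y
    unfolding h_def gadd[OF that] using gc[OF that(1)] gc[OF that(2)] \<mm>c[OF that(1)] \<mm>c[OF that(2)] l(1) by algebra
  have hmult: "h (r \<otimes> x) = r \<otimes> h x" if "r \<in> carrier R" "x \<in> \<mm>" for r x
    unfolding h_def gmult[OF that] using gc[OF that(2)] \<mm>c[OF that(2)] l(1) that(1) by algebra
  have h2: "h x = \<zero>" if x: "x \<in> \<mm>2" for x
  proof -
    obtain a where a: "a \<in> carrier R" "x = a \<otimes> s" using mem2[OF x] by blast
    have "h s = \<zero>" unfolding h_def l(2) using l(1) sc by (simp add: minus_eq r_neg)
    then show ?thesis using hmult[OF a(1) sm] a by simp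
  qed
  have hm2: "h x \<in> \<mm>2" if x: "x \<in> \<mm>" for x
  proof (rule socle[OF hc[OF x]])
    show "r \<otimes> h x = \<zero>" if r: "r \<in> \<mm>" for r
      using hmult[OF \<mm>c[OF r] x] h2[OF mult_\<mm>_\<mm>[OF r x]] by simp
  qed
  have "\<exists>c\<in>carrier R. \<forall>x\<in>\<mm>. h x = x \<otimes> c"
  proof (cases "\<forall>x\<in>\<mm>. h x = \<zero>")
    case True
    then show ?thesis using \<mm>c by (intro bexI[of _ \<zero>]) auto
  next
    case False
    then obtain x0 where x0: "x0 \<in> \<mm>" "h x0 \<noteq> \<zero>" by blast
    have x0c: "x0 \<in> carrier R" using x0 \<mm>c by blast
    have inv: "\<exists>v\<in>carrier R. v \<otimes> (a \<otimes> s) = s" if ac: "a \<in> carrier R" and as: "a \<otimes> s \<noteq> \<zero>" for a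
    proof -
      have "a \<notin> \<mm>" using as ms by blast
      then obtain v where v: "v \<in> carrier R" "v \<otimes> a = \<one>" using unit_if_not_mem[OF ac] by blast
      have "v \<otimes> (a \<otimes> s) = (v \<otimes> a) \<otimes> s" using v(1) ac sc by (simp add: m_assoc)
      then show ?thesis using v sc by (intro bexI[of _ v]) auto
    qed
    obtain u where u: "u \<in> carrier R" "h x0 = u \<otimes> s" using mem2 hm2[OF x0(1)] by blast
    obtain v where v: "v \<in> carrier R" "v \<otimes> h x0 = s" using inv[OF u(1)] x0(2) u(2) by auto
    \<comment> \<open>The kernel has colength one in \<open>\<mm>\<close>; together with \<open>x0\<close> it generates \<open>\<mm>\<close>.\<close>
    let ?K = "{x \<in> \<mm>. h x = \<zero>}"
    have K: "submodule R ?K RR"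
      unfolding submodule_def
    proof (intro conjI allI impI subsetI)
      show "Module.module R RR" by (rule module_ring_as_module)
      show "x \<in> carrier RR" if "x \<in> ?K" for x using that \<mm>c by simp
      show "x \<oplus>\<^bsub>RR\<^esub> y \<in> ?K" if "x \<in> ?K" "y \<in> ?K" for x y
        using that hadd[of x y] submoduleD(3)[OF submodule_RR(1), of x y] by simp
      show "\<zero>\<^bsub>RR\<^esub> \<in> ?K" using zm h2 submoduleD(4)[OF submodule_RR(2)] by simp
      show "r \<odot>\<^bsub>RR\<^esub> x \<in> ?K" if "r \<in> carrier R" "x \<in> ?K" for r x
        using that hmult[of r x] \<mm>mult[of r x] by simp
    qed
    have dec: "\<exists>k\<in>?K. \<exists>a\<in>carrier R. x = k \<oplus> a \<otimes> x0" if x: "x \<in> \<mm>" for x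
    proof -
      obtain a where a: "a \<in> carrier R" "h x = a \<otimes> s" using mem2 hm2[OF x] by blast
      let ?k = "x \<ominus> (a \<otimes> v) \<otimes> x0"
      have avx: "(a \<otimes> v) \<otimes> x0 \<in> \<mm>" using a v x0 \<mm>mult by auto
      have k: "?k \<in> \<mm>" 
      proof -
        have "x \<oplus> \<ominus> \<one> \<otimes> (a \<otimes> v \<otimes> x0) \<in> \<mm>"
          using submoduleD(3)[OF submodule_RR(1) x \<mm>mult[OF _ avx]] by simp
        then show ?thesis using \<mm>c[OF avx] by (simp add: minus_eq l_minus)
      qed
      have eq: "x = ?k \<oplus> (a \<otimes> v) \<otimes> x0" using \<mm>c[OF x] a(1) v(1) x0c by algebra
      have "h x = h ?k \<oplus> (a \<otimes> v) \<otimes> h x0"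
        using hadd[OF k avx] eq hmult[of "a \<otimes> v" x0] a(1) v(1) x0(1) by simp
      also have "(a \<otimes> v) \<otimes> h x0 = h x" using a v hc[OF x0(1)] by (simp add: m_assoc)
      finally have "h x = h ?k \<oplus> h x" .
      then have "h ?k = \<zero>" using hc[OF k] hc[OF x] by (metis add.l_cancel_one' a_comm)
      then show ?thesis using k eq a v by blast
    qed
    have m2K: "\<mm>2 \<subseteq> ?K" using \<mm>2_subset h2 by blast
    let ?X = "cyclic_submodule R RR x0"
    have X: "submodule R ?X RR" using RR.submodule_cyclic x0c by simp
    have KX: "?K <+>\<^bsub>RR\<^esub> ?X = \<mm>"
    proof
      show "?K <+>\<^bsub>RR\<^esub> ?X \<subseteq> \<mm>" using RR.cyclic_least[OF submodule_RR(1) x0(1)] by (intro RR.set_add_least submodule_RR) auto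
      show "\<mm> \<subseteq> ?K <+>\<^bsub>RR\<^esub> ?X"
        using dec unfolding cyclic_submodule_def by (force simp: mem_set_add_iff)
    qed
    have "ilen R RR ?K \<mm> = 1"
      using len1[OF K x0c] x0 KX m2K mult_\<mm>_\<mm>[OF _ x0(1)] by auto
    then have "ilen R RR \<mm>2 ?K + 1 = enat embdim"
      using RR.ilen_add[OF submodule_RR(2) K submodule_RR(1) m2K] ilen_\<mm>2_\<mm> by auto
    then obtain n where n: "ilen R RR \<mm>2 ?K = enat n" "embdim = n + 1"
      by (cases "ilen R RR \<mm>2 ?K") (auto simp: one_enat_def)
    have "scale R RR \<mm> ?K \<subseteq> \<mm>2"
      using RR.scale_least[OF submodule_RR(2), of \<mm> ?K] mult_\<mm>_\<mm> by auto
    from cube_zero_module.exists_generated[OF c0 K submodule_RR(2) this m2K n(1)]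
    obtain F where F: "generated R RR n F" "\<mm>2 <+>\<^bsub>RR\<^esub> F = ?K" by blast
    have sF: "submodule R F RR" using RR.submodule_generated F(1) by blast
    have FK: "F \<subseteq> ?K" using RR.set_add_upper(2)[OF submodule_RR(2) sF] F(2) by simp
    \<comment> \<open>The annihilator of the kernel: \<open>e - 1\<close> conditions on \<open>\<mm>/\<mm>\<^sup>2\<close>, which has dimension \<open>e\<close>, leave some \<open>y\<close> outside \<open>\<mm>\<^sup>2\<close>.\<close>
    let ?T = "\<mm> \<inter> {y \<in> carrier R. \<forall>k\<in>F. k \<otimes> y \<in> {\<zero>}}"
    have "ilen R RR ?T \<mm> \<le> enat n"
      using ilen_annihilator_le[OF F(1)] FK soc unfolding simple_socle_def by auto
    moreover have "\<not> ilen R RR \<mm>2 \<mm> \<le> enat n" using ilen_\<mm>2_\<mm> n(2) by simp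
    moreover have "ilen R RR \<mm>2 \<mm> \<le> ilen R RR ?T \<mm>" if "?T \<subseteq> \<mm>2" using that by (intro ilen_mono) auto
    ultimately have "\<not> ?T \<subseteq> \<mm>2" using order_trans by blast
    then obtain y where y: "y \<in> \<mm>" "y \<notin> \<mm>2" "\<And>k. k \<in> F \<Longrightarrow> k \<otimes> y = \<zero>" by blast
    have yc: "y \<in> carrier R" using y \<mm>c by blast
    have yK: "k \<otimes> y = \<zero>" if "k \<in> ?K" for k
    proof -
      have "k \<in> \<mm>2 <+>\<^bsub>RR\<^esub> F" using F(2) that by simp
      then obtain a f where af: "a \<in> \<mm>2" "f \<in> F" "k = a \<oplus> f" by (auto elim!: set_addE)
      have ac: "a \<in> carrier R" "f \<in> carrier R" using af \<mm>2_carrier FK \<mm>c by auto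
      have "a \<otimes> y = \<zero>" using mult_\<mm>_\<mm>2[OF y(1) af(1)] m_comm ac yc by simp
      then show ?thesis using af y(3) ac yc by (simp add: l_distr)
    qed
    have "x0 \<otimes> y \<noteq> \<zero>"
    proof
      assume 0: "x0 \<otimes> y = \<zero>"
      have "r \<otimes> y = \<zero>" if r: "r \<in> \<mm>" for r
      proof -
        obtain k a where ka: "k \<in> ?K" "a \<in> carrier R" "r = k \<oplus> a \<otimes> x0" using dec[OF r] by blast
        have kc: "k \<in> carrier R" using ka \<mm>c by auto
        have "r \<otimes> y = k \<otimes> y \<oplus> a \<otimes> (x0 \<otimes> y)" unfolding ka(3) using kc ka(2) x0c yc by algebra
        then show ?thesis using yK[OF ka(1)] 0 ka(2) by simp
      qed
      then show False using socle[OF yc] y(2) by blast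
    qed
    moreover obtain w where w: "w \<in> carrier R" "x0 \<otimes> y = w \<otimes> s" using mem2 mult_\<mm>_\<mm>[OF x0(1) y(1)] by blast
    ultimately obtain t where t: "t \<in> carrier R" "t \<otimes> (x0 \<otimes> y) = s" using inv[of w] by auto
    \<comment> \<open>A unit multiple of \<open>y\<close> has the right value at \<open>x0\<close>.\<close>
    let ?c = "(u \<otimes> t) \<otimes> y"
    have "h x = x \<otimes> ?c" if x: "x \<in> \<mm>" for x
    proof -
      obtain k a where ka: "k \<in> ?K" "a \<in> carrier R" "x = k \<oplus> a \<otimes> x0" using dec[OF x] by blast
      have kc: "k \<in> carrier R" "k \<in> \<mm>" using ka \<mm>c by auto
      have "h x = h k \<oplus> h (a \<otimes> x0)" using hadd[OF kc(2) \<mm>mult[OF ka(2) x0(1)]] ka(3) by simp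
      also have "\<dots> = a \<otimes> (u \<otimes> s)" using ka hmult[OF ka(2) x0(1)] u sc by simp
      also have "\<dots> = (u \<otimes> t) \<otimes> (k \<otimes> y) \<oplus> a \<otimes> (u \<otimes> (t \<otimes> (x0 \<otimes> y)))" using yK[OF ka(1)] t u sc ka(2) by simp
      also have "\<dots> = x \<otimes> ?c" unfolding ka(3) using kc(1) u(1) t(1) yc ka(2) x0c by algebra
      finally show ?thesis .
    qed
    then show ?thesis using u t yc by (intro bexI[of _ ?c]) auto
  qed
  then obtain c where c: "c \<in> carrier R" "\<And>x. x \<in> \<mm> \<Longrightarrow> h x = x \<otimes> c" by blast
  have "g x = x \<otimes> (c \<oplus> l)" if x: "x \<in> \<mm>" for x
  proof -
    have "g x = h x \<oplus> l \<otimes> x" unfolding h_def using gc[OF x] l(1) \<mm>c[OF x] by algebra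
    then show ?thesis using c(2)[OF x] c(1) l(1) \<mm>c[OF x] by algebra
  qed
  then show ?thesis using c(1) l(1) by (intro bexI[of _ "c \<oplus> l"]) auto
qed

end

section \<open>Extending homomorphisms into a ring with simple socle\<close>
context cube_zero_module begin

text \<open>
  Graphs of homomorphisms into \<open>R\<close> from submodules of \<open>M\<close>; as sets of pairs they are ordered by extension, ready
  for Zorn's lemma.
\<close>
definition partial_hom where
  "partial_hom G \<longleftrightarrow> G \<subseteq> carrier M \<times> carrier R \<and> (\<zero>\<^bsub>M\<^esub>, \<zero>) \<in> G \<and>
    (\<forall>x y x' y'. (x, y) \<in> G \<longrightarrow> (x', y') \<in> G \<longrightarrow> (x \<oplus>\<^bsub>M\<^esub> x', y \<oplus> y') \<in> G) \<and>
    (\<forall>r\<in>carrier R. \<forall>x y. (x, y) \<in> G \<longrightarrow> (r \<odot>\<^bsub>M\<^esub> x, r \<otimes> y) \<in> G) \<and>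
    (\<forall>y. (\<zero>\<^bsub>M\<^esub>, y) \<in> G \<longrightarrow> y = \<zero>)"

lemma partial_homD:
  assumes "partial_hom G"
  shows "(x, y) \<in> G \<Longrightarrow> x \<in> carrier M" "(x, y) \<in> G \<Longrightarrow> y \<in> carrier R" "(\<zero>\<^bsub>M\<^esub>, \<zero>) \<in> G"
    "(x, y) \<in> G \<Longrightarrow> (x', y') \<in> G \<Longrightarrow> (x \<oplus>\<^bsub>M\<^esub> x', y \<oplus> y') \<in> G"
    "r \<in> carrier R \<Longrightarrow> (x, y) \<in> G \<Longrightarrow> (r \<odot>\<^bsub>M\<^esub> x, r \<otimes> y) \<in> G"
    "(\<zero>\<^bsub>M\<^esub>, y) \<in> G \<Longrightarrow> y = \<zero>"
  using assms unfolding partial_hom_def by blast+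

lemma partial_hom_unique:
  assumes G: "partial_hom G" and "(x, y) \<in> G" "(x, y') \<in> G" shows "y = y'"
proof -
  note c = partial_homD(1,2)[OF G assms(2)] partial_homD(2)[OF G assms(3)]
  have "(\<ominus> \<one> \<odot>\<^bsub>M\<^esub> x, \<ominus> \<one> \<otimes> y') \<in> G" using partial_homD(5)[OF G _ assms(3)] by simp
  then have "(x \<oplus>\<^bsub>M\<^esub> \<ominus> \<one> \<odot>\<^bsub>M\<^esub> x, y \<oplus> \<ominus> \<one> \<otimes> y') \<in> G" by (rule partial_homD(4)[OF G assms(2)])
  moreover have "x \<oplus>\<^bsub>M\<^esub> \<ominus> \<one> \<odot>\<^bsub>M\<^esub> x = \<zero>\<^bsub>M\<^esub>" using c by (simp add: smult_l_minus M.r_neg)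
  ultimately have "y \<oplus> \<ominus> \<one> \<otimes> y' = \<zero>" using partial_homD(6)[OF G] by metis
  moreover have "y = (y \<oplus> \<ominus> \<one> \<otimes> y') \<oplus> y'" using c(2,3) by algebra
  ultimately show ?thesis using c(3) by simp
qed

text \<open>
  Since \<open>\<mm>\<^sup>3 = 0\<close>, a proper domain misses some \<open>x\<close> with \<open>\<mm> x\<close> inside it. Extending to \<open>x\<close> requires a value
  \<open>c\<close> with \<open>r c\<close> equal to the given value at \<open>r x\<close> for all \<open>r \<in> \<mm>\<close>; the lemma on linear forms on \<open>\<mm>\<close> provides it. So instead
  of all ideals, as in Baer's criterion, only the ideal \<open>\<mm>\<close> has to be considered.
\<close>
lemma partial_hom_total_if_maximal:
  assumes soc: simple_socle and G: "partial_hom G"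
    and max: "\<And>H. partial_hom H \<Longrightarrow> G \<subseteq> H \<Longrightarrow> H = G"
  shows "\<forall>x\<in>carrier M. \<exists>y. (x, y) \<in> G"
proof (rule ccontr)
  define D where "D x \<longleftrightarrow> (\<exists>y. (x, y) \<in> G)" for x
  assume "\<not> (\<forall>x\<in>carrier M. \<exists>y. (x, y) \<in> G)"
  then obtain x0 where x0: "x0 \<in> carrier M" "\<not> D x0" unfolding D_def by blast
  have "\<exists>x\<in>carrier M. \<not> D x \<and> (\<forall>r\<in>\<mm>. D (r \<odot>\<^bsub>M\<^esub> x))"
  proof (rule ccontr)
    assume no: "\<not> (\<exists>x\<in>carrier M. \<not> D x \<and> (\<forall>r\<in>\<mm>. D (r \<odot>\<^bsub>M\<^esub> x)))"
    have step: "\<exists>r\<in>\<mm>. \<not> D (r \<odot>\<^bsub>M\<^esub> x) \<and> r \<odot>\<^bsub>M\<^esub> x \<in> carrier M" if "x \<in> carrier M" "\<not> D x" for x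
      using no that \<mm>_carrier by blast
    obtain r where r: "r \<in> \<mm>" "\<not> D (r \<odot>\<^bsub>M\<^esub> x0)" "r \<odot>\<^bsub>M\<^esub> x0 \<in> carrier M" using step[OF x0] by blast
    obtain s where s: "s \<in> \<mm>" "\<not> D (s \<odot>\<^bsub>M\<^esub> (r \<odot>\<^bsub>M\<^esub> x0))" "s \<odot>\<^bsub>M\<^esub> (r \<odot>\<^bsub>M\<^esub> x0) \<in> carrier M"
      using step[OF r(3,2)] by blast
    obtain t where t: "t \<in> \<mm>" "\<not> D (t \<odot>\<^bsub>M\<^esub> (s \<odot>\<^bsub>M\<^esub> (r \<odot>\<^bsub>M\<^esub> x0)))" using step[OF s(3,2)] by blast
    have c: "r \<in> carrier R" "s \<in> carrier R" "t \<in> carrier R" using r s t \<mm>_carrier by auto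
    have "t \<odot>\<^bsub>M\<^esub> (s \<odot>\<^bsub>M\<^esub> (r \<odot>\<^bsub>M\<^esub> x0)) = (t \<otimes> (s \<otimes> r)) \<odot>\<^bsub>M\<^esub> x0" using c x0 by (simp add: smult_assoc1)
    also have "\<dots> = \<zero>\<^bsub>M\<^esub>" using mult_\<mm>_\<mm>2[OF t(1) mult_\<mm>_\<mm>[OF s(1) r(1)]] x0 by simp
    finally show False using t(2) partial_homD(3)[OF G] unfolding D_def by metis
  qed
  then obtain x where x: "x \<in> carrier M" "\<not> D x" "\<And>r. r \<in> \<mm> \<Longrightarrow> D (r \<odot>\<^bsub>M\<^esub> x)" by blast
  define g where "g r = (SOME y. (r \<odot>\<^bsub>M\<^esub> x, y) \<in> G)" for r
  have g: "(r \<odot>\<^bsub>M\<^esub> x, g r) \<in> G" if "r \<in> \<mm>" for r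
    unfolding g_def by (rule someI_ex) (use x(3)[OF that] in \<open>simp add: D_def\<close>)
  have "\<exists>c\<in>carrier R. \<forall>r\<in>\<mm>. g r = r \<otimes> c"
  proof (rule linear_form_on_\<mm>[OF soc])
    show "g r \<in> carrier R" if "r \<in> \<mm>" for r using partial_homD(2)[OF G g[OF that]] .
    show "g (r \<oplus> s) = g r \<oplus> g s" if rs: "r \<in> \<mm>" "s \<in> \<mm>" for r s
    proof (rule partial_hom_unique[OF G])
      have c: "r \<in> carrier R" "s \<in> carrier R" using rs \<mm>_carrier by auto
      have "r \<oplus> s \<in> \<mm>" using submoduleD(3)[OF submodule_RR(1) rs] by simp
      then show "((r \<oplus> s) \<odot>\<^bsub>M\<^esub> x, g (r \<oplus> s)) \<in> G" by (rule g)
      show "((r \<oplus> s) \<odot>\<^bsub>M\<^esub> x, g r \<oplus> g s) \<in> G"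
        using partial_homD(4)[OF G g[OF rs(1)] g[OF rs(2)]] smult_l_distr[OF c x(1)] by simp
    qed
    show "g (r \<otimes> s) = r \<otimes> g s" if rs: "r \<in> carrier R" "s \<in> \<mm>" for r s
    proof (rule partial_hom_unique[OF G])
      have c: "s \<in> carrier R" using rs \<mm>_carrier by auto
      show "((r \<otimes> s) \<odot>\<^bsub>M\<^esub> x, g (r \<otimes> s)) \<in> G" using rs max.I_l_closed by (intro g) blast
      show "((r \<otimes> s) \<odot>\<^bsub>M\<^esub> x, r \<otimes> g s) \<in> G"
        using partial_homD(5)[OF G rs(1) g[OF rs(2)]] smult_assoc1[OF rs(1) c x(1)] by simp
    qed
  qed
  then obtain c where c: "c \<in> carrier R" "\<And>r. r \<in> \<mm> \<Longrightarrow> g r = r \<otimes> c" by blast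
  define H where "H = {(n \<oplus>\<^bsub>M\<^esub> a \<odot>\<^bsub>M\<^esub> x, y \<oplus> a \<otimes> c) | n y a. (n, y) \<in> G \<and> a \<in> carrier R}"
  have HI: "(n \<oplus>\<^bsub>M\<^esub> a \<odot>\<^bsub>M\<^esub> x, y \<oplus> a \<otimes> c) \<in> H" if "(n, y) \<in> G" "a \<in> carrier R" for n y a
    unfolding H_def using that by blast
  have "partial_hom H"
    unfolding partial_hom_def
  proof (intro conjI allI impI ballI)
    show "H \<subseteq> carrier M \<times> carrier R" using partial_homD(1,2)[OF G] x(1) c(1) by (auto simp: H_def)
    show "(\<zero>\<^bsub>M\<^esub>, \<zero>) \<in> H" using HI[OF partial_homD(3)[OF G], of \<zero>] x(1) c(1) by simp
  next
    fix u v u' v' assume "(u, v) \<in> H" "(u', v') \<in> H"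
    then obtain n y a n' y' a' where 1: "(n, y) \<in> G" "a \<in> carrier R" "u = n \<oplus>\<^bsub>M\<^esub> a \<odot>\<^bsub>M\<^esub> x" "v = y \<oplus> a \<otimes> c"
      and 2: "(n', y') \<in> G" "a' \<in> carrier R" "u' = n' \<oplus>\<^bsub>M\<^esub> a' \<odot>\<^bsub>M\<^esub> x" "v' = y' \<oplus> a' \<otimes> c"
      unfolding H_def by blast
    note cc = partial_homD(1,2)[OF G 1(1)] partial_homD(1,2)[OF G 2(1)]
    have "u \<oplus>\<^bsub>M\<^esub> u' = (n \<oplus>\<^bsub>M\<^esub> n') \<oplus>\<^bsub>M\<^esub> (a \<oplus> a') \<odot>\<^bsub>M\<^esub> x"
      using 1 2 cc x(1) by (simp add: smult_l_distr M.add.m_ac)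
    moreover have "v \<oplus> v' = (y \<oplus> y') \<oplus> (a \<oplus> a') \<otimes> c" using 1(2,4) 2(2,4) cc c(1) by algebra
    ultimately show "(u \<oplus>\<^bsub>M\<^esub> u', v \<oplus> v') \<in> H"
      using HI[OF partial_homD(4)[OF G 1(1) 2(1)], of "a \<oplus> a'"] 1(2) 2(2) by simp
  next
    fix r u v assume r: "r \<in> carrier R" and "(u, v) \<in> H"
    then obtain n y a where 1: "(n, y) \<in> G" "a \<in> carrier R" "u = n \<oplus>\<^bsub>M\<^esub> a \<odot>\<^bsub>M\<^esub> x" "v = y \<oplus> a \<otimes> c"
      unfolding H_def by blast
    note cc = partial_homD(1,2)[OF G 1(1)]
    have "r \<odot>\<^bsub>M\<^esub> u = r \<odot>\<^bsub>M\<^esub> n \<oplus>\<^bsub>M\<^esub> (r \<otimes> a) \<odot>\<^bsub>M\<^esub> x"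
      using 1 cc x(1) r by (simp add: smult_r_distr smult_assoc1)
    moreover have "r \<otimes> v = r \<otimes> y \<oplus> (r \<otimes> a) \<otimes> c" using 1(2,4) cc c(1) r by algebra
    ultimately show "(r \<odot>\<^bsub>M\<^esub> u, r \<otimes> v) \<in> H"
      using HI[OF partial_homD(5)[OF G r 1(1)], of "r \<otimes> a"] 1(2) r by simp
  next
    fix v assume "(\<zero>\<^bsub>M\<^esub>, v) \<in> H"
    then obtain n y a where 1: "(n, y) \<in> G" "a \<in> carrier R" "\<zero>\<^bsub>M\<^esub> = n \<oplus>\<^bsub>M\<^esub> a \<odot>\<^bsub>M\<^esub> x" "v = y \<oplus> a \<otimes> c"
      unfolding H_def by blast
    note cc = partial_homD(1,2)[OF G 1(1)]
    have "a \<in> \<mm>"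
    proof (rule ccontr)
      assume "a \<notin> \<mm>"
      then obtain w where w: "w \<in> carrier R" "w \<otimes> a = \<one>" using unit_if_not_mem[OF 1(2)] by blast
      have "a \<odot>\<^bsub>M\<^esub> x = \<ominus>\<^bsub>M\<^esub> n" using 1(2,3) cc x(1) M.minus_equality[of "a \<odot>\<^bsub>M\<^esub> x" n] by (simp add: M.add.m_comm)
      also have "\<dots> = \<ominus> \<one> \<odot>\<^bsub>M\<^esub> n" using cc by (simp add: smult_l_minus)
      finally have "a \<odot>\<^bsub>M\<^esub> x = \<ominus> \<one> \<odot>\<^bsub>M\<^esub> n" .
      moreover have "x = w \<odot>\<^bsub>M\<^esub> (a \<odot>\<^bsub>M\<^esub> x)" using w 1(2) x(1) by (simp flip: smult_assoc1)
      ultimately have "x = w \<odot>\<^bsub>M\<^esub> (\<ominus> \<one> \<odot>\<^bsub>M\<^esub> n)" by simp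
      moreover have "(w \<odot>\<^bsub>M\<^esub> (\<ominus> \<one> \<odot>\<^bsub>M\<^esub> n), w \<otimes> (\<ominus> \<one> \<otimes> y)) \<in> G"
        using w(1) 1(1) by (intro partial_homD(5)[OF G]) auto
      ultimately have "D x" unfolding D_def by metis
      then show False using x(2) by blast
    qed
    then have "(a \<odot>\<^bsub>M\<^esub> x, a \<otimes> c) \<in> G" using g c(2) by metis
    then have "(\<zero>\<^bsub>M\<^esub>, v) \<in> G" unfolding 1(3,4) by (rule partial_homD(4)[OF G 1(1)])
    then show "v = \<zero>" by (rule partial_homD(6)[OF G])
  qed
  moreover have "G \<subseteq> H"
  proof (rule subrelI)
    fix n y assume ny: "(n, y) \<in> G"
    then show "(n, y) \<in> H" using HI[OF ny, of \<zero>] partial_homD(1,2)[OF G ny] x(1) c(1) by simp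
  qed
  ultimately have "H = G" by (rule max)
  moreover have "(x, c) \<in> H" using HI[OF partial_homD(3)[OF G], of \<one>] x(1) c(1) by simp
  ultimately show False using x(2) unfolding D_def by blast
qed

lemma extend_hom:
  assumes soc: simple_socle and N: "submodule R N M"
    and fc: "\<And>x. x \<in> N \<Longrightarrow> f x \<in> carrier R"
    and fadd: "\<And>x y. x \<in> N \<Longrightarrow> y \<in> N \<Longrightarrow> f (x \<oplus>\<^bsub>M\<^esub> y) = f x \<oplus> f y"
    and fmult: "\<And>r x. r \<in> carrier R \<Longrightarrow> x \<in> N \<Longrightarrow> f (r \<odot>\<^bsub>M\<^esub> x) = r \<otimes> f x"
  shows "\<exists>g \<in> LinearCombinations.module_hom R M RR. \<forall>x\<in>N. g x = f x"
proof -
  let ?f = "{(x, f x) | x. x \<in> N}"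
  let ?\<A> = "{G. partial_hom G \<and> ?f \<subseteq> G}"
  have f0: "f \<zero>\<^bsub>M\<^esub> = \<zero>"
    using fmult[of \<zero> "\<zero>\<^bsub>M\<^esub>"] fc submoduleD(4)[OF N] by simp
  have "partial_hom ?f"
    unfolding partial_hom_def using submoduleD(2-5)[OF N] fc fadd fmult f0 by auto
  then have ne: "?\<A> \<noteq> {}" by blast
  have "\<exists>G\<in>?\<A>. \<forall>H\<in>?\<A>. G \<subseteq> H \<longrightarrow> H = G"
  proof (rule subset_Zorn_nonempty[OF ne])
    fix \<C> assume C: "\<C> \<noteq> {}" "subset.chain ?\<A> \<C>"
    have ph: "partial_hom G" "?f \<subseteq> G" if "G \<in> \<C>" for G using C(2) that unfolding subset.chain_def by auto
    have two: "\<exists>G\<in>\<C>. p \<in> G \<and> q \<in> G" if pq: "p \<in> \<Union>\<C>" "q \<in> \<Union>\<C>" for p q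
    proof -
      obtain G H where GH: "G \<in> \<C>" "p \<in> G" "H \<in> \<C>" "q \<in> H" using pq by blast
      then have "G \<subseteq> H \<or> H \<subseteq> G" using C(2) unfolding subset_chain_def by blast
      then show ?thesis using GH by blast
    qed
    have "partial_hom (\<Union>\<C>)"
      unfolding partial_hom_def
    proof (intro conjI allI impI ballI)
      show "\<Union>\<C> \<subseteq> carrier M \<times> carrier R" using ph(1) unfolding partial_hom_def by blast
      show "(\<zero>\<^bsub>M\<^esub>, \<zero>) \<in> \<Union>\<C>" using C(1) partial_homD(3)[OF ph(1)] by blast
      show "(x \<oplus>\<^bsub>M\<^esub> x', y \<oplus> y') \<in> \<Union>\<C>" if xy: "(x, y) \<in> \<Union>\<C>" "(x', y') \<in> \<Union>\<C>" for x y x' y'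
      proof -
        obtain G where "G \<in> \<C>" "(x, y) \<in> G" "(x', y') \<in> G" using two[OF xy] by blast
        then show ?thesis using partial_homD(4)[OF ph(1)[of G], of x y x' y'] by blast
      qed
      show "(r \<odot>\<^bsub>M\<^esub> x, r \<otimes> y) \<in> \<Union>\<C>" if r: "r \<in> carrier R" and xy: "(x, y) \<in> \<Union>\<C>" for r x y
      proof -
        obtain G where "G \<in> \<C>" "(x, y) \<in> G" using xy by blast
        then show ?thesis using partial_homD(5)[OF ph(1)[of G] r, of x y] by blast
      qed
      show "y = \<zero>" if "(\<zero>\<^bsub>M\<^esub>, y) \<in> \<Union>\<C>" for y using that partial_homD(6)[OF ph(1)] by blast
    qed
    then show "\<Union>\<C> \<in> ?\<A>" using C(1) ph(2) by blast
  qed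
  then obtain G where G0: "G \<in> ?\<A>" "\<forall>H\<in>?\<A>. G \<subseteq> H \<longrightarrow> H = G" by (rule bexE)
  then have G: "partial_hom G" "?f \<subseteq> G" "\<And>H. partial_hom H \<Longrightarrow> ?f \<subseteq> H \<Longrightarrow> G \<subseteq> H \<Longrightarrow> H = G" by auto
  have "\<forall>x\<in>carrier M. \<exists>y. (x, y) \<in> G"
  proof (rule partial_hom_total_if_maximal[OF soc G(1)])
    show "H = G" if "partial_hom H" "G \<subseteq> H" for H using G(2) that by (intro G(3)) auto
  qed
  then obtain g where g: "\<And>x. x \<in> carrier M \<Longrightarrow> (x, g x) \<in> G" by metis
  have "g \<in> LinearCombinations.module_hom R M RR"
    unfolding LinearCombinations.module_hom_def
  proof (safe, simp_all)
    show "g x \<in> carrier R" if "x \<in> carrier M" for x using partial_homD(2)[OF G(1) g[OF that]] .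
    show "g (x \<oplus>\<^bsub>M\<^esub> y) = g x \<oplus> g y" if "x \<in> carrier M" "y \<in> carrier M" for x y
      using partial_hom_unique[OF G(1) g[of "x \<oplus>\<^bsub>M\<^esub> y"] partial_homD(4)[OF G(1) g[OF that(1)] g[OF that(2)]]] that by simp
    show "g (r \<odot>\<^bsub>M\<^esub> x) = r \<otimes> g x" if "r \<in> carrier R" "x \<in> carrier M" for r x
      using partial_hom_unique[OF G(1) g[of "r \<odot>\<^bsub>M\<^esub> x"] partial_homD(5)[OF G(1) that(1) g[OF that(2)]]] that by simp
  qed
  moreover have "g x = f x" if x: "x \<in> N" for x
  proof (rule partial_hom_unique[OF G(1)])
    show "(x, g x) \<in> G" using x submoduleD(2)[OF N] g by blast
    show "(x, f x) \<in> G" using x G(2) by blast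
  qed
  ultimately show ?thesis by blast
qed

end

context cube_zero_local_ring begin

text \<open>
  An isomorphic copy of an ideal, as constant functions: the definition of injective dimension asks for
  modules with elements of this type. The resolution \<open>0 \<rightarrow> R \<rightarrow> R \<rightarrow> 0\<close> uses the copies of \<open>R\<close> and of \<open>0\<close>.
\<close>
definition const_copy :: "'a set \<Rightarrow> ('a, nat \<Rightarrow> 'a) module" where
  "const_copy C = \<lparr>carrier = (\<lambda>x _. x) ` C, monoid.mult = (\<lambda>f g. f), one = (\<lambda>_. \<zero>), zero = (\<lambda>_. \<zero>),
     add = (\<lambda>f g _. f 0 \<oplus> g 0), smult = (\<lambda>r f _. r \<otimes> f 0)\<rparr>"

lemma module_const_copy:
  assumes C: "submodule R C RR" shows "Module.module R (const_copy C)"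
proof -
  have c: "C \<subseteq> carrier R" using submoduleD(2)[OF C] by simp
  have cl: "x \<oplus> y \<in> C" if "x \<in> C" "y \<in> C" for x y using submoduleD(3)[OF C that] by simp
  have ml: "r \<otimes> y \<in> C" if "r \<in> carrier R" "y \<in> C" for r y using submoduleD(5)[OF C that] by simp
  have z: "\<zero> \<in> C" using submoduleD(4)[OF C] by simp
  have neg: "\<exists>y\<in>C. y \<oplus> x = \<zero>" if x: "x \<in> C" for x
  proof (rule bexI[of _ "\<ominus> \<one> \<otimes> x"])
    show "\<ominus> \<one> \<otimes> x \<oplus> x = \<zero>" using x c by (simp add: l_minus l_neg subset_iff)
  qed (use ml x in simp)
  have "abelian_group (const_copy C)"
  proof (rule abelian_groupI)
    fix f assume "f \<in> carrier (const_copy C)"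
    then obtain x where x: "x \<in> C" "f = (\<lambda>_. x)" by (auto simp: const_copy_def)
    then obtain y where "y \<in> C" "y \<oplus> x = \<zero>" using neg by blast
    then show "\<exists>g\<in>carrier (const_copy C). g \<oplus>\<^bsub>const_copy C\<^esub> f = \<zero>\<^bsub>const_copy C\<^esub>"
      using x by (intro bexI[of _ "\<lambda>_. y"]) (auto simp: const_copy_def)
  qed (use c cl z in \<open>auto simp: const_copy_def subset_iff a_assoc intro: a_comm\<close>)
  then show ?thesis
    using c ml by (intro moduleI) (auto simp: const_copy_def subset_iff is_cring l_distr r_distr m_assoc)
qed

lemma injective_const_copy:
  assumes soc: simple_socle shows "injective_module R (const_copy (carrier R))"
  unfolding injective_module_def
proof (intro conjI allI impI)
  show "Module.module R (const_copy (carrier R))" using module_const_copy[OF submodule_RR(3)] .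
  fix M :: "('a, nat \<Rightarrow> 'a) module" and N f
  let ?E = "const_copy (carrier R)"
  assume *: "Module.module R M \<and> submodule R N M \<and> f \<in> LinearCombinations.module_hom R (M\<lparr>carrier := N\<rparr>) ?E"
  then have N: "submodule R N M" and f: "f \<in> LinearCombinations.module_hom R (M\<lparr>carrier := N\<rparr>) ?E" by auto
  have M: "cube_zero_module R \<mm> M" using * cube_zero_local_ring_axioms by (simp add: cube_zero_module_def)
  have fE: "f x \<in> carrier ?E" if "x \<in> N" for x using f that unfolding LinearCombinations.module_hom_def by auto
  have f1: "f (x \<oplus>\<^bsub>M\<^esub> y) = f x \<oplus>\<^bsub>?E\<^esub> f y" if "x \<in> N" "y \<in> N" for x y
    using f that unfolding LinearCombinations.module_hom_def by auto
  have f2: "f (r \<odot>\<^bsub>M\<^esub> x) = r \<odot>\<^bsub>?E\<^esub> f x" if "r \<in> carrier R" "x \<in> N" for r x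
    using f that unfolding LinearCombinations.module_hom_def by auto
  have "\<exists>g \<in> LinearCombinations.module_hom R M RR. \<forall>x\<in>N. g x = f x 0"
  proof (rule cube_zero_module.extend_hom[OF M soc N])
    show "f x 0 \<in> carrier R" if "x \<in> N" for x using fE[OF that] by (auto simp: const_copy_def)
    show "f (x \<oplus>\<^bsub>M\<^esub> y) 0 = f x 0 \<oplus> f y 0" if "x \<in> N" "y \<in> N" for x y
      using f1[OF that] by (simp add: const_copy_def)
    show "f (r \<odot>\<^bsub>M\<^esub> x) 0 = r \<otimes> f x 0" if "r \<in> carrier R" "x \<in> N" for r x
      using f2[OF that] by (simp add: const_copy_def)
  qed
  then obtain g where g: "g \<in> LinearCombinations.module_hom R M RR" "\<And>x. x \<in> N \<Longrightarrow> g x = f x 0" by blast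
  have "(\<lambda>x _. g x) \<in> LinearCombinations.module_hom R M ?E"
    using g(1) unfolding LinearCombinations.module_hom_def by (auto simp: const_copy_def)
  moreover have "(\<lambda>_. g x) = f x" if "x \<in> N" for x
    using fE[OF that] g(2)[OF that] by (auto simp: const_copy_def)
  ultimately show "\<exists>g\<in>LinearCombinations.module_hom R M ?E. \<forall>x\<in>N. g x = f x"
    by (intro bexI[of _ "\<lambda>x _. g x"]) auto
qed

lemma gorenstein_if_simple_socle:
  assumes soc: simple_socle shows "gorenstein R"
proof -
  define E where "E j = const_copy (if j = (0::nat) then carrier R else {\<zero>})" for j
  show ?thesis
    unfolding gorenstein_def finite_injective_dimension_def
  proof (intro exI[of _ "0::nat"] exI[of _ E] exI[of _ "\<lambda>x _. x"] exI[of _ "\<lambda>j f _. \<zero>"] conjI allI impI)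
    show "injective_module R (E j)" if "j \<le> 0" for j using injective_const_copy[OF soc] that by (simp add: E_def)
    show "Module.module R (E (Suc 0))" using module_const_copy[OF submodule_RR(4)] by (simp add: E_def)
    show "carrier (E (Suc 0)) = {\<zero>\<^bsub>E (Suc 0)\<^esub>}" by (simp add: E_def const_copy_def)
    show "(\<lambda>x _. x) \<in> LinearCombinations.module_hom R RR (E 0)"
      by (auto simp: LinearCombinations.module_hom_def E_def const_copy_def)
    show "inj_on (\<lambda>x _. x) (carrier RR)" by (auto intro!: inj_onI dest: fun_cong)
    show "(\<lambda>f _. \<zero>) \<in> LinearCombinations.module_hom R (E j) (E (Suc j))" for j
      by (auto simp: LinearCombinations.module_hom_def E_def const_copy_def)
    show "(\<lambda>x _. x) ` carrier RR = a_kernel (E 0) (E 1) (\<lambda>f _. \<zero>)"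
      unfolding a_kernel_def' by (auto simp: E_def const_copy_def)
  qed simp
qed

end

section \<open>Quotient modules\<close>

lemma mem_coset_iff: "y \<in> N +>\<^bsub>M\<^esub> x \<longleftrightarrow> (\<exists>n\<in>N. y = n \<oplus>\<^bsub>M\<^esub> x)"
  by (auto simp: a_r_coset_def')

context Module.module begin

lemma coset_eqI:
  assumes N: "submodule R N M" and "x \<in> carrier M" "n \<in> N"
  shows "N +>\<^bsub>M\<^esub> (n \<oplus>\<^bsub>M\<^esub> x) = N +>\<^bsub>M\<^esub> x"
proof (intro equalityI subsetI)
  have nc: "n \<in> carrier M" using assms submoduleD(2) by blast
  {
    fix y assume "y \<in> N +>\<^bsub>M\<^esub> (n \<oplus>\<^bsub>M\<^esub> x)"
    then obtain k where k: "k \<in> N" "y = k \<oplus>\<^bsub>M\<^esub> (n \<oplus>\<^bsub>M\<^esub> x)" unfolding mem_coset_iff by blast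
    have "k \<in> carrier M" using k N submoduleD(2) by blast
    then have "y = (k \<oplus>\<^bsub>M\<^esub> n) \<oplus>\<^bsub>M\<^esub> x" using k nc assms(2) by (simp add: M.add.m_assoc)
    then show "y \<in> N +>\<^bsub>M\<^esub> x" unfolding mem_coset_iff using submoduleD(3)[OF N k(1) assms(3)] by blast
  next
    fix y assume "y \<in> N +>\<^bsub>M\<^esub> x"
    then obtain k where k: "k \<in> N" "y = k \<oplus>\<^bsub>M\<^esub> x" unfolding mem_coset_iff by blast
    have kc: "k \<in> carrier M" using k N submoduleD(2) by blast
    have "y = (k \<ominus>\<^bsub>M\<^esub> n) \<oplus>\<^bsub>M\<^esub> (n \<oplus>\<^bsub>M\<^esub> x)" 
      using k(2) kc nc assms(2) M.add.m_assoc[of "\<ominus>\<^bsub>M\<^esub> n" n x] by (simp add: a_minus_def M.add.m_assoc M.l_neg)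
    then show "y \<in> N +>\<^bsub>M\<^esub> (n \<oplus>\<^bsub>M\<^esub> x)" unfolding mem_coset_iff using submodule_minus[OF N k(1) assms(3)] by blast
  }
qed

lemma coset_eq_iff:
  assumes N: "submodule R N M" and "x \<in> carrier M" "y \<in> carrier M"
  shows "N +>\<^bsub>M\<^esub> x = N +>\<^bsub>M\<^esub> y \<longleftrightarrow> (\<exists>n\<in>N. x = n \<oplus>\<^bsub>M\<^esub> y)"
proof
  assume "N +>\<^bsub>M\<^esub> x = N +>\<^bsub>M\<^esub> y"
  moreover have "\<zero>\<^bsub>M\<^esub> \<oplus>\<^bsub>M\<^esub> x \<in> N +>\<^bsub>M\<^esub> x" unfolding mem_coset_iff using submoduleD(4)[OF N] by blast
  ultimately have "x \<in> N +>\<^bsub>M\<^esub> y" using assms by simp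
  then show "\<exists>n\<in>N. x = n \<oplus>\<^bsub>M\<^esub> y" unfolding mem_coset_iff .
qed (use assms coset_eqI in blast)

lemma self_in_coset: "submodule R N M \<Longrightarrow> x \<in> carrier M \<Longrightarrow> x \<in> N +>\<^bsub>M\<^esub> x"
  unfolding mem_coset_iff by (rule bexI[of _ "\<zero>\<^bsub>M\<^esub>"]) (simp_all add: submoduleD(4))

lemma coset_zero: "submodule R N M \<Longrightarrow> x \<in> carrier M \<Longrightarrow> N +>\<^bsub>M\<^esub> x = N \<longleftrightarrow> x \<in> N"
proof -
  assume N: "submodule R N M" and x: "x \<in> carrier M"
  have c: "n \<in> carrier M" if "n \<in> N" for n using that submoduleD(2)[OF N] by blast
  have "N +>\<^bsub>M\<^esub> \<zero>\<^bsub>M\<^esub> = N" unfolding a_r_coset_def' using c by simp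
  then have "N +>\<^bsub>M\<^esub> x = N \<longleftrightarrow> (\<exists>n\<in>N. x = n \<oplus>\<^bsub>M\<^esub> \<zero>\<^bsub>M\<^esub>)" using coset_eq_iff[OF N x M.zero_closed] by simp
  then show ?thesis using c by auto
qed

lemma coset_add:
  assumes N: "submodule R N M" and "x \<in> carrier M" "y \<in> carrier M"
  shows "(N +>\<^bsub>M\<^esub> x) <+>\<^bsub>M\<^esub> (N +>\<^bsub>M\<^esub> y) = N +>\<^bsub>M\<^esub> (x \<oplus>\<^bsub>M\<^esub> y)"
proof (intro equalityI subsetI)
  have c: "n \<in> carrier M" if "n \<in> N" for n using that submoduleD(2)[OF N] by blast
  {
    fix z assume "z \<in> (N +>\<^bsub>M\<^esub> x) <+>\<^bsub>M\<^esub> (N +>\<^bsub>M\<^esub> y)"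
    then obtain n k where nk: "n \<in> N" "k \<in> N" "z = (n \<oplus>\<^bsub>M\<^esub> x) \<oplus>\<^bsub>M\<^esub> (k \<oplus>\<^bsub>M\<^esub> y)"
      by (auto elim!: set_addE simp: mem_coset_iff)
    then have "z = (n \<oplus>\<^bsub>M\<^esub> k) \<oplus>\<^bsub>M\<^esub> (x \<oplus>\<^bsub>M\<^esub> y)" using c assms(2,3) by (simp add: M.add.m_ac)
    then show "z \<in> N +>\<^bsub>M\<^esub> (x \<oplus>\<^bsub>M\<^esub> y)" unfolding mem_coset_iff using submoduleD(3)[OF N nk(1,2)] by blast
  next
    fix z assume "z \<in> N +>\<^bsub>M\<^esub> (x \<oplus>\<^bsub>M\<^esub> y)"
    then obtain n where n: "n \<in> N" "z = n \<oplus>\<^bsub>M\<^esub> (x \<oplus>\<^bsub>M\<^esub> y)" unfolding mem_coset_iff by blast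
    then have "z = (n \<oplus>\<^bsub>M\<^esub> x) \<oplus>\<^bsub>M\<^esub> y" using c assms(2,3) by (simp add: M.add.m_assoc)
    moreover have "n \<oplus>\<^bsub>M\<^esub> x \<in> N +>\<^bsub>M\<^esub> x" unfolding mem_coset_iff using n by blast
    ultimately show "z \<in> (N +>\<^bsub>M\<^esub> x) <+>\<^bsub>M\<^esub> (N +>\<^bsub>M\<^esub> y)"
      using set_addI[OF _ self_in_coset[OF N assms(3)]] by metis
  }
qed

lemma coset_smult:
  assumes N: "submodule R N M" and "x \<in> carrier M" "r \<in> carrier R"
  shows "(\<Union>z\<in>N +>\<^bsub>M\<^esub> x. N +>\<^bsub>M\<^esub> (r \<odot>\<^bsub>M\<^esub> z)) = N +>\<^bsub>M\<^esub> (r \<odot>\<^bsub>M\<^esub> x)"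
proof -
  have "N +>\<^bsub>M\<^esub> (r \<odot>\<^bsub>M\<^esub> z) = N +>\<^bsub>M\<^esub> (r \<odot>\<^bsub>M\<^esub> x)" if z: "z \<in> N +>\<^bsub>M\<^esub> x" for z
  proof -
    obtain n where n: "n \<in> N" "z = n \<oplus>\<^bsub>M\<^esub> x" using z unfolding mem_coset_iff by blast
    have "n \<in> carrier M" using n submoduleD(2)[OF N] by blast
    then have "r \<odot>\<^bsub>M\<^esub> z = r \<odot>\<^bsub>M\<^esub> n \<oplus>\<^bsub>M\<^esub> r \<odot>\<^bsub>M\<^esub> x" using n assms by (simp add: smult_r_distr)
    then show ?thesis using coset_eqI[OF N _ submoduleD(5)[OF N assms(3) n(1)]] assms by simp
  qed
  then show ?thesis using self_in_coset[OF N assms(2)] by blast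
qed

lemma carrier_quotient_module: "carrier (quotient_module M N) = (\<lambda>x. N +>\<^bsub>M\<^esub> x) ` carrier M"
  by (auto simp: quotient_module_def A_RCOSETS_def')

lemma quotient_module_ops:
  assumes N: "submodule R N M"
  shows "\<zero>\<^bsub>quotient_module M N\<^esub> = N +>\<^bsub>M\<^esub> \<zero>\<^bsub>M\<^esub>" "\<zero>\<^bsub>quotient_module M N\<^esub> = N"
    "x \<in> carrier M \<Longrightarrow> y \<in> carrier M \<Longrightarrow>
      (N +>\<^bsub>M\<^esub> x) \<oplus>\<^bsub>quotient_module M N\<^esub> (N +>\<^bsub>M\<^esub> y) = N +>\<^bsub>M\<^esub> (x \<oplus>\<^bsub>M\<^esub> y)"
    "r \<in> carrier R \<Longrightarrow> x \<in> carrier M \<Longrightarrow> r \<odot>\<^bsub>quotient_module M N\<^esub> (N +>\<^bsub>M\<^esub> x) = N +>\<^bsub>M\<^esub> (r \<odot>\<^bsub>M\<^esub> x)"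
  using coset_add[OF N, of x y] coset_smult[OF N, of x r] coset_zero[OF N, of "\<zero>\<^bsub>M\<^esub>"] submoduleD(4)[OF N]
  by (simp_all add: quotient_module_def)

lemma module_quotient:
  assumes N: "submodule R N M" shows "Module.module R (quotient_module M N)"
proof -
  let ?Q = "quotient_module M N" and ?\<pi> = "\<lambda>x. N +>\<^bsub>M\<^esub> x"
  note ops = quotient_module_ops(1,3,4)[OF N]
  have cE: thesis if "X \<in> carrier ?Q" "\<And>x. x \<in> carrier M \<Longrightarrow> X = ?\<pi> x \<Longrightarrow> thesis" for X thesis
    using that unfolding carrier_quotient_module by blast
  have cI: "?\<pi> x \<in> carrier ?Q" if "x \<in> carrier M" for x using that unfolding carrier_quotient_module by blast
  have "abelian_group ?Q"
  proof (rule abelian_groupI)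
    fix X assume "X \<in> carrier ?Q"
    then obtain x where x: "x \<in> carrier M" "X = ?\<pi> x" by (rule cE)
    show "\<exists>Y\<in>carrier ?Q. Y \<oplus>\<^bsub>?Q\<^esub> X = \<zero>\<^bsub>?Q\<^esub>"
      using x cI[of "\<ominus>\<^bsub>M\<^esub> x"] by (intro bexI[of _ "?\<pi> (\<ominus>\<^bsub>M\<^esub> x)"]) (simp_all add: ops M.l_neg)
    show "\<zero>\<^bsub>?Q\<^esub> \<oplus>\<^bsub>?Q\<^esub> X = X" using x by (simp add: ops)
    fix Y assume "Y \<in> carrier ?Q"
    then obtain y where y: "y \<in> carrier M" "Y = ?\<pi> y" by (rule cE)
    show "X \<oplus>\<^bsub>?Q\<^esub> Y \<in> carrier ?Q" using x y cI[of "x \<oplus>\<^bsub>M\<^esub> y"] by (simp add: ops)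
    show "X \<oplus>\<^bsub>?Q\<^esub> Y = Y \<oplus>\<^bsub>?Q\<^esub> X" using x y by (simp add: ops M.add.m_comm)
    fix W assume "W \<in> carrier ?Q"
    then obtain w where w: "w \<in> carrier M" "W = ?\<pi> w" by (rule cE)
    show "X \<oplus>\<^bsub>?Q\<^esub> Y \<oplus>\<^bsub>?Q\<^esub> W = X \<oplus>\<^bsub>?Q\<^esub> (Y \<oplus>\<^bsub>?Q\<^esub> W)" using x y w by (simp add: ops M.add.m_assoc)
  next
    show "\<zero>\<^bsub>?Q\<^esub> \<in> carrier ?Q" using cI[of "\<zero>\<^bsub>M\<^esub>"] by (simp add: ops)
  qed
  then show ?thesis
  proof (intro moduleI R.is_cring)
    fix a X assume a: "a \<in> carrier R" and "X \<in> carrier ?Q"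
    then obtain x where x: "x \<in> carrier M" "X = ?\<pi> x" by (blast elim: cE)
    show "a \<odot>\<^bsub>?Q\<^esub> X \<in> carrier ?Q" using a x cI[of "a \<odot>\<^bsub>M\<^esub> x"] by (simp add: ops)
    fix c assume c: "c \<in> carrier R"
    show "(a \<oplus> c) \<odot>\<^bsub>?Q\<^esub> X = a \<odot>\<^bsub>?Q\<^esub> X \<oplus>\<^bsub>?Q\<^esub> c \<odot>\<^bsub>?Q\<^esub> X" using a c x by (simp add: ops smult_l_distr)
    show "(a \<otimes> c) \<odot>\<^bsub>?Q\<^esub> X = a \<odot>\<^bsub>?Q\<^esub> (c \<odot>\<^bsub>?Q\<^esub> X)" using a c x by (simp add: ops smult_assoc1)
  next
    fix a X Y assume a: "a \<in> carrier R" and X: "X \<in> carrier ?Q" and Y: "Y \<in> carrier ?Q"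
    from X obtain x where x: "x \<in> carrier M" "X = ?\<pi> x" by (rule cE)
    from Y obtain y where y: "y \<in> carrier M" "Y = ?\<pi> y" by (rule cE)
    show "a \<odot>\<^bsub>?Q\<^esub> (X \<oplus>\<^bsub>?Q\<^esub> Y) = a \<odot>\<^bsub>?Q\<^esub> X \<oplus>\<^bsub>?Q\<^esub> a \<odot>\<^bsub>?Q\<^esub> Y" using a x y by (simp add: ops smult_r_distr)
  next
    fix X assume X: "X \<in> carrier ?Q"
    from X obtain x where x: "x \<in> carrier M" "X = ?\<pi> x" by (rule cE)
    show "\<one> \<odot>\<^bsub>?Q\<^esub> X = X" using x by (simp add: ops)
  qed
qed

lemma mod_hom_quotient:
  assumes N: "submodule R N M" shows "mod_hom R M (quotient_module M N) (\<lambda>x. N +>\<^bsub>M\<^esub> x)"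
  unfolding mod_hom_def mod_hom_axioms_def LinearCombinations.module_hom_def
  using module_axioms module_quotient[OF N]
  by (auto simp: quotient_module_ops[OF N] carrier_quotient_module)

lemma submodule_sum_eq_set_add: "submodule_sum U W = U <+>\<^bsub>M\<^esub> W"
  by (rule Set.set_eqI) (auto simp: submodule_sum_def mem_set_add_iff image_iff)

lemma module_length_eq_ilen: "module_length R M = ilen R M {\<zero>\<^bsub>M\<^esub>} (carrier M)"
proof -
  have "submodule R U M \<longleftrightarrow> submodule R U M \<and> {\<zero>\<^bsub>M\<^esub>} \<subseteq> U \<and> U \<subseteq> carrier M" for U
    using submoduleD(2,4)[of R U M] by auto
  then show ?thesis unfolding module_length_def ilen_def submodule_chain_def by simp
qed

lemma module_length_quotient:
  assumes N: "submodule R N M" shows "module_length R (quotient_module M N) = ilen R M N (carrier M)"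
proof -
  interpret q: mod_hom R M "quotient_module M N" "\<lambda>x. N +>\<^bsub>M\<^esub> x" by (rule mod_hom_quotient[OF N])
  have "carrier M \<inter> (\<lambda>x. N +>\<^bsub>M\<^esub> x) -` {\<zero>\<^bsub>quotient_module M N\<^esub>} = N"
    using coset_zero[OF N] submoduleD(2)[OF N] by (auto simp: quotient_module_ops(2)[OF N])
  then show ?thesis using q.ilen_image[OF submodule_carrier] q.N.module_length_eq_ilen
    by (simp add: carrier_quotient_module)
qed

end

section \<open>Direct summands isomorphic to the residue field\<close>

context cube_zero_module begin

text \<open>
  The generator of the summand \<open>N \<cong> k\<close> is not in \<open>\<mm>M\<close>, because \<open>\<mm>M = \<mm>N + \<mm>L = \<mm>L \<subseteq> L\<close> meets \<open>N\<close> trivially.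
\<close>
lemma residue_summand_imp:
  assumes "is_direct_summand R (residue_module R \<mm>) M"
  shows "\<exists>y\<in>carrier M. y \<notin> mS (carrier M) \<and> (\<forall>r\<in>\<mm>. r \<odot>\<^bsub>M\<^esub> y = \<zero>\<^bsub>M\<^esub>)"
proof -
  let ?k = "quotient_module RR \<mm>"
  let ?\<pi> = "\<lambda>x. \<mm> +>\<^bsub>RR\<^esub> x"
  obtain N L f where NL: "submodule R N M" "submodule R L M" "N \<inter> L = {\<zero>\<^bsub>M\<^esub>}"
    and sum: "submodule_sum N L = carrier M"
    and f: "f \<in> LinearCombinations.module_hom R ?k (M\<lparr>carrier := N\<rparr>)" "bij_betw f (carrier ?k) N"
    using assms unfolding is_direct_summand_def residue_module_def by blast
  have sum': "N <+>\<^bsub>M\<^esub> L = carrier M"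
    using sum by (simp add: submodule_sum_eq_set_add)
  note ops = RR.quotient_module_ops[OF submodule_RR(1), simplified]
  have fs: "f (r \<odot>\<^bsub>?k\<^esub> X) = r \<odot>\<^bsub>M\<^esub> f X" if "r \<in> carrier R" "X \<in> carrier ?k" for r X
    using f(1) that unfolding LinearCombinations.module_hom_def by auto
  have fN: "f X \<in> N" if "X \<in> carrier ?k" for X using f(2) that by (auto simp: bij_betw_def)
  have ck: "?\<pi> a \<in> carrier ?k" if "a \<in> carrier R" for a using that RR.carrier_quotient_module by auto
  have Nc: "x \<in> carrier M" if "x \<in> N" for x using that submoduleD(2)[OF NL(1)] by blast
  have z: "?\<pi> a = ?\<pi> \<zero>" if "a \<in> \<mm>" for a
    using that \<mm>_carrier RR.coset_zero[OF submodule_RR(1), of a] RR.coset_zero[OF submodule_RR(1), of \<zero>]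
      submoduleD(4)[OF submodule_RR(1)] by auto
  have f0: "f (?\<pi> \<zero>) = \<zero>\<^bsub>M\<^esub>"
  proof -
    have "f (\<zero> \<odot>\<^bsub>?k\<^esub> ?\<pi> \<zero>) = \<zero> \<odot>\<^bsub>M\<^esub> f (?\<pi> \<zero>)" using ck by (intro fs) auto
    then show ?thesis using fN[OF ck[of \<zero>]] Nc by (simp add: ops)
  qed
  have mN: "r \<odot>\<^bsub>M\<^esub> n = \<zero>\<^bsub>M\<^esub>" if r: "r \<in> \<mm>" and n: "n \<in> N" for r n
  proof -
    have "n \<in> f ` carrier ?k" using n f(2) by (simp add: bij_betw_def)
    then obtain a where a: "a \<in> carrier R" "n = f (?\<pi> a)" using RR.carrier_quotient_module by auto
    have rc: "r \<in> carrier R" using r \<mm>_carrier by blast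
    have "r \<odot>\<^bsub>M\<^esub> n = f (?\<pi> (r \<otimes> a))" using fs[OF rc ck[OF a(1)]] a rc by (simp add: ops)
    also have "?\<pi> (r \<otimes> a) = ?\<pi> \<zero>" using z[of "r \<otimes> a"] max.I_r_closed r a by blast
    finally show ?thesis using f0 by simp
  qed
  let ?y = "f (?\<pi> \<one>)"
  have yN: "?y \<in> N" using fN ck by simp
  have "?y \<notin> mS (carrier M)"
  proof
    assume y: "?y \<in> mS (carrier M)"
    have "mS (carrier M) \<subseteq> L"
    proof (rule scale_least[OF NL(2)])
      fix r x assume r: "r \<in> \<mm>" and "x \<in> carrier M"
      then obtain n l where nl: "n \<in> N" "l \<in> L" "x = n \<oplus>\<^bsub>M\<^esub> l" unfolding sum'[symmetric] by (auto elim!: set_addE)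
      have lc: "l \<in> carrier M" using nl submoduleD(2)[OF NL(2)] by blast
      have rc: "r \<in> carrier R" using r \<mm>_carrier by blast
      have "r \<odot>\<^bsub>M\<^esub> x = r \<odot>\<^bsub>M\<^esub> l" using nl lc Nc rc mN[OF r nl(1)] by (simp add: smult_r_distr)
      then show "r \<odot>\<^bsub>M\<^esub> x \<in> L" using submoduleD(5)[OF NL(2) rc nl(2)] by simp
    qed
    then have "?y = f (?\<pi> \<zero>)" using y yN NL(3) f0 by auto
    then have "?\<pi> \<one> = ?\<pi> \<zero>" using f(2) ck[of \<one>] ck[of \<zero>] by (auto simp: bij_betw_def inj_on_def)
    then have "?\<pi> \<one> = \<mm>" using RR.coset_zero[OF submodule_RR(1), of \<zero>] submoduleD(4)[OF submodule_RR(1)] by simp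
    then show False using RR.coset_zero[OF submodule_RR(1), of \<one>] one_not_in_\<mm> by simp
  qed
  then show ?thesis using yN Nc mN by blast
qed

lemma residue_summand_if:
  assumes y: "y \<in> carrier M" "y \<notin> mS (carrier M)" and my: "\<And>r. r \<in> \<mm> \<Longrightarrow> r \<odot>\<^bsub>M\<^esub> y = \<zero>\<^bsub>M\<^esub>"
    and fin: "ilen R M (mS (carrier M)) (carrier M) \<noteq> \<infinity>"
  shows "is_direct_summand R (residue_module R \<mm>) M"
proof -
  let ?k = "quotient_module RR \<mm>" and ?N = "cyclic_submodule R M y"
  let ?\<pi> = "\<lambda>x. \<mm> +>\<^bsub>RR\<^esub> x"
  note ops = RR.quotient_module_ops[OF submodule_RR(1), simplified]
  obtain L where L: "submodule R L M" "L \<inter> ?N = {\<zero>\<^bsub>M\<^esub>}" "L <+>\<^bsub>M\<^esub> ?N = carrier M"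
    using socle_element_splits[OF submodule_carrier y my fin] by auto
  have N: "submodule R ?N M" by (rule submodule_cyclic[OF y(1)])
  define f where "f X = (SOME a. a \<in> X) \<odot>\<^bsub>M\<^esub> y" for X
  have f: "f (?\<pi> a) = a \<odot>\<^bsub>M\<^esub> y" if a: "a \<in> carrier R" for a
  proof -
    have "a \<in> ?\<pi> a" using RR.self_in_coset[OF submodule_RR(1), of a] a by simp
    then have "(SOME b. b \<in> ?\<pi> a) \<in> ?\<pi> a" by (rule someI)
    then obtain n where n: "n \<in> \<mm>" "(SOME b. b \<in> ?\<pi> a) = n \<oplus> a" by (auto simp: mem_coset_iff)
    have "n \<in> carrier R" using n \<mm>_carrier by blast
    then show ?thesis unfolding f_def n(2) using a y(1) my[OF n(1)] by (simp add: smult_l_distr)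
  qed
  have ck: "carrier ?k = ?\<pi> ` carrier R" using RR.carrier_quotient_module by simp
  have "f \<in> LinearCombinations.module_hom R ?k (M\<lparr>carrier := ?N\<rparr>)"
    unfolding LinearCombinations.module_hom_def ck using y(1)
    by (auto simp: ops f smult_l_distr smult_assoc1 cyclic_submodule_def)
  moreover have "bij_betw f (carrier ?k) ?N"
    unfolding bij_betw_def
  proof
    show "f ` carrier ?k = ?N" unfolding ck using f by (force simp: cyclic_submodule_def image_def)
    show "inj_on f (carrier ?k)"
    proof (rule inj_onI)
      fix X Y assume "X \<in> carrier ?k" "Y \<in> carrier ?k" and eq: "f X = f Y"
      then obtain a c where ac: "a \<in> carrier R" "X = ?\<pi> a" "c \<in> carrier R" "Y = ?\<pi> c" unfolding ck by blast
      have "(a \<ominus> c) \<odot>\<^bsub>M\<^esub> y = \<zero>\<^bsub>M\<^esub>"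
        using eq ac f y(1) by (simp add: a_minus_def smult_l_distr smult_l_minus M.r_neg)
      have "a \<ominus> c \<in> \<mm>"
      proof (rule ccontr)
        assume "a \<ominus> c \<notin> \<mm>"
        moreover have acc: "a \<ominus> c \<in> carrier R" using ac by simp
        ultimately obtain v where v: "v \<in> carrier R" "v \<otimes> (a \<ominus> c) = \<one>" using unit_if_not_mem by blast
        have "y = (v \<otimes> (a \<ominus> c)) \<odot>\<^bsub>M\<^esub> y" using v y(1) by simp
        also have "\<dots> = v \<odot>\<^bsub>M\<^esub> ((a \<ominus> c) \<odot>\<^bsub>M\<^esub> y)" using v(1) acc y(1) by (rule smult_assoc1)
        finally have "y = \<zero>\<^bsub>M\<^esub>" using \<open>(a \<ominus> c) \<odot>\<^bsub>M\<^esub> y = \<zero>\<^bsub>M\<^esub>\<close> v(1) by simp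
        then show False using y(2) submoduleD(4)[OF submodule_mS[OF submodule_carrier]] by simp
      qed
      moreover have "a = (a \<ominus> c) \<oplus> c" using ac by algebra
      ultimately show "X = Y" using RR.coset_eq_iff[OF submodule_RR(1), of a c] ac by auto
    qed
  qed
  moreover have "submodule_sum ?N L = carrier M"
    using L(3) set_add_commute[OF L(1) N] by (simp add: submodule_sum_eq_set_add)
  moreover have "?N \<inter> L = {\<zero>\<^bsub>M\<^esub>}" using L(2) by blast
  ultimately show ?thesis
    unfolding is_direct_summand_def residue_module_def using N L(1) by blast
qed

end

context minimal_acyclic_complex begin

lemma coker_eq: "coker A d (i + 2) = quotient_module (A (i + 1)) (Z (i + 1))"
proof -
  have "i + 2 - 1 = i + 1" "i + 1 + 1 = i + 2" by simp_all
  then show ?thesis unfolding coker_def Z_def by (simp only:)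
qed

lemma module_length_coker: "module_length R (coker A d (i + 2)) = enat (b (i + 1) + z i)"
  unfolding coker_eq using A.module_length_quotient[OF submodule_Z] ilen_coker by simp

text \<open>
  Both sides are transported along \<open>A\<^sub>i\<^sub>+\<^sub>1 / Z\<^sub>i\<^sub>+\<^sub>1 \<cong> Z\<^sub>i\<close>: an element \<open>x\<close> of \<open>A\<^sub>i\<^sub>+\<^sub>1\<close> gives a generator of the cokernel killed by \<open>\<mm>\<close>
  exactly when its boundary is a socle generator of \<open>Z\<^sub>i\<close>.
\<close>
lemma residue_summand_iff: "is_direct_summand R (residue_module R \<mm>) (coker A d (i + 2)) \<longleftrightarrow> socle_gen i"
proof -
  let ?Q = "quotient_module (A (i + 1)) (Z (i + 1))" and ?\<pi> = "\<lambda>x. Z (i + 1) +>\<^bsub>A (i + 1)\<^esub> x"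
  interpret q: mod_hom R "A (i + 1)" ?Q ?\<pi> by (rule A.mod_hom_quotient[OF submodule_Z])
  interpret Q: cube_zero_module R \<mm> ?Q
    by (intro cube_zero_module.intro cube_zero_local_ring_axioms q.N.module_axioms)
  have cQ: "carrier ?Q = ?\<pi> ` carrier (A (i + 1))" by (rule A.carrier_quotient_module)
  have mQ: "Q.mS (carrier ?Q) = ?\<pi> ` mA (i + 1)"
    unfolding cQ using q.image_scale[OF \<mm>_carrier submodules(5)[of "i + 1"]] by simp
  have mem: "?\<pi> x \<in> Q.mS (carrier ?Q) \<longleftrightarrow> x \<in> mA (i + 1)" if x: "x \<in> carrier (A (i + 1))" for x
  proof
    assume "?\<pi> x \<in> Q.mS (carrier ?Q)"
    then obtain y where y: "y \<in> mA (i + 1)" "?\<pi> x = ?\<pi> y" unfolding mQ by blast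
    have "y \<in> carrier (A (i + 1))" using y submoduleD(2)[OF submodules(1)[of "i + 1"]] by blast
    then obtain n where "n \<in> Z (i + 1)" "x = n \<oplus>\<^bsub>A (i + 1)\<^esub> y"
      using A.coset_eq_iff[OF submodule_Z x] y(2) by blast
    then show "x \<in> mA (i + 1)" using y(1) Z_subset_mA[of "i + 1"] submoduleD(3)[OF submodules(1)[of "i + 1"]] by blast
  qed (unfold mQ, blast)
  have zero: "r \<odot>\<^bsub>?Q\<^esub> ?\<pi> x = \<zero>\<^bsub>?Q\<^esub> \<longleftrightarrow> r \<odot>\<^bsub>A i\<^esub> d (i + 1) x = \<zero>\<^bsub>A i\<^esub>"
    if "x \<in> carrier (A (i + 1))" "r \<in> carrier R" for x r
  proof -
    have c: "r \<odot>\<^bsub>A (i + 1)\<^esub> x \<in> carrier (A (i + 1))" by (rule A.smult_closed[OF that(2,1)])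
    have "r \<odot>\<^bsub>?Q\<^esub> ?\<pi> x = ?\<pi> (r \<odot>\<^bsub>A (i + 1)\<^esub> x)" by (rule A.quotient_module_ops(4)[OF submodule_Z that(2,1)])
    moreover have "\<zero>\<^bsub>?Q\<^esub> = Z (i + 1)" by (rule A.quotient_module_ops(2)[OF submodule_Z])
    moreover have "?\<pi> (r \<odot>\<^bsub>A (i + 1)\<^esub> x) = Z (i + 1) \<longleftrightarrow> r \<odot>\<^bsub>A (i + 1)\<^esub> x \<in> Z (i + 1)"
      by (rule A.coset_zero[OF submodule_Z c])
    moreover have "r \<odot>\<^bsub>A (i + 1)\<^esub> x \<in> Z (i + 1) \<longleftrightarrow> d (i + 1) (r \<odot>\<^bsub>A (i + 1)\<^esub> x) = \<zero>\<^bsub>A i\<^esub>"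
      using c kernel_eq_Z[of i] by blast
    moreover have "d (i + 1) (r \<odot>\<^bsub>A (i + 1)\<^esub> x) = r \<odot>\<^bsub>A i\<^esub> d (i + 1) x" by (rule d.f_smult[OF that(2,1)])
    ultimately show ?thesis by metis
  qed
  have memZ: "d (i + 1) x \<in> mZ i \<longleftrightarrow> x \<in> mA (i + 1)" if "x \<in> carrier (A (i + 1))" for x
    using vimage_mZ[of i] that by blast
  have "ilen R ?Q {\<zero>\<^bsub>?Q\<^esub>} (carrier ?Q) = enat (b (i + 1) + z i)"
    using module_length_coker[of i] q.N.module_length_eq_ilen unfolding coker_eq by simp
  moreover have "ilen R ?Q (Q.mS (carrier ?Q)) (carrier ?Q) \<le> ilen R ?Q {\<zero>\<^bsub>?Q\<^esub>} (carrier ?Q)"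
    using submoduleD(4)[OF Q.submodule_mS[OF q.N.submodule_carrier]] by (intro ilen_mono) auto
  ultimately have fin: "ilen R ?Q (Q.mS (carrier ?Q)) (carrier ?Q) \<noteq> \<infinity>" by (auto dest: enat_ile)
  show ?thesis
  proof
    assume "is_direct_summand R (residue_module R \<mm>) (coker A d (i + 2))"
    then obtain X where X: "X \<in> carrier ?Q" "X \<notin> Q.mS (carrier ?Q)" "\<And>r. r \<in> \<mm> \<Longrightarrow> r \<odot>\<^bsub>?Q\<^esub> X = \<zero>\<^bsub>?Q\<^esub>"
      using Q.residue_summand_imp unfolding coker_eq by blast
    then obtain x where x: "x \<in> carrier (A (i + 1))" "X = ?\<pi> x" unfolding cQ by blast
    show "socle_gen i"
      unfolding socle_gen_def
    proof (intro bexI[of _ "d (i + 1) x"] conjI ballI)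
      show "d (i + 1) x \<in> Z i" using x(1) unfolding Z_def by blast
      show "d (i + 1) x \<notin> mZ i" using memZ[OF x(1)] mem[OF x(1)] X(2) x(2) by blast
      show "r \<odot>\<^bsub>A i\<^esub> d (i + 1) x = \<zero>\<^bsub>A i\<^esub>" if "r \<in> \<mm>" for r
        using zero[OF x(1), of r] X(3)[OF that] that \<mm>_carrier x(2) by blast
    qed
  next
    assume "socle_gen i"
    then obtain y where y: "y \<in> Z i" "y \<notin> mZ i" "\<And>r. r \<in> \<mm> \<Longrightarrow> r \<odot>\<^bsub>A i\<^esub> y = \<zero>\<^bsub>A i\<^esub>"
      unfolding socle_gen_def by blast
    then obtain x where x: "x \<in> carrier (A (i + 1))" "y = d (i + 1) x" unfolding Z_def by blast
    show "is_direct_summand R (residue_module R \<mm>) (coker A d (i + 2))"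
      unfolding coker_eq
    proof (rule Q.residue_summand_if[OF _ _ _ fin])
      show "?\<pi> x \<in> carrier ?Q" using x(1) unfolding cQ by blast
      show "?\<pi> x \<notin> Q.mS (carrier ?Q)" using mem[OF x(1)] memZ[OF x(1)] y(2) x(2) by blast
      show "r \<odot>\<^bsub>?Q\<^esub> ?\<pi> x = \<zero>\<^bsub>?Q\<^esub>" if "r \<in> \<mm>" for r
        using zero[OF x(1), of r] y(3)[OF that] x(2) that \<mm>_carrier by blast
    qed
  qed
qed

end

section \<open>The cotangent space\<close>

context cube_zero_local_ring begin

text \<open>
  Cosets are taken in the ring as a module over itself, where the calculus of quotient modules applies; as
  sets they agree with the cosets in the ring.
\<close>
abbreviation cot where "cot x \<equiv> \<mm>2 +>\<^bsub>RR\<^esub> x"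
abbreviation res where "res a \<equiv> \<mm> +>\<^bsub>RR\<^esub> a"
abbreviation V where "V \<equiv> cotangent_space R \<mm>"
abbreviation K where "K \<equiv> R Quot \<mm>"

lemma coset_RR: "N +>\<^bsub>RR\<^esub> x = N +>\<^bsub>R\<^esub> x"
  by (simp add: a_r_coset_def')

lemma cotangent_space_simps:
  "carrier V = cot ` \<mm>" "\<zero>\<^bsub>V\<^esub> = \<mm>2"
  "X \<oplus>\<^bsub>V\<^esub> Y = X <+>\<^bsub>RR\<^esub> Y" "smult V = rcoset_mult R \<mm>2"
  by (simp_all add: cotangent_space_def Let_def coset_RR set_add_def')

lemma cot_add: "x \<in> \<mm> \<Longrightarrow> y \<in> \<mm> \<Longrightarrow> cot x \<oplus>\<^bsub>V\<^esub> cot y = cot (x \<oplus> y)"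
  using RR.coset_add[OF submodule_RR(2), of x y] \<mm>_carrier
  by (auto simp: cotangent_space_simps)

lemma cot_zero: "\<zero>\<^bsub>V\<^esub> = cot \<zero>"
  using RR.coset_zero[OF submodule_RR(2), of \<zero>] submoduleD(4)[OF submodule_RR(2)]
  by (simp add: cotangent_space_simps)

lemma cot_smult:
  assumes a: "a \<in> carrier R" and x: "x \<in> \<mm>" shows "res a \<odot>\<^bsub>V\<^esub> cot x = cot (a \<otimes> x)"
proof -
  have xc: "x \<in> carrier R" using x \<mm>_carrier by blast
  have *: "\<mm>2 +>\<^bsub>R\<^esub> (a' \<otimes> x') = cot (a \<otimes> x)" if a': "a' \<in> res a" and x': "x' \<in> cot x" for a' x'
  proof -
    obtain n where n: "n \<in> \<mm>" "a' = n \<oplus> a" using a' by (auto simp: mem_coset_iff)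
    obtain t where t: "t \<in> \<mm>2" "x' = t \<oplus> x" using x' by (auto simp: mem_coset_iff)
    have c: "n \<in> carrier R" "t \<in> carrier R" using n t \<mm>_carrier \<mm>2_carrier by auto
    have "a' \<otimes> x' = (n \<otimes> t \<oplus> (n \<otimes> x \<oplus> a \<otimes> t)) \<oplus> a \<otimes> x" unfolding n(2) t(2) using c a xc by algebra
    moreover have "n \<otimes> t \<in> \<mm>2" "n \<otimes> x \<in> \<mm>2" "a \<otimes> t \<in> \<mm>2"
      using mult_\<mm>_\<mm>[OF n(1)] t(1) \<mm>2_subset x submoduleD(5)[OF submodule_RR(2) a t(1)] by auto
    then have "n \<otimes> t \<oplus> (n \<otimes> x \<oplus> a \<otimes> t) \<in> \<mm>2" using submoduleD(3)[OF submodule_RR(2)] by simp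
    ultimately show ?thesis using RR.coset_eqI[OF submodule_RR(2)] a xc by (simp add: coset_RR)
  qed
  have "a \<in> res a" "x \<in> cot x" using RR.self_in_coset[OF submodule_RR(1), of a] RR.self_in_coset[OF submodule_RR(2), of x] a xc by auto
  then show ?thesis unfolding cotangent_space_simps rcoset_mult_def using * by blast
qed

lemma residue_field_simps:
  "carrier K = res ` carrier R" "\<one>\<^bsub>K\<^esub> = res \<one>"
  "a \<in> carrier R \<Longrightarrow> c \<in> carrier R \<Longrightarrow> res a \<oplus>\<^bsub>K\<^esub> res c = res (a \<oplus> c)"
  "a \<in> carrier R \<Longrightarrow> c \<in> carrier R \<Longrightarrow> res a \<otimes>\<^bsub>K\<^esub> res c = res (a \<otimes> c)"
proof -
  show "carrier K = res ` carrier R" by (auto simp: FactRing_def A_RCOSETS_def' coset_RR)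
  show "\<one>\<^bsub>K\<^esub> = res \<one>" by (simp add: FactRing_def coset_RR)
  show "res a \<oplus>\<^bsub>K\<^esub> res c = res (a \<oplus> c)" if "a \<in> carrier R" "c \<in> carrier R"
    using RR.coset_add[OF submodule_RR(1), of a c] that by (simp add: FactRing_def set_add_def')
  show "res a \<otimes>\<^bsub>K\<^esub> res c = res (a \<otimes> c)" if "a \<in> carrier R" "c \<in> carrier R"
    using max.rcoset_mult_add that by (simp add: FactRing_def coset_RR)
qed

lemma vectorspace_cotangent: "vectorspace K V"
proof -
  have field: "field K" by (rule max.quotient_is_field[OF is_cring])
  have mc: "x \<in> carrier R" if "x \<in> \<mm>" for x using that \<mm>_carrier by blast
  have madd: "x \<oplus> y \<in> \<mm>" if "x \<in> \<mm>" "y \<in> \<mm>" for x y using submoduleD(3)[OF submodule_RR(1) that] by simp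
  have mmult: "a \<otimes> x \<in> \<mm>" if "a \<in> carrier R" "x \<in> \<mm>" for a x using submoduleD(5)[OF submodule_RR(1) that] by simp
  have zm: "\<zero> \<in> \<mm>" using submoduleD(4)[OF submodule_RR(1)] by simp
  have vE: thesis if "X \<in> carrier V" "\<And>x. x \<in> \<mm> \<Longrightarrow> X = cot x \<Longrightarrow> thesis" for X thesis
    using that unfolding cotangent_space_simps by blast
  have kE: thesis if "X \<in> carrier K" "\<And>a. a \<in> carrier R \<Longrightarrow> X = res a \<Longrightarrow> thesis" for X thesis
    using that unfolding residue_field_simps by blast
  have vI: "cot x \<in> carrier V" if "x \<in> \<mm>" for x using that unfolding cotangent_space_simps by blast
  have "abelian_group V"
  proof (rule abelian_groupI)
    fix X assume "X \<in> carrier V"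
    then obtain x where x: "x \<in> \<mm>" "X = cot x" by (rule vE)
    have neg: "\<ominus> \<one> \<otimes> x \<in> \<mm>" using x by (intro mmult) auto
    have "\<ominus> \<one> \<otimes> x \<oplus> x = \<zero>" using mc[OF x(1)] by (simp add: l_minus l_neg)
    then have "cot (\<ominus> \<one> \<otimes> x) \<oplus>\<^bsub>V\<^esub> X = \<zero>\<^bsub>V\<^esub>" using cot_add[OF neg x(1)] x(2) cot_zero by simp
    then show "\<exists>Y\<in>carrier V. Y \<oplus>\<^bsub>V\<^esub> X = \<zero>\<^bsub>V\<^esub>" using vI[OF neg] by blast
    show "\<zero>\<^bsub>V\<^esub> \<oplus>\<^bsub>V\<^esub> X = X" unfolding cot_zero x(2) cot_add[OF zm x(1)] using mc[OF x(1)] by simp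
    fix Y assume "Y \<in> carrier V"
    then obtain y where y: "y \<in> \<mm>" "Y = cot y" by (rule vE)
    show "X \<oplus>\<^bsub>V\<^esub> Y \<in> carrier V" using x y vI[OF madd] by (simp add: cot_add)
    show "X \<oplus>\<^bsub>V\<^esub> Y = Y \<oplus>\<^bsub>V\<^esub> X" using x y mc a_comm[of x y] by (simp add: cot_add)
    fix W assume "W \<in> carrier V"
    then obtain w where w: "w \<in> \<mm>" "W = cot w" by (rule vE)
    show "X \<oplus>\<^bsub>V\<^esub> Y \<oplus>\<^bsub>V\<^esub> W = X \<oplus>\<^bsub>V\<^esub> (Y \<oplus>\<^bsub>V\<^esub> W)"
      using x y w madd mc a_assoc[of x y w] by (simp add: cot_add)
  next
    show "\<zero>\<^bsub>V\<^esub> \<in> carrier V" using vI[OF zm] by (simp add: cot_zero)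
  qed
  then have "Module.module K V"
  proof (rule moduleI[rotated])
    show "cring K" using field by (simp add: field_def domain_def)
  next
    fix A X assume A: "A \<in> carrier K" and X: "X \<in> carrier V"
    from A obtain a where a: "a \<in> carrier R" "A = res a" by (rule kE)
    from X obtain x where x: "x \<in> \<mm>" "X = cot x" by (rule vE)
    show "A \<odot>\<^bsub>V\<^esub> X \<in> carrier V" using a x vI[OF mmult] by (simp add: cot_smult)
    fix C assume "C \<in> carrier K"
    then obtain c where c: "c \<in> carrier R" "C = res c" by (rule kE)
    show "(A \<oplus>\<^bsub>K\<^esub> C) \<odot>\<^bsub>V\<^esub> X = A \<odot>\<^bsub>V\<^esub> X \<oplus>\<^bsub>V\<^esub> C \<odot>\<^bsub>V\<^esub> X"
      using a c x mmult mc l_distr[of a c x] by (simp add: cot_smult cot_add residue_field_simps)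
    show "(A \<otimes>\<^bsub>K\<^esub> C) \<odot>\<^bsub>V\<^esub> X = A \<odot>\<^bsub>V\<^esub> (C \<odot>\<^bsub>V\<^esub> X)"
      using a c x mmult mc m_assoc[of a c x] by (simp add: cot_smult residue_field_simps)
  next
    fix A X Y assume A: "A \<in> carrier K" and X: "X \<in> carrier V" and Y: "Y \<in> carrier V"
    from A obtain a where a: "a \<in> carrier R" "A = res a" by (rule kE)
    from X obtain x where x: "x \<in> \<mm>" "X = cot x" by (rule vE)
    from Y obtain y where y: "y \<in> \<mm>" "Y = cot y" by (rule vE)
    show "A \<odot>\<^bsub>V\<^esub> (X \<oplus>\<^bsub>V\<^esub> Y) = A \<odot>\<^bsub>V\<^esub> X \<oplus>\<^bsub>V\<^esub> A \<odot>\<^bsub>V\<^esub> Y"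
      using a x y mmult madd mc r_distr[of x y a] by (simp add: cot_smult cot_add)
  next
    fix X assume "X \<in> carrier V"
    then obtain x where x: "x \<in> \<mm>" "X = cot x" by (rule vE)
    show "\<one>\<^bsub>K\<^esub> \<odot>\<^bsub>V\<^esub> X = X" using x mc by (simp add: cot_smult residue_field_simps)
  qed
  then show ?thesis using field by (simp add: vectorspace_def)
qed

text \<open>
  The dimension is the least size of a generating set. Generators of \<open>\<mm>\<close> modulo \<open>\<mm>\<^sup>2\<close> and generators of the vector space
  \<open>\<mm>/\<mm>\<^sup>2\<close> correspond to each other, and the least number of the former is the length of \<open>\<mm>/\<mm>\<^sup>2\<close>.
\<close>
lemma dim_cotangent: "vectorspace.dim K V = embdim"
proof -
  interpret V: vectorspace K V by (rule vectorspace_cotangent)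
  have c0: "cube_zero_module R \<mm> RR"
    by (intro cube_zero_module.intro cube_zero_local_ring_axioms module_ring_as_module)
  have gens: "\<exists>A. finite A \<and> card A \<le> n \<and> A \<subseteq> carrier V \<and> cot ` F \<subseteq> V.span A"
    if "generated R RR n F" "F \<subseteq> \<mm>" for n F
    using that
  proof (induction rule: generated.induct)
    case generated_0
    have "submodule K (V.span {}) V" by (rule V.span_is_submodule) simp
    then have "\<zero>\<^bsub>V\<^esub> \<in> V.span {}" by (rule submoduleD(4))
    then show ?case by (intro exI[of _ "{}"]) (simp add: cot_zero)
  next
    case (generated_Suc n F x)
    let ?C = "cyclic_submodule R RR x"
    have xc: "x \<in> carrier R" using generated_Suc.hyps by simp
    have F: "submodule R F RR" using RR.submodule_generated generated_Suc.hyps by blast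
    have C: "submodule R ?C RR" using RR.submodule_cyclic xc by simp
    have up: "F \<subseteq> F <+>\<^bsub>RR\<^esub> ?C" "?C \<subseteq> F <+>\<^bsub>RR\<^esub> ?C" using RR.set_add_upper[OF F C] by auto
    have x: "x \<in> \<mm>" and Fm: "F \<subseteq> \<mm>" using up RR.self_in_cyclic[of x] xc generated_Suc.prems by auto
    obtain A where A: "finite A" "card A \<le> n" "A \<subseteq> carrier V" "cot ` F \<subseteq> V.span A"
      using generated_Suc.IH[OF Fm] by blast
    let ?A = "insert (cot x) A"
    have Ac: "?A \<subseteq> carrier V" using A(3) x unfolding cotangent_space_simps by blast
    have sp: "submodule K (V.span ?A) V" by (rule V.span_is_submodule[OF Ac])
    have "cot z \<in> V.span ?A" if z: "z \<in> F <+>\<^bsub>RR\<^esub> ?C" for z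
    proof -
      obtain a r where ar: "a \<in> F" "r \<in> carrier R" "z = a \<oplus> r \<otimes> x"
        using z by (auto elim!: set_addE simp: cyclic_submodule_def)
      have am: "a \<in> \<mm>" and rx: "r \<otimes> x \<in> \<mm>" using ar Fm max.I_l_closed[OF x] by auto
      have "cot a \<in> V.span A" using ar(1) A(4) by blast
      then have 1: "cot a \<in> V.span ?A" using V.span_is_monotone[of A ?A] by blast
      have "cot x \<in> V.span ?A" using V.in_own_span[OF Ac] by blast
      moreover have "res r \<in> carrier K" using ar(2) unfolding residue_field_simps by blast
      ultimately have "res r \<odot>\<^bsub>V\<^esub> cot x \<in> V.span ?A" using submoduleD(5)[OF sp] by blast
      then have "cot a \<oplus>\<^bsub>V\<^esub> cot (r \<otimes> x) \<in> V.span ?A" using submoduleD(3)[OF sp 1] cot_smult[OF ar(2) x] by simp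
      then show ?thesis using cot_add[OF am rx] ar(3) by simp
    qed
    moreover have "card ?A \<le> Suc n" using A(1,2) by (simp add: card_insert_if)
    ultimately show ?case using A(1) Ac by (intro exI[of _ ?A]) auto
  qed
  have "scale R RR \<mm> \<mm> \<subseteq> \<mm>2" using scale_RR[OF ideal_\<mm> ideal_\<mm>] by simp
  from cube_zero_module.exists_generated[OF c0 submodule_RR(1,2) this \<mm>2_subset ilen_\<mm>2_\<mm>]
  obtain F where F: "generated R RR embdim F" "\<mm>2 <+>\<^bsub>RR\<^esub> F = \<mm>" by blast
  have sF: "submodule R F RR" using RR.submodule_generated F(1) by blast
  have Fm: "F \<subseteq> \<mm>" using RR.set_add_upper(2)[OF submodule_RR(2) sF] F(2) by simp
  have "carrier V \<subseteq> cot ` F"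
  proof
    fix X assume "X \<in> carrier V"
    then obtain x where x: "x \<in> \<mm>" "X = cot x" unfolding cotangent_space_simps by blast
    have "x \<in> \<mm>2 <+>\<^bsub>RR\<^esub> F" using x(1) F(2) by simp
    then obtain t f where tf: "t \<in> \<mm>2" "f \<in> F" "x = t \<oplus>\<^bsub>RR\<^esub> f" by (rule set_addE)
    have "f \<in> carrier RR" using tf(2) submoduleD(2)[OF sF] by blast
    then have "X = cot f" unfolding x(2) tf(3) using RR.coset_eqI[OF submodule_RR(2) _ tf(1)] by simp
    then show "X \<in> cot ` F" using tf(2) by blast
  qed
  moreover obtain A where A: "finite A" "card A \<le> embdim" "A \<subseteq> carrier V" "cot ` F \<subseteq> V.span A"
    using gens[OF F(1) Fm] by blast
  moreover have "V.span A \<subseteq> carrier V" using submoduleD(2)[OF V.span_is_submodule[OF A(3)]] .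
  ultimately have spanA: "V.span A = carrier V" by blast
  have lower: "embdim \<le> card B" if B: "finite B" "B \<subseteq> carrier V" "V.span B = carrier V" for B
  proof -
    have "\<forall>X\<in>B. \<exists>x. x \<in> \<mm> \<and> X = cot x" using B(2) unfolding cotangent_space_simps by blast
    then obtain rep where rep: "\<And>X. X \<in> B \<Longrightarrow> rep X \<in> \<mm>" "\<And>X. X \<in> B \<Longrightarrow> X = cot (rep X)" by metis
    have "rep ` B \<subseteq> carrier RR" using rep(1) \<mm>_carrier by auto
    then obtain G where G: "generated R RR (card (rep ` B)) G" "rep ` B \<subseteq> G"
      "\<And>W. submodule R W RR \<Longrightarrow> rep ` B \<subseteq> W \<Longrightarrow> G \<subseteq> W"
      using RR.finite_set_generates[of "rep ` B"] B(1) by auto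
    have sG: "submodule R G RR" using RR.submodule_generated G(1) by blast
    have Gm: "G \<subseteq> \<mm>" using G(3)[OF submodule_RR(1)] rep(1) by blast
    have Wsub: "submodule K (cot ` G) V"
      unfolding submodule_def
    proof (intro conjI allI impI)
      show "Module.module K V" by (rule V.module_axioms)
      show "cot ` G \<subseteq> carrier V" using Gm unfolding cotangent_space_simps by blast
      show "\<zero>\<^bsub>V\<^esub> \<in> cot ` G" using submoduleD(4)[OF sG] unfolding cot_zero by auto
      fix X Y assume "X \<in> cot ` G" "Y \<in> cot ` G"
      then obtain x y where xy: "x \<in> G" "y \<in> G" "X = cot x" "Y = cot y" by blast
      have "X \<oplus>\<^bsub>V\<^esub> Y = cot (x \<oplus> y)" using xy Gm cot_add by blast
      moreover have "x \<oplus> y \<in> G" using submoduleD(3)[OF sG xy(1,2)] by simp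
      ultimately show "X \<oplus>\<^bsub>V\<^esub> Y \<in> cot ` G" by blast
    next
      fix D X assume "D \<in> carrier K" "X \<in> cot ` G"
      then obtain a x where ax: "a \<in> carrier R" "D = res a" "x \<in> G" "X = cot x"
        unfolding residue_field_simps by blast
      have "D \<odot>\<^bsub>V\<^esub> X = cot (a \<otimes> x)" using ax Gm cot_smult by blast
      moreover have "a \<otimes> x \<in> G" using submoduleD(5)[OF sG ax(1,3)] by simp
      ultimately show "D \<odot>\<^bsub>V\<^esub> X \<in> cot ` G" by blast
    qed
    have "B \<subseteq> cot ` G" using rep(2) G(2) by blast
    then have "carrier V \<subseteq> cot ` G" using V.span_is_subset[OF _ Wsub] B(3) by blast
    have "\<mm> \<subseteq> \<mm>2 <+>\<^bsub>RR\<^esub> G"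
    proof
      fix x assume x: "x \<in> \<mm>"
      then have "cot x \<in> cot ` G" using \<open>carrier V \<subseteq> cot ` G\<close> unfolding cotangent_space_simps by blast
      then obtain g where g: "g \<in> G" "cot x = cot g" by blast
      have "g \<in> carrier RR" "x \<in> carrier RR" using g(1) x Gm \<mm>_carrier by auto
      then obtain t where "t \<in> \<mm>2" "x = t \<oplus>\<^bsub>RR\<^esub> g" using RR.coset_eq_iff[OF submodule_RR(2), of x g] g(2) by auto
      then show "x \<in> \<mm>2 <+>\<^bsub>RR\<^esub> G" using g(1) by (metis set_addI)
    qed
    then have "ilen R RR \<mm>2 \<mm> \<le> ilen R RR \<mm>2 (\<mm>2 <+>\<^bsub>RR\<^esub> G)" by (intro ilen_mono) auto
    also have "\<dots> = ilen R RR (G \<inter> \<mm>2) G" by (rule RR.ilen_second_iso[OF submodule_RR(2) sG])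
    also have "\<dots> \<le> ilen R RR (scale R RR \<mm> G) (scale R RR (carrier R) G)"
    proof (rule ilen_mono)
      have "scale R RR \<mm> G \<subseteq> \<mm>2"
        using Gm mult_\<mm>_\<mm> by (intro RR.scale_least[OF submodule_RR(2)]) auto
      moreover have "scale R RR \<mm> G \<subseteq> G" using RR.scale_subset[OF \<mm>_carrier sG] .
      ultimately show "scale R RR \<mm> G \<subseteq> G \<inter> \<mm>2" by blast
      show "G \<subseteq> scale R RR (carrier R) G" using RR.scale_carrier[OF sG] by simp
    qed
    also have "\<dots> \<le> enat (card (rep ` B)) * ilen R RR \<mm> (carrier R)"
      by (rule RR.ilen_scale_generated_le[OF submodule_RR(1,3) \<mm>_carrier G(1)])
    finally have "embdim \<le> card (rep ` B)" by (simp add: ilen_\<mm>_carrier ilen_\<mm>2_\<mm>)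
    then show ?thesis using card_image_le[OF B(1), of rep] by simp
  qed
  have "card A = embdim" using lower[OF A(1,3) spanA] A(2) by simp
  show ?thesis
    unfolding V.dim_def
  proof (rule Least_equality)
    show "\<exists>B. finite B \<and> card B = embdim \<and> B \<subseteq> carrier V \<and> V.span B = carrier V"
      using A(1,3) spanA \<open>card A = embdim\<close> by blast
    show "embdim \<le> n" if "\<exists>B. finite B \<and> card B = n \<and> B \<subseteq> carrier V \<and> V.span B = carrier V" for n
      using that lower by blast
  qed
qed

end

section \<open>The socle of a free module\<close>
context Module.module begin

lemma lincomb_in_submodule:
  assumes W: "submodule R W M" and "finite B" "B \<subseteq> carrier M" "a \<in> B \<rightarrow> carrier R"
    and "\<And>v. v \<in> B \<Longrightarrow> a v \<odot>\<^bsub>M\<^esub> v \<in> W"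
  shows "lincomb a B \<in> W"
  using assms(2-)
proof (induction B rule: finite_induct)
  case empty
  then show ?case using submoduleD(4)[OF W] by (simp add: lincomb_def)
next
  case (insert x B)
  have "lincomb a (insert x B) = a x \<odot>\<^bsub>M\<^esub> x \<oplus>\<^bsub>M\<^esub> lincomb a B"
    unfolding lincomb_def using insert.hyps insert.prems by (intro M.finsum_insert) auto
  then show ?case using insert submoduleD(3)[OF W] by simp
qed

end

context cube_zero_module begin

text \<open>
  Here coordinates are needed: an element of a free module is killed by \<open>\<mm>\<close> only if all its coordinates are.
\<close>
lemma socle_of_free:
  assumes free: "fg_free_module R M"
    and soc: "\<And>x. x \<in> carrier R \<Longrightarrow> (\<And>r. r \<in> \<mm> \<Longrightarrow> r \<otimes> x = \<zero>) \<Longrightarrow> x \<in> \<mm>2"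
    and y: "y \<in> carrier M" and my: "\<And>r. r \<in> \<mm> \<Longrightarrow> r \<odot>\<^bsub>M\<^esub> y = \<zero>\<^bsub>M\<^esub>"
  shows "y \<in> m2S (carrier M)"
proof -
  obtain B where B: "finite B" "B \<subseteq> carrier M" "\<not> lin_dep B" "span B = carrier M"
    using free by (auto simp: fg_free_module_def finite_basis_def)
  obtain a where a: "a \<in> B \<rightarrow> carrier R" "lincomb a B = y"
    using finite_in_span[OF B(1,2)] y B(4) by blast
  have "a v \<in> \<mm>2" if v: "v \<in> B" for v
  proof (rule soc)
    show "a v \<in> carrier R" using a(1) v by blast
    fix r assume r: "r \<in> \<mm>"
    then have rc: "r \<in> carrier R" using \<mm>_carrier by blast
    have "lincomb (\<lambda>v. r \<otimes> a v) B = r \<odot>\<^bsub>M\<^esub> lincomb a B"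
      using rc by (intro lincomb_smult B a)
    then have "lincomb (\<lambda>v. r \<otimes> a v) B = \<zero>\<^bsub>M\<^esub>" using a(2) my[OF r] by simp
    moreover have "(\<lambda>v. r \<otimes> a v) \<in> B \<rightarrow> carrier R" using a(1) rc by auto
    ultimately show "r \<otimes> a v = \<zero>" using B(1,3) v unfolding lin_dep_def by blast
  qed
  then have "lincomb a B \<in> m2S (carrier M)"
    using B a(1) by (intro lincomb_in_submodule submodule_m2S submodule_carrier scaleI) auto
  then show ?thesis using a(2) by simp
qed

end

section \<open>Ranks in a minimal acyclic complex\<close>

locale nonzero_minimal_acyclic_complex = minimal_acyclic_complex R \<mm> A d
  for R :: "('a, 'r) ring_scheme" (structure) and \<mm> :: "'a set"
    and A :: "int \<Rightarrow> ('a, 'b, 'c) module_scheme" and d :: "int \<Rightarrow> 'b \<Rightarrow> 'b" +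
  assumes square_nonzero: "\<mm>2 \<noteq> {\<zero>}" and nonzero: "nonzero_complex A" and not_gorenstein: "\<not> gorenstein R"
begin

lemma square_nonzeroD:
  assumes "\<And>s. s \<in> \<mm>2 \<Longrightarrow> s = \<zero>" shows False
proof -
  have "\<zero> \<in> \<mm>2" using submoduleD(4)[OF submodule_RR(2)] by simp
  then have "\<mm>2 = {\<zero>}" using assms by blast
  then show False using square_nonzero by contradiction
qed

lemma sqdim_pos: "sqdim > 0"
proof (rule ccontr)
  assume "\<not> sqdim > 0"
  then have "ilen R RR {\<zero>} \<mm>2 = 0" using ilen_0_\<mm>2 by (simp add: zero_enat_def)
  then show False
    using RR.ilen_eq_0_iff[OF submodule_RR(4,2)] submoduleD(4)[OF submodule_RR(2)] square_nonzero by simp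
qed

text \<open>
  The layers of \<open>Z\<^sub>i\<close> are bounded by the rank of \<open>A\<^sub>i\<close> from one side and by the rank of \<open>A\<^sub>i\<^sub>+\<^sub>1\<close> from the other. So a
  zero rank spreads in both directions.
\<close>
lemma b_eq_0_step: "b i = 0 \<longleftrightarrow> b (i + 1) = 0"
proof
  assume 0: "b i = 0"
  then have "z i + t i = 0" using z_t[of i] by simp
  moreover have "w i = 0" using w_z[of "i - 1"] 0 by simp
  ultimately show "b (i + 1) = 0" using t_w[of i] by simp
next
  assume "b (i + 1) = 0"
  then have "t i = 0" "w i = 0" using t_w[of i] by auto
  then have "sqdim * b i = 0" using z_t[of i] z_le[of i] by simp
  then show "b i = 0" using sqdim_pos by simp
qed

lemma b_pos: "b i > 0"
proof -
  obtain k where k: "b k \<noteq> 0" using nonzero b_eq_0_iff unfolding nonzero_complex_def by blast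
  have "b i \<noteq> 0"
  proof (induction i rule: int_induct[where k = k])
    case base show ?case by (rule k)
  next
    case (step1 i) then show ?case using b_eq_0_step[of i] by simp
  next
    case (step2 i) then show ?case using b_eq_0_step[of "i - 1"] by simp
  qed
  then show ?thesis by simp
qed

text \<open>
  The lengths \<open>w\<close> and \<open>z\<close> are eliminated from the counts for the layers of \<open>Z\<^sub>i\<close> and \<open>Z\<^sub>i\<^sub>+\<^sub>1\<close>. What remains besides the
  ranks are the error terms, which vanish at the indices without a socle generator.
\<close>
lemma rank_recurrence: "b (i + 1 + 1) + sqdim * b i = embdim * b (i + 1) + t (i + 1) + t i"
  using t_w[of "i + 1"] w_z[of i] z_t[of i] by linarith

lemma rank_lower_bound: "sqdim * b i + embdim * t i \<le> embdim * b (i + 1) + t i"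
proof -
  have "embdim * t i + embdim * w i = embdim * b (i + 1)" using t_w[of i] by (metis add_mult_distrib2)
  then show ?thesis using z_le[of i] z_t[of i] by linarith
qed

lemma not_strictly_increasing: "\<not> (\<forall>i. b i < b (i + 1))"
proof
  assume inc: "\<forall>i. b i < b (i + 1)"
  have "b (- int n) + n \<le> b 0" for n
  proof (induction n)
    case (Suc n)
    have "b (- int (Suc n)) < b (- int (Suc n) + 1)" using inc by blast
    also have "- int (Suc n) + 1 = - int n" by simp
    finally show ?case using Suc by simp
  qed simp
  from this[of "b 0"] b_pos[of "- int (b 0)"] show False by simp
qed

text \<open>
  To the left of an index below which the error terms vanish, the recurrence for the ranks is homogeneous.
\<close>
lemma constant_tail:
  assumes t0: "\<And>i. i < k \<Longrightarrow> t i = 0" and f: "sqdim \<ge> 2"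
  shows "embdim = sqdim + 1" and "\<And>i. i \<le> k \<Longrightarrow> b i = b k"
proof -
  define c where "c n = b (k - int n)" for n
  have pos: "c n > 0" for n unfolding c_def by (rule b_pos)
  have rec: "c n + sqdim * c (n + 2) = embdim * c (n + 1)" for n
  proof -
    define j where "j = k - int n - 2"
    have 1: "k - int n = j + 1 + 1" "k - int (n + 1) = j + 1" "k - int (n + 2) = j"
      unfolding j_def by simp_all
    have "t (j + 1) = 0" "t j = 0" unfolding j_def by (rule t0; simp)+
    then show ?thesis using rank_recurrence[of j] unfolding c_def 1 by simp
  qed
  show "embdim = sqdim + 1" by (rule recurrence_constant(2)[OF pos rec f])
  show "b i = b k" if "i \<le> k" for i
    using recurrence_constant(1)[OF pos rec f, of "nat (k - i)"] that unfolding c_def by simp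
qed

lemma ring_socle:
  assumes "\<not> socle_gen (i + 1)" and x: "x \<in> carrier R" "\<And>r. r \<in> \<mm> \<Longrightarrow> r \<otimes> x = \<zero>"
  shows "x \<in> \<mm>2"
proof -
  have "x \<in> \<mm>"
  proof (rule ccontr)
    assume "x \<notin> \<mm>"
    then obtain y where y: "y \<in> carrier R" "y \<otimes> x = \<one>" using unit_if_not_mem[OF x(1)] by blast
    have "s = \<zero>" if s: "s \<in> \<mm>" for s
    proof -
      have sc: "s \<in> carrier R" using s \<mm>_carrier by blast
      have "s = s \<otimes> (y \<otimes> x)" using y sc by simp
      also have "\<dots> = y \<otimes> (s \<otimes> x)" using y(1) sc x(1) by algebra
      finally show ?thesis using x(2)[OF s] y(1) by simp
    qed
    then show False using \<mm>2_subset by (intro square_nonzeroD) blast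
  qed
  then show ?thesis using ring_socle_subset[OF assms(1) b_pos _ x(2)] by blast
qed

text \<open>
  If \<open>\<mm>/\<mm>\<^sup>2\<close> has dimension one, a socle element outside \<open>\<mm>\<^sup>2\<close> would generate \<open>\<mm>\<close> modulo \<open>\<mm>\<^sup>2\<close>, and then \<open>\<mm>\<^sup>2 = 0\<close>.
\<close>
lemma simple_socle_if_embdim_1:
  assumes e: "embdim = 1" and f: "sqdim = 1" shows simple_socle
  unfolding simple_socle_def
proof (intro conjI ballI impI f)
  fix x assume x: "x \<in> \<mm>" and mx: "\<forall>r\<in>\<mm>. r \<otimes> x = \<zero>"
  have xc: "x \<in> carrier R" using x \<mm>_carrier by blast
  show "x \<in> \<mm>2"
  proof (rule ccontr)
    assume nx: "x \<notin> \<mm>2"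
    have c0: "cube_zero_module R \<mm> RR"
      by (intro cube_zero_module.intro cube_zero_local_ring_axioms module_ring_as_module)
    let ?C = "cyclic_submodule R RR x"
    have C: "submodule R ?C RR" using RR.submodule_cyclic xc by simp
    let ?J = "\<mm>2 <+>\<^bsub>RR\<^esub> ?C"
    have J: "submodule R ?J RR" by (intro RR.submodule_set_add C submodule_RR)
    have Jm: "?J \<subseteq> \<mm>"
      using RR.cyclic_least[OF submodule_RR(1) x] \<mm>2_subset by (intro RR.set_add_least submodule_RR)
    have "ilen R RR \<mm>2 ?J = 1"
      using cube_zero_module.ilen_add_cyclic[OF c0 submodule_RR(2), of x] xc nx mult_\<mm>_\<mm>[OF _ x] by simp
    then have "ilen R RR ?J \<mm> = 0"
      using RR.ilen_add[OF submodule_RR(2) J submodule_RR(1) _ Jm] RR.set_add_upper(1)[OF submodule_RR(2) C]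
        ilen_\<mm>2_\<mm> e by (cases "ilen R RR ?J \<mm>") (auto simp: one_enat_def zero_enat_def)
    then have "?J = \<mm>" using RR.ilen_eq_0_iff[OF J submodule_RR(1) Jm] by simp
    have zero: "u \<otimes> v = \<zero>" if u: "u \<in> \<mm>" and v: "v \<in> \<mm>" for u v
    proof -
      have "v \<in> ?J" using v \<open>?J = \<mm>\<close> by simp
      then obtain s r where sr: "s \<in> \<mm>2" "r \<in> carrier R" "v = s \<oplus> r \<otimes> x"
        by (auto elim!: set_addE simp: cyclic_submodule_def)
      have c: "u \<in> carrier R" "s \<in> carrier R" using u sr \<mm>_carrier \<mm>2_carrier by auto
      have "u \<otimes> v = u \<otimes> s \<oplus> r \<otimes> (u \<otimes> x)" unfolding sr(3) using c sr(2) xc by algebra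
      then show ?thesis using mult_\<mm>_\<mm>2[OF u sr(1)] mx u sr(2) by simp
    qed
    have "s = \<zero>" if "s \<in> \<mm>2" for s
      using that by (induction rule: ideal_prod.induct) (simp_all add: zero)
    then show False by (rule square_nonzeroD)
  qed
qed

lemma embdim_pos: "embdim > 0"
proof (rule ccontr)
  assume "\<not> embdim > 0"
  then have "ilen R RR \<mm>2 \<mm> = 0" using ilen_\<mm>2_\<mm> by (simp add: zero_enat_def)
  then have "\<mm>2 = \<mm>" using RR.ilen_eq_0_iff[OF submodule_RR(2,1) \<mm>2_subset] by simp
  then have "\<mm>2 = ideal_prod R \<mm> \<mm>2" by (rule arg_cong[OF sym])
  then show False using square_nonzero unfolding cube_zero by blast
qed

text \<open>
  For \<open>f > e\<close> the lower bound on the ranks makes them strictly increasing on all of \<open>\<int>\<close>. For \<open>f = e \<ge> 2\<close> they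
  are nondecreasing, hence constant to the left of some index; there the error terms vanish, and the recurrence
  would force \<open>e = f + 1\<close>. For \<open>f = e = 1\<close> the ring is Gorenstein.
\<close>
lemma sqdim_less_embdim: "sqdim < embdim"
proof (rule ccontr)
  assume "\<not> sqdim < embdim"
  then consider "sqdim > embdim" | "embdim = 1" "sqdim = 1" | "embdim \<ge> 2" "sqdim = embdim"
    using embdim_pos by linarith
  then show False
  proof cases
    case 1
    have "b i < b (i + 1)" for i
    proof -
      have "t i \<le> embdim * t i" using embdim_pos by simp
      then have "sqdim * b i \<le> embdim * b (i + 1)" using rank_lower_bound[of i] by linarith
      moreover have "embdim * b i < sqdim * b i" using 1 b_pos[of i] by simp
      ultimately have "embdim * b i < embdim * b (i + 1)" by linarith
      then show ?thesis by simp
    qed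
    then show False using not_strictly_increasing by blast
  next
    case 2
    then show False using gorenstein_if_simple_socle[OF simple_socle_if_embdim_1] not_gorenstein by blast
  next
    case 3
    have step: "b i + t i \<le> b (i + 1) \<or> (t i > 0 \<and> b i < b (i + 1))" for i
    proof -
      have "embdim * b i + embdim * t i \<le> embdim * b (i + 1) + t i" using rank_lower_bound[of i] 3 by simp
      moreover have "2 * t i \<le> embdim * t i" using 3 by simp
      ultimately have *: "embdim * b i + t i \<le> embdim * b (i + 1)" by linarith
      show ?thesis
      proof (cases "t i = 0")
        case True
        then have "b i \<le> b (i + 1)" using * 3 by simp
        then show ?thesis using True by simp
      next
        case False
        then have "embdim * b i < embdim * b (i + 1)" using * by linarith
        then show ?thesis using False by simp
      qed
    qed
    have mono: "b i \<le> b (i + 1)" for i using step[of i] by linarith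
    obtain k where k: "\<And>i. b k \<le> b i" using ex_has_least_nat[of "\<lambda>_. True" 0 b] by auto
    have bk: "b (k - int n) = b k" for n
    proof (induction n)
      case (Suc n)
      have "b (k - int (Suc n)) \<le> b (k - int (Suc n) + 1)" by (rule mono)
      also have "k - int (Suc n) + 1 = k - int n" by simp
      finally show ?case using Suc k[of "k - int (Suc n)"] by simp
    qed simp
    have "t i = 0" if "i < k" for i
    proof -
      have "b i = b k" using bk[of "nat (k - i)"] that by simp
      moreover have "b (i + 1) = b k" using bk[of "nat (k - i - 1)"] that by (simp add: algebra_simps)
      ultimately show ?thesis using step[of i] by linarith
    qed
    then have "embdim = sqdim + 1" using constant_tail(1)[of k] 3 by simp
    then show False using 3 by simp
  qed
qed

text \<open>
  A socle generator far to the left would make the rank of \<open>A\<^sub>0\<close> too large.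
\<close>
lemma socle_gen_bounded_below: "socle_gen i \<Longrightarrow> i \<ge> - int (b 0)"
  using socle_gen_growth[OF _ sqdim_less_embdim sqdim_pos, of i "nat (- i - 1)"]
  by (cases "i < 0") auto

lemma exists_no_socle_gen: "\<exists>i. \<not> socle_gen (i + 1)"
  using socle_gen_bounded_below[of "- int (b 0) - 2 + 1"] by (intro exI[of _ "- int (b 0) - 2"]) auto

lemma sqdim_ge_2: "sqdim \<ge> 2"
proof (rule ccontr)
  assume "\<not> sqdim \<ge> 2"
  then have "sqdim = 1" using sqdim_pos by simp
  moreover obtain i where "\<not> socle_gen (i + 1)" using exists_no_socle_gen by blast
  ultimately have simple_socle unfolding simple_socle_def using ring_socle \<mm>_carrier by blast
  then show False using gorenstein_if_simple_socle not_gorenstein by blast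
qed

text \<open>
  If \<open>\<mm>Z\<^sub>i = \<mm>\<^sup>2A\<^sub>i\<close>, then every element of \<open>Z\<^sub>i\<close> killed by \<open>\<mm>\<close> lies in \<open>\<mm>Z\<^sub>i\<close>, because the socle of the ring, and with it
  that of \<open>A\<^sub>i\<close>, is contained in the square of the maximal ideal.
\<close>
lemma t_pos: "socle_gen i \<Longrightarrow> t i > 0"
proof (rule ccontr)
  assume "socle_gen i" and "\<not> t i > 0"
  then have "ilen R (A i) (mZ i) (m2A i) = 0" using ilen_t[of i] by (simp add: zero_enat_def)
  then have eq: "mZ i = m2A i" using A.ilen_eq_0_iff[OF submodules(4,2) mZ_subset_m2A] by blast
  obtain y where y: "y \<in> Z i" "y \<notin> mZ i" "\<And>r. r \<in> \<mm> \<Longrightarrow> r \<odot>\<^bsub>A i\<^esub> y = \<zero>\<^bsub>A i\<^esub>"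
    using \<open>socle_gen i\<close> unfolding socle_gen_def by blast
  obtain j where j: "\<not> socle_gen (j + 1)" using exists_no_socle_gen by blast
  have yc: "y \<in> carrier (A i)" using y(1) submoduleD(2)[OF submodule_Z] by blast
  have "y \<in> m2A i"
  proof (rule A.socle_of_free[OF fg_free _ yc y(3)])
    show "x \<in> \<mm>2" if "x \<in> carrier R" "\<And>r. r \<in> \<mm> \<Longrightarrow> r \<otimes> x = \<zero>" for x
      by (rule ring_socle[OF j that])
  qed
  then show False using y(2) eq by simp
qed

lemma coker_length:
  assumes t0: "\<And>i. i < k \<Longrightarrow> t i = 0" and i: "i \<le> k"
  shows "module_length R (coker A d (i + 2)) = enat (b k * embdim)"
proof -
  have e: "embdim = sqdim + 1" by (rule constant_tail(1)[OF t0 sqdim_ge_2])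
  have bi: "b i = b k" by (rule constant_tail(2)[OF t0 sqdim_ge_2 i])
  have "i - 1 \<le> k" "i - 1 < k" using i by auto
  then have "b (i - 1) = b k" "t (i - 1) = 0" using constant_tail(2)[OF t0 sqdim_ge_2] t0 by blast+
  then have "z (i - 1) = sqdim * b k" using z_t[of "i - 1"] by simp
  moreover have "w i + z (i - 1) = embdim * b i" using w_z[of "i - 1"] unfolding diff_add_cancel .
  ultimately have "w i + sqdim * b k = (sqdim + 1) * b k" unfolding e bi by simp
  then have "w i = b k" by simp
  moreover have "b (i + 1) = t i + w i" using t_w[of i] by simp
  moreover have "z i + t i = sqdim * b k" using z_t[of i] unfolding bi .
  moreover have "b k * embdim = b k + sqdim * b k" unfolding e by simp
  ultimately have "b (i + 1) + z i = b k * embdim" by linarith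
  then show ?thesis unfolding module_length_coker by simp
qed

text \<open>
  The error term \<open>t\<^sub>k > 0\<close> makes the ranks jump after the constant part. From then on \<open>e = f + 1\<close> turns the
  recurrence into \<open>b\<^sub>i\<^sub>+\<^sub>2 - b\<^sub>i\<^sub>+\<^sub>1 \<ge> f (b\<^sub>i\<^sub>+\<^sub>1 - b\<^sub>i)\<close>, which propagates the increase.
\<close>
lemma rank_strictly_increasing:
  assumes t0: "\<And>i. i < k \<Longrightarrow> t i = 0" and tk: "t k > 0" and i: "i \<ge> k"
  shows "b (i + 1) > b i"
  using i
proof (induction i rule: int_ge_induct)
  have e: "embdim = sqdim + 1" by (rule constant_tail(1)[OF t0 sqdim_ge_2])
  case base
  have bk: "b (k - 1) = b k" by (rule constant_tail(2)[OF t0 sqdim_ge_2]) simp_all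
  have "b (k + 1) + sqdim * b (k - 1) = embdim * b k + t k + t (k - 1)"
    using rank_recurrence[of "k - 1"] unfolding diff_add_cancel .
  then have "b (k + 1) + sqdim * b k = sqdim * b k + b k + t k + t (k - 1)" unfolding e bk by simp
  then show ?case using tk by linarith
next
  have e: "embdim = sqdim + 1" by (rule constant_tail(1)[OF t0 sqdim_ge_2])
  case (step i)
  have "sqdim * b i < sqdim * b (i + 1)" using step.IH sqdim_pos by simp
  moreover have "b (i + 1 + 1) + sqdim * b i = sqdim * b (i + 1) + b (i + 1) + t (i + 1) + t i"
    using rank_recurrence[of i] unfolding e by simp
  ultimately show ?case by linarith
qed

lemma ranks_without_socle_gen:
  assumes no: "\<And>i. \<not> socle_gen i"
  shows "b i = b 0" "module_length R (coker A d i) = enat (b 0 * embdim)"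
proof -
  have t0: "t i = 0" for i by (rule t_eq_0[OF no])
  have const: "b i = b 0" for i
    using constant_tail(2)[OF _ sqdim_ge_2, of "max i 0" i] constant_tail(2)[OF _ sqdim_ge_2, of "max i 0" 0] t0 by simp
  then show "b i = b 0" .
  have "module_length R (coker A d (i - 2 + 2)) = enat (b (i - 2) * embdim)"
    by (rule coker_length[OF t0]) simp
  then show "module_length R (coker A d i) = enat (b 0 * embdim)" using const[of "i - 2"] by simp
qed

lemma first_socle_gen:
  assumes "socle_gen j"
  shows "\<exists>k. socle_gen k \<and> (\<forall>i<k. \<not> socle_gen i)"
proof -
  obtain k where k: "socle_gen k" "\<And>i. socle_gen i \<Longrightarrow> nat (k + int (b 0)) \<le> nat (i + int (b 0))"
    using ex_has_least_nat[of socle_gen j "\<lambda>i. nat (i + int (b 0))"] assms by blast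
  have "\<not> socle_gen i" if "i < k" for i
    using k(2)[of i] socle_gen_bounded_below[of i] that by auto
  then show ?thesis using k(1) by blast
qed

end

theorem theoremB:
  fixes R :: "('a, 'r) ring_scheme"
    and \<mm> :: "'a set"
    and A :: "int \<Rightarrow> ('a, 'b, 'c) module_scheme"
    and d :: "int \<Rightarrow> 'b \<Rightarrow> 'b"
    and e :: nat
  assumes local_ring: "noetherian_local_ring R \<mm>"
    and not_gorenstein: "\<not> gorenstein R"
    and cube_zero: "ideal_prod R \<mm> (ideal_prod R \<mm> \<mm>) = {\<zero>\<^bsub>R\<^esub>}"
    and square_nonzero: "ideal_prod R \<mm> \<mm> \<noteq> {\<zero>\<^bsub>R\<^esub>}"
    and e_def: "e = vectorspace.dim (R Quot \<mm>) (cotangent_space R \<mm>)"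
    and complex: "fg_free_complex R A d"
    and nonzero: "nonzero_complex A"
    and minimal: "minimal_complex R \<mm> A d"
    and acyclic: "acyclic_complex A d"
  shows
    "((\<forall>i. \<not> is_direct_summand R (residue_module R \<mm>) (coker A d i)) \<and>
      (\<exists>a>0. (\<forall>i. free_rank R (A i) = a) \<and>
             (\<forall>i. module_length R (coker A d i) = enat (a * e))))
   \<or> (\<exists>\<kappa>.
        is_direct_summand R (residue_module R \<mm>) (coker A d (\<kappa> + 2)) \<and>
        (\<forall>i<\<kappa>. \<not> is_direct_summand R (residue_module R \<mm>) (coker A d (i + 2))) \<and>
        (\<exists>a>0. (\<forall>i\<le>\<kappa>. free_rank R (A i) = a) \<and>
               (\<forall>i\<ge>\<kappa>. free_rank R (A (i + 1)) > free_rank R (A i)) \<and>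
               (\<forall>i\<le>\<kappa>. module_length R (coker A d (i + 2)) = enat (a * e))))"
proof -
  interpret cube_zero_local_ring R \<mm> using local_ring cube_zero by unfold_locales
  interpret nonzero_minimal_acyclic_complex R \<mm> A d
    using complex minimal acyclic square_nonzero nonzero not_gorenstein by unfold_locales
  have e: "e = embdim" using e_def dim_cotangent by simp
  have summand: "is_direct_summand R (residue_module R \<mm>) (coker A d i) \<longleftrightarrow> socle_gen (i - 2)" for i
    using residue_summand_iff[of "i - 2"] by simp
  show ?thesis
  proof (cases "\<exists>j. socle_gen j")
    case False
    then have no: "\<And>i. \<not> socle_gen i" by blast
    have "\<forall>i. free_rank R (A i) = b 0" using ranks_without_socle_gen(1)[OF no] unfolding b_def by blast
    moreover have "\<forall>i. module_length R (coker A d i) = enat (b 0 * e)"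
      using ranks_without_socle_gen(2)[OF no] unfolding e by blast
    ultimately show ?thesis using no b_pos[of 0] unfolding summand by blast
  next
    case True
    then obtain k where k: "socle_gen k" "\<And>i. i < k \<Longrightarrow> \<not> socle_gen i" using first_socle_gen by blast
    have t0: "t i = 0" if "i < k" for i by (rule t_eq_0[OF k(2)[OF that]])
    have "\<forall>i\<le>k. free_rank R (A i) = b k" using constant_tail(2)[OF t0 sqdim_ge_2] unfolding b_def by blast
    moreover have "\<forall>i\<ge>k. free_rank R (A (i + 1)) > free_rank R (A i)"
      using rank_strictly_increasing[OF t0 t_pos[OF k(1)]] unfolding b_def by blast
    moreover have "\<forall>i\<le>k. module_length R (coker A d (i + 2)) = enat (b k * e)"
      using coker_length[OF t0] unfolding e by blast
    ultimately show ?thesis using k b_pos[of k] residue_summand_iff by blast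
  qed
qed

end
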